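(* Let $p\in[1,\infty]$ and assume one of the following holds: (i) $\gamma\in(0,1)$ and $b\in(-\infty,1)$; (ii) $\gamma=1$ and $b\in(-\infty,1)\setminus\mathcal{E}_p$; (iii) $\gamma>1$ and $b\in(-\infty,0)$. Let $\mathcal{U}_N$ be the uniform measure on $\{1,\dots,N\}$. Then the random rooted graph $(G_N,\mathcal{O}_N)$ sampled from $\mathbb{P}^{b,p}_{N,\gamma}\otimes\mathcal{U}_N$ converges in distribution, as $N\to\infty$, to the random rooted graph $(G,\mathcal{O})$ sampled from $\mathbb{P}_\gamma\otimes\delta_{\{0\}}$.
   Context: $\mathcal{G}$ is the set of locally finite graphs $g=(V,E)$ with $V\subset\mathbb{Z}$; $d_g(x,y)$ denotes graph distance in $g$. For a finite $g=(V,E)\in\mathcal{G}$ with $N=|V|$, define $\mathcal{H}_p(g)=\big(\binom{N}{2}^{-1}\sum_{x,y\in V,\,x<y}d_g(x,y)^p\big)^{1/p}$ for $p\in[1,\infty)$ and $\mathcal{H}_\infty(g)=\sup\{d_g(x,y):x,y\in V\}$. For $N\ge1$ and $\gamma>0$, $\mathbb{P}_{N,\gamma}$ is the law of the random graph $G_N$ with vertex set $[N]=\{1,\dots,N\}$ which contains every edge $\{x,y\}$ with $|x-y|=1$, and in which each pair $\{x,y\}\subset[N]$ with $|x-y|>1$ is an edge independently with probability $\exp\{-|x-y|^\gamma\}$. For $b\in\mathbb{R}$, $p\in[1,\infty]$, $\mathbb{P}^{b,p}_{N,\gamma}(g)=\frac{1}{Z^{b,p}_{N,\gamma}}\exp\{-N^b\mathcal{H}_p(g)\}\mathbb{P}_{N,\gamma}(g)$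 with $Z^{b,p}_{N,\gamma}$ the normalizing constant. $\mathbb{P}_\gamma$ is the analogous law of a random graph $G$ on vertex set $\mathbb{Z}$: all edges $\{x,x+1\}$ present, and each $\{x,y\}$ with $|x-y|>1$ present independently with probability $\exp\{-|x-y|^\gamma\}$. For $p<\infty$, $\mathcal{E}_p=\bigcup_{k=1}^\infty\big[\frac{k-1}{k},\frac{k-1}{k}+\big(0\vee\frac{2p-(p-1)k}{k(k+1)(k+2p)}\big)\big]$; for $p=\infty$, $\mathcal{E}_\infty=[0,\frac14]\cup\bigcup_{k\ge2}\{\frac{k-1}{k}\}$. A rooted graph is a pair $(g,o)$ with $g\in\mathcal{G}$ and $o$ a vertex of $g$. Write $(g,o)\simeq(g',o')$ if the translation $x\mapsto x-o+o'$ maps $g$ (vertices and edges) exactly onto $g'$. The ball $B_{(g,o)}(R)$ is the rooted graph $(g_R,o)$ where $g_R$ has vertex set $\{x:d_g(o,x)\le R\}$ and all edges of $g$ with both endpoints in that set. Random rooted graphs $(G_n,\mathcal{O}_n)$ converge in distribution to $(G,\mathcal{O})$ if for every $R>0$ and every deterministic rooted graph $(g,o)$, $P(B_{(G_n,\mathcal{O}_n)}(R)\simeq(g,o))\to P(B_{(G,\mathcal{O})}(R)\simeq(g,o))$. *)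

theory Defs
  imports "HOL-Probability.Probability"
begin

type_synonym graph = "int set \<times> int set set"

definition is_graph :: "graph \<Rightarrow> bool" where
  "is_graph g \<longleftrightarrow>
     (\<forall>e\<in>snd g. \<exists>x y. x \<noteq> y \<and> x \<in> fst g \<and> y \<in> fst g \<and> e = {x, y}) \<and>
     (\<forall>x\<in>fst g. finite {y. {x, y} \<in> snd g})"

definition walk :: "int set set \<Rightarrow> int list \<Rightarrow> bool" where
  "walk E xs \<longleftrightarrow> xs \<noteq> [] \<and> (\<forall>i. Suc i < length xs \<longrightarrow> {xs ! i, xs ! Suc i} \<in> E)"

text \<open>Graph distance (infinite if no path).\<close>
definition gdist :: "graph \<Rightarrow> int \<Rightarrow> int \<Rightarrow> enat" where
  "gdist g x y = (INF xs \<in> {xs. walk (snd g) xs \<and> hd xs = x \<and> last xs = y \<and> x \<in> fst g}.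
                    enat (length xs - 1))"

text \<open>The energy H_p; p ranges over [1,\<infinity>] encoded as an extended real.\<close>
definition Hp :: "ereal \<Rightarrow> graph \<Rightarrow> real" where
  "Hp p g = (case p of
      ereal q \<Rightarrow>
        ((\<Sum>(x, y)\<in>{(x, y). x \<in> fst g \<and> y \<in> fst g \<and> x < y}.
              real (the_enat (gdist g x y)) powr q)
           / real (card (fst g) choose 2)) powr (1 / q)
    | PInfty \<Rightarrow> Sup {real (the_enat (gdist g x y)) | x y. x \<in> fst g \<and> y \<in> fst g}
    | MInfty \<Rightarrow> 0)"

definition ball_graph :: "graph \<Rightarrow> int \<Rightarrow> real \<Rightarrow> graph" where
  "ball_graph g r R =
     (let W = {x \<in> fst g. \<exists>n::nat. gdist g r x = enat n \<and> real n \<le> R}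
      in (W, {e \<in> snd g. e \<subseteq> W}))"

definition rooted_iso :: "graph \<times> int \<Rightarrow> graph \<times> int \<Rightarrow> bool" where
  "rooted_iso a b =
     (let t = (\<lambda>x. x - snd a + snd b)
      in t ` fst (fst a) = fst (fst b) \<and> (\<lambda>e. t ` e) ` snd (fst a) = snd (fst b))"

definition conn_prob :: "real \<Rightarrow> int \<Rightarrow> int \<Rightarrow> real" where
  "conn_prob \<gamma> x y = exp (- (real_of_int \<bar>y - x\<bar> powr \<gamma>))"

text \<open>Long-range pairs (x<y, |x-y|>1) within [N]; the graph G_N is encoded by the set S
  of long-range pairs that are edges.\<close>
definition LR :: "nat \<Rightarrow> (int \<times> int) set" where
  "LR N = {(x, y). 1 \<le> x \<and> y \<le> int N \<and> x + 1 < y}"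

definition fin_graph :: "nat \<Rightarrow> (int \<times> int) set \<Rightarrow> graph" where
  "fin_graph N S = ({1..int N},
      {{x, x + 1} | x. 1 \<le> x \<and> x + 1 \<le> int N} \<union> {{x, y} | x y. (x, y) \<in> S})"

definition PN :: "nat \<Rightarrow> real \<Rightarrow> (int \<times> int) set \<Rightarrow> real" where
  "PN N \<gamma> S = (\<Prod>(x, y)\<in>LR N. if (x, y) \<in> S then conn_prob \<gamma> x y else 1 - conn_prob \<gamma> x y)"

definition tilt_weight :: "nat \<Rightarrow> real \<Rightarrow> real \<Rightarrow> ereal \<Rightarrow> (int \<times> int) set \<Rightarrow> real" where
  "tilt_weight N \<gamma> b p S = exp (- (real N powr b * Hp p (fin_graph N S))) * PN N \<gamma> S"

definition Zfun :: "nat \<Rightarrow> real \<Rightarrow> real \<Rightarrow> ereal \<Rightarrow> real" where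
  "Zfun N \<gamma> b p = (\<Sum>S\<in>Pow (LR N). tilt_weight N \<gamma> b p S)"

definition fin_ball_prob :: "nat \<Rightarrow> real \<Rightarrow> real \<Rightarrow> ereal \<Rightarrow> real \<Rightarrow> graph \<Rightarrow> int \<Rightarrow> real" where
  "fin_ball_prob N \<gamma> b p R g r =
     (\<Sum>S\<in>Pow (LR N). tilt_weight N \<gamma> b p S / Zfun N \<gamma> b p *
        (real (card {v \<in> {1..int N}. rooted_iso (ball_graph (fin_graph N S) v R, v) (g, r)}) / real N))"

definition LRZ :: "(int \<times> int) set" where
  "LRZ = {(x, y). x + 1 < y}"

definition edge_space :: "real \<Rightarrow> (int \<times> int \<Rightarrow> bool) measure" where
  "edge_space \<gamma> = PiM LRZ (\<lambda>(x, y). measure_pmf (bernoulli_pmf (conn_prob \<gamma> x y)))"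

definition inf_graph :: "(int \<times> int \<Rightarrow> bool) \<Rightarrow> graph" where
  "inf_graph \<omega> = (UNIV, {{x, x + 1} | x. True} \<union> {{x, y} | x y. (x, y) \<in> LRZ \<and> \<omega> (x, y)})"

definition inf_ball_prob :: "real \<Rightarrow> real \<Rightarrow> graph \<Rightarrow> int \<Rightarrow> real" where
  "inf_ball_prob \<gamma> R g r =
     measure (edge_space \<gamma>)
       {\<omega> \<in> space (edge_space \<gamma>). rooted_iso (ball_graph (inf_graph \<omega>) 0 R, 0) (g, r)}"

definition Eset :: "ereal \<Rightarrow> real set" where
  "Eset p = (case p of
      ereal q \<Rightarrow> (\<Union>k\<in>{1::nat..}. {(real k - 1) / real k ..
          (real k - 1) / real k +
            max 0 ((2 * q - (q - 1) * real k) / (real k * (real k + 1) * (real k + 2 * q)))})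
    | PInfty \<Rightarrow> {0..1/4} \<union> {(real k - 1) / real k | k::nat. k \<ge> 2}
    | MInfty \<Rightarrow> {})"

end

theory Submission
  imports Defs "HOL-Real_Asymp.Real_Asymp"
begin

text \<open>
  The number of vertices whose ball is isomorphic to a given rooted graph changes by a bounded amount
  when one edge is switched, so under the product measure it deviates from its mean by order \<open>N\<close> only
  with probability exponentially small in \<open>N\<close>. If the partition function decays slower than
  exponentially, tilting cannot change this. This covers \<open>\<gamma> < 1\<close> and \<open>b < 0\<close>: a hierarchy of \<open>k\<close> layers
  of long edges gives diameter of order \<open>N powr (1 / (k + 1))\<close>, at cost \<open>o(N)\<close> for \<open>\<gamma> < 1\<close>.

  For \<open>\<gamma> = 1\<close> and \<open>(k - 1) / k < b < k / (k + 1)\<close> the same construction costs \<open>k N\<close>, and this is sharp up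
  to \<open>o(N)\<close>: when the long edges have total length at most \<open>(k - \<epsilon>) N\<close>, a positive fraction of the cuts
  is crossed at most \<open>k\<close> times; after contracting all other cuts, balls of radius \<open>h\<close> have at most
  \<open>(2 h + 1) ^ k\<close> vertices, so typical distances are at least of order \<open>N powr (1 / k)\<close> and the energy
  is much larger than \<open>N\<close>. Hence only configurations with total long edge length about \<open>k N\<close> matter, and
  under the product measure having such a length together with atypical local statistics is
  exponentially less likely than \<open>exp (- k N)\<close>.
\<close>

section \<open>Product Bernoulli measures on subsets of a finite set\<close>

text \<open>The cutoff \<open>L\<close> in \<open>long_len\<close> reconciles two demands. Rewarding
  each edge of length l by exp(\<theta> l), with \<theta> just below 1, raises the exponent of the
  moment bound by a multiple of N times the sum of (exp(\<theta> l) - 1) exp(- l). The gain from a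
  deviation of the local statistics is also of order N, with a small constant, so only a tail of
  this series is affordable: short edges must not be rewarded. In the geometric estimate edges of
  length at most \<open>L\<close> shorten distances by at most the factor \<open>L\<close>, which
  leaves the exponent 1/k intact. Hence that estimate is proved for every \<open>L\<close>, and the
  probabilistic part chooses \<open>L\<close>.

  The window for b comes from comparing energies with N: the hierarchy has energy of order N^(b +
  1/(k+1)), which is o(N) iff b < k/(k+1), while little long length forces energy of order N^(b +
  1/k), which exceeds every multiple of N iff b > (k-1)/k. Inside the window both bounds carry the
  same rate k. They must agree up to o(N), since the exponential gain from a deviation may be
  arbitrarily small; it is fixed first and the slack in the partition function afterwards.\<close>

definition bern :: "('a \<Rightarrow> real) \<Rightarrow> 'a set \<Rightarrow> 'a set \<Rightarrow> real" where
  "bern q F S = (\<Prod>e\<in>F. if e \<in> S then q e else 1 - q e)"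

lemma bern_nonneg:
  assumes "\<And>e. e \<in> F \<Longrightarrow> 0 \<le> q e \<and> q e \<le> 1"
  shows "0 \<le> bern q F S"
  unfolding bern_def using assms by (intro prod_nonneg) auto

lemma sum_Pow_insert:
  fixes h :: "'a set \<Rightarrow> real"
  assumes "finite F" "e \<notin> F"
  shows "(\<Sum>S\<in>Pow (insert e F). h S) = (\<Sum>S\<in>Pow F. h S + h (insert e S))"
proof -
  have "inj_on (insert e) (Pow F)"
    using assms(2) by (intro inj_onI) (metis Pow_iff insert_ident subsetD)
  moreover have "Pow F \<inter> insert e ` Pow F = {}"
    using assms(2) by auto
  ultimately show ?thesis
    using assms by (simp add: Pow_insert sum.union_disjoint sum.reindex sum.distrib)
qed

lemma bern_insert:
  assumes "finite F" "e \<notin> F" "S \<subseteq> F"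
  shows "bern q (insert e F) S = (1 - q e) * bern q F S"
    and "bern q (insert e F) (insert e S) = q e * bern q F S"
proof -
  show "bern q (insert e F) S = (1 - q e) * bern q F S"
    using assms by (auto simp: bern_def)
  have "bern q F (insert e S) = bern q F S"
    unfolding bern_def using assms by (intro prod.cong) auto
  then show "bern q (insert e F) (insert e S) = q e * bern q F S"
    using assms by (auto simp: bern_def)
qed

text \<open>Exposes the single element \<open>e\<close>; every induction over edges below rests on
  this identity.\<close>

lemma sum_bern_insert:
  assumes "finite F" "e \<notin> F"
  shows "(\<Sum>S\<in>Pow (insert e F). bern q (insert e F) S * h S)
       = (\<Sum>S\<in>Pow F. bern q F S * ((1 - q e) * h S + q e * h (insert e S)))"
  unfolding sum_Pow_insert[OF assms]
  by (rule sum.cong) (auto simp: bern_insert[OF assms] algebra_simps)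

lemma sum_bern_eq_1:
  assumes "finite F"
  shows "(\<Sum>S\<in>Pow F. bern q F S) = 1"
  using assms
proof (induction F)
  case empty
  then show ?case by (simp add: bern_def)
next
  case (insert e F)
  then show ?case
    using sum_bern_insert[OF insert(1,2), of q "\<lambda>_. 1"] by simp
qed

text \<open>The two weights of a coordinate outside \<open>G\<close> add up to 1, so these
  coordinates integrate out one at a time. This turns expectations of local events into sums over a
  window that does not grow with the graph.\<close>

lemma sum_bern_marginal:
  assumes "finite F" "G \<subseteq> F"
  shows "(\<Sum>S\<in>Pow F. bern q F S * h (S \<inter> G)) = (\<Sum>T\<in>Pow G. bern q G T * h T)"
proof -
  have fG: "finite G" using assms finite_subset by blast
  have "(\<Sum>S\<in>Pow (G \<union> H). bern q (G \<union> H) S * h (S \<inter> G)) = (\<Sum>T\<in>Pow G. bern q G T * h T)"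
    if "finite H" "H \<inter> G = {}" for H
    using that
  proof (induction H)
    case empty
    then show ?case by (auto intro!: sum.cong simp: Int_absorb2)
  next
    case (insert e H)
    then have e: "e \<notin> G \<union> H" "e \<notin> G" and fin: "finite (G \<union> H)" using fG by auto
    have "(\<Sum>S\<in>Pow (G \<union> insert e H). bern q (G \<union> insert e H) S * h (S \<inter> G))
        = (\<Sum>S\<in>Pow (G \<union> H). bern q (G \<union> H) S * h (S \<inter> G))"
      unfolding Un_insert_right sum_bern_insert[OF fin e(1)]
      using e by (intro sum.cong) (auto simp: algebra_simps)
    with insert show ?case by auto
  qed
  from this[of "F - G"] show ?thesis
    using assms by (simp add: Un_absorb1 finite_subset Un_Diff_cancel Int_commute)
qed

lemma sum_bern_superset:
  assumes "finite F" "S0 \<subseteq> F"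
  shows "(\<Sum>S\<in>{S\<in>Pow F. S0 \<subseteq> S}. bern q F S) = (\<Prod>e\<in>S0. q e)"
proof -
  have fin: "finite S0" using assms finite_subset by blast
  have "(\<Sum>S\<in>{S\<in>Pow F. S0 \<subseteq> S}. bern q F S)
      = (\<Sum>S\<in>Pow F. bern q F S * (if S \<inter> S0 = S0 then 1 else 0))"
    using assms by (subst sum.inter_filter) (auto intro!: sum.cong)
  also have "\<dots> = (\<Sum>T\<in>Pow S0. bern q S0 T * (if T = S0 then 1 else 0))"
    by (rule sum_bern_marginal[OF assms])
  also have "\<dots> = bern q S0 S0"
    using fin by (simp add: if_distrib[of "(*) _"] sum.delta cong: if_cong)
  finally show ?thesis by (simp add: bern_def)
qed

lemma sum_bern_card:
  assumes "finite F"
  shows "(\<Sum>S\<in>Pow F. bern q F S * real (card (S \<inter> G))) = (\<Sum>e\<in>F \<inter> G. q e)"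
  using assms
proof (induction F)
  case empty
  then show ?case by (simp add: bern_def)
next
  case (insert e F)
  have "(\<Sum>S\<in>Pow (insert e F). bern q (insert e F) S * real (card (S \<inter> G)))
      = (\<Sum>S\<in>Pow F. bern q F S * real (card (S \<inter> G)) + (if e \<in> G then q e else 0) * bern q F S)"
    unfolding sum_bern_insert[OF insert(1,2)]
  proof (rule sum.cong[OF refl])
    fix S assume "S \<in> Pow F"
    then have "finite S" "e \<notin> S" using insert finite_subset by auto
    then have "real (card (insert e S \<inter> G)) = real (card (S \<inter> G)) + (if e \<in> G then 1 else 0)"
      by simp
    then show "bern q F S * ((1 - q e) * real (card (S \<inter> G)) + q e * real (card (insert e S \<inter> G)))
       = bern q F S * real (card (S \<inter> G)) + (if e \<in> G then q e else 0) * bern q F S"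
      by (simp add: algebra_simps)
  qed
  also have "\<dots> = (\<Sum>e\<in>insert e F \<inter> G. q e)"
    using insert by (simp add: sum.distrib sum_distrib_left[symmetric] sum_bern_eq_1)
  finally show ?case .
qed

text \<open>For negative x the quadratic Taylor polynomial bounds \<open>exp (- x)\<close> from
  below, and its product with the claimed bound is still at least 1.\<close>

lemma exp_le_quadratic:
  fixes x :: real
  assumes "\<bar>x\<bar> \<le> 1"
  shows "exp x \<le> 1 + x + x\<^sup>2"
proof (cases "x \<ge> 0")
  case True
  then show ?thesis using exp_bound[of x] assms by auto
next
  case False
  then have "1 - x + x\<^sup>2 / 2 \<le> exp (- x)"
    using exp_lower_Taylor_quadratic[of "- x"] by simp
  moreover have "1 \<le> (1 + x + x\<^sup>2) * (1 - x + x\<^sup>2 / 2)"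
  proof -
    define y where "y = - x"
    have y: "0 \<le> y" "y \<le> 1" using False assms by (auto simp: y_def)
    have "(1 - y + y\<^sup>2) * (1 + y + y\<^sup>2 / 2) = 1 + y\<^sup>2 * ((1 + y + y\<^sup>2)/2)"
      by (simp add: power2_eq_square field_simps)
    also have "\<dots> \<ge> 1" using y by auto
    finally show ?thesis by (simp add: y_def)
  qed
  moreover have "0 \<le> 1 + x + x\<^sup>2" using assms by (auto simp: abs_le_iff intro: add_nonneg_nonneg)
  ultimately have "1 \<le> (1 + x + x\<^sup>2) * exp (- x)"
    by (smt (verit) mult_left_mono)
  then show ?thesis by (simp add: exp_minus field_simps)
qed

text \<open>Exposing one edge at a time, the conditional exponential moment of a two-valued increment
  of size at most \<open>c\<close> is at most \<open>1 + q c\<^sup>2\<close>; the factor \<open>q\<close> makes the bound useful although the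
  number of edges is quadratic in the number of vertices.\<close>

lemma bern_exp_moment:
  fixes q a :: "'a \<Rightarrow> real"
  assumes "finite F" and c: "0 \<le> c" "c \<le> 1"
    and q: "\<And>e. e \<in> F \<Longrightarrow> 0 \<le> q e \<and> q e \<le> 1"
    and a: "\<And>e. e \<in> F \<Longrightarrow> 0 \<le> a e"
    and f: "\<And>e S. e \<in> F \<Longrightarrow> S \<subseteq> F \<Longrightarrow> \<bar>f (insert e S) - f S\<bar> \<le> c"
  shows "(\<Sum>S\<in>Pow F. bern q F S * exp ((\<Sum>e\<in>S. a e) + f S - (\<Sum>T\<in>Pow F. bern q F T * f T)))
           \<le> exp (\<Sum>e\<in>F. q e * (c\<^sup>2 + 3 * (exp (a e) - 1)))"
  using assms(1) q a f
proof (induction F arbitrary: f)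
  case empty
  then show ?case by (simp add: bern_def)
next
  case (insert e F)
  note q = insert.prems(1) and a = insert.prems(2) and f = insert.prems(3)
  \<comment> \<open>The conditional expectation of \<open>f\<close> given all edges except
    \<open>e\<close>: one step of the Doob martingale.\<close>
  define g where "g S = (1 - q e) * f S + q e * f (insert e S)" for S
  define m where "m = (\<Sum>T\<in>Pow F. bern q F T * g T)"
  have m: "(\<Sum>T\<in>Pow (insert e F). bern q (insert e F) T * f T) = m"
    unfolding m_def g_def by (rule sum_bern_insert[OF insert(1,2)])
  have qe: "0 \<le> q e" "q e \<le> 1" and ae: "0 \<le> a e" using q a by auto
  define K where "K = exp (q e * (c\<^sup>2 + 3 * (exp (a e) - 1)))"
  \<comment> \<open>The first-order terms cancel because \<open>g\<close> is the conditional mean,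
    leaving variance q (1 - q) d^2. The excess factor \<open>exp (a e) - 1\<close> multiplies an
    exponential of an increment at most 1, hence the constant 3 \<ge> e.\<close>
  have one: "(1 - q e) * exp (f S - g S) + q e * (exp (a e) * exp (f (insert e S) - g S)) \<le> K"
    if S: "S \<subseteq> F" for S
  proof -
    define d where "d = f (insert e S) - f S"
    have d: "\<bar>d\<bar> \<le> c" using f[of e S] S by (auto simp: d_def)
    have x0: "f S - g S = - (q e * d)" and x1: "f (insert e S) - g S = (1 - q e) * d"
      by (auto simp: g_def d_def algebra_simps)
    have b0: "\<bar>q e * d\<bar> \<le> \<bar>d\<bar>" and b1: "\<bar>(1 - q e) * d\<bar> \<le> \<bar>d\<bar>"
      using qe by (auto simp: abs_mult intro: mult_left_le_one_le)
    have d2: "d\<^sup>2 \<le> c\<^sup>2" using d c by (metis abs_le_square_iff abs_of_nonneg)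
    have e0: "exp (- (q e * d)) \<le> 1 - q e * d + (q e * d)\<^sup>2"
      using exp_le_quadratic[of "- (q e * d)"] b0 d c by simp
    have e1: "exp ((1 - q e) * d) \<le> 1 + (1 - q e) * d + ((1 - q e) * d)\<^sup>2"
      using exp_le_quadratic[of "(1 - q e) * d"] b1 d c by simp
    have e1': "exp ((1 - q e) * d) \<le> 3"
    proof -
      have "(1 - q e) * d \<le> 1" using b1 d c by linarith
      then have "exp ((1 - q e) * d) \<le> exp 1" by simp
      also have "\<dots> \<le> 3" by (rule exp_le)
      finally show ?thesis .
    qed
    have "(1 - q e) * exp (f S - g S) + q e * exp (f (insert e S) - g S)
        \<le> (1 - q e) * (1 - q e * d + (q e * d)\<^sup>2) + q e * (1 + (1 - q e) * d + ((1 - q e) * d)\<^sup>2)"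
      unfolding x0 x1 using qe e0 e1 by (intro add_mono mult_left_mono) auto
    also have "\<dots> = 1 + q e * (1 - q e) * d\<^sup>2"
      by (simp add: power2_eq_square algebra_simps)
    also have "\<dots> \<le> 1 + q e * c\<^sup>2"
      using qe d2 by (auto intro!: mult_mono mult_left_le)
    finally have A: "(1 - q e) * exp (f S - g S) + q e * exp (f (insert e S) - g S) \<le> 1 + q e * c\<^sup>2" .
    have B: "q e * ((exp (a e) - 1) * exp (f (insert e S) - g S)) \<le> q e * ((exp (a e) - 1) * 3)"
      unfolding x1 using qe ae e1' by (intro mult_left_mono) auto
    have "(1 - q e) * exp (f S - g S) + q e * (exp (a e) * exp (f (insert e S) - g S))
        = (1 - q e) * exp (f S - g S) + q e * exp (f (insert e S) - g S)
          + q e * ((exp (a e) - 1) * exp (f (insert e S) - g S))"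
      by (simp add: algebra_simps)
    also have "\<dots> \<le> 1 + q e * (c\<^sup>2 + 3 * (exp (a e) - 1))"
      using A B by (simp add: algebra_simps)
    also have "\<dots> \<le> K" unfolding K_def by (rule exp_ge_add_one_self)
    finally show ?thesis .
  qed
  have "(\<Sum>S\<in>Pow (insert e F). bern q (insert e F) S * exp ((\<Sum>e\<in>S. a e) + f S - m))
     = (\<Sum>S\<in>Pow F. bern q F S * ((1 - q e) * exp ((\<Sum>e\<in>S. a e) + f S - m)
          + q e * exp ((\<Sum>e\<in>insert e S. a e) + f (insert e S) - m)))"
    by (rule sum_bern_insert[OF insert(1,2)])
  also have "\<dots> = (\<Sum>S\<in>Pow F. bern q F S * exp ((\<Sum>e\<in>S. a e) + g S - m) *
        ((1 - q e) * exp (f S - g S) + q e * (exp (a e) * exp (f (insert e S) - g S))))"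
  proof (rule sum.cong[OF refl])
    fix S assume "S \<in> Pow F"
    then have S: "finite S" "e \<notin> S" using insert finite_subset by auto
    have 1: "exp ((\<Sum>e\<in>S. a e) + f S - m) = exp ((\<Sum>e\<in>S. a e) + g S - m) * exp (f S - g S)"
      by (simp add: exp_add[symmetric])
    have 2: "exp ((\<Sum>e\<in>insert e S. a e) + f (insert e S) - m)
        = exp ((\<Sum>e\<in>S. a e) + g S - m) * (exp (a e) * exp (f (insert e S) - g S))"
      using S by (simp add: exp_add[symmetric])
    show "bern q F S * ((1 - q e) * exp ((\<Sum>e\<in>S. a e) + f S - m)
          + q e * exp ((\<Sum>e\<in>insert e S. a e) + f (insert e S) - m)) =
        bern q F S * exp ((\<Sum>e\<in>S. a e) + g S - m) *
        ((1 - q e) * exp (f S - g S) + q e * (exp (a e) * exp (f (insert e S) - g S)))"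
      unfolding 1 2 by (simp add: algebra_simps)
  qed
  also have "\<dots> \<le> (\<Sum>S\<in>Pow F. bern q F S * exp ((\<Sum>e\<in>S. a e) + g S - m) * K)"
    using q by (intro sum_mono mult_left_mono one mult_nonneg_nonneg bern_nonneg) auto
  also have "\<dots> = K * (\<Sum>S\<in>Pow F. bern q F S * exp ((\<Sum>e\<in>S. a e) + g S - m))"
    by (simp add: sum_distrib_left mult_ac)
  also have "\<dots> \<le> K * exp (\<Sum>e\<in>F. q e * (c\<^sup>2 + 3 * (exp (a e) - 1)))"
  proof -
    \<comment> \<open>A convex combination of increments of \<open>f\<close>, so \<open>g\<close>
      inherits the constant \<open>c\<close> and the induction hypothesis applies to it.\<close>
    have gd: "\<bar>g (insert e' S) - g S\<bar> \<le> c" if "e' \<in> F" "S \<subseteq> F" for e' S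
    proof -
      have "g (insert e' S) - g S = (1 - q e) * (f (insert e' S) - f S)
          + q e * (f (insert e' (insert e S)) - f (insert e S))"
        by (simp add: g_def algebra_simps insert_commute)
      also have "\<bar>\<dots>\<bar> \<le> (1 - q e) * \<bar>f (insert e' S) - f S\<bar>
          + q e * \<bar>f (insert e' (insert e S)) - f (insert e S)\<bar>"
        using qe by (intro order_trans[OF abs_triangle_ineq]) (simp add: abs_mult)
      also have "\<dots> \<le> (1 - q e) * c + q e * c"
        using that qe by (intro add_mono mult_left_mono f) auto
      finally show ?thesis by (simp add: algebra_simps)
    qed
    have "(\<Sum>S\<in>Pow F. bern q F S * exp ((\<Sum>e\<in>S. a e) + g S - m))
        \<le> exp (\<Sum>e\<in>F. q e * (c\<^sup>2 + 3 * (exp (a e) - 1)))"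
      unfolding m_def using q a gd by (intro insert.IH) auto
    then show ?thesis by (intro mult_left_mono) (auto simp: K_def)
  qed
  also have "\<dots> = exp (\<Sum>e\<in>insert e F. q e * (c\<^sup>2 + 3 * (exp (a e) - 1)))"
    using insert by (simp add: K_def exp_add)
  finally show ?case unfolding m .
qed

section \<open>Ball growth in multigraphs with few crossings of each cut\<close>

text \<open>Edges are labels with two endpoint maps, because contracting vertices creates loops and
  parallel edges, and parallel edges have to be counted separately in the cuts.\<close>

definition msteps :: "('e \<Rightarrow> int) \<Rightarrow> ('e \<Rightarrow> int) \<Rightarrow> 'e set \<Rightarrow> (int \<times> int) set" where
  "msteps s t E = {(u, v). \<exists>e\<in>E. (u = s e \<and> v = t e) \<or> (u = t e \<and> v = s e)}"

definition mball :: "('e \<Rightarrow> int) \<Rightarrow> ('e \<Rightarrow> int) \<Rightarrow> 'e set \<Rightarrow> nat \<Rightarrow> int \<Rightarrow> int set" where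
  "mball s t E h v = {u. \<exists>m\<le>h. (v, u) \<in> msteps s t E ^^ m}"

lemma mball_center: "v \<in> mball s t E h v"
  unfolding mball_def by (auto intro!: exI[of _ 0])

lemma mball_subset_endpoints: "mball s t E h v \<subseteq> insert v (s ` E \<union> t ` E)"
proof
  fix u assume "u \<in> mball s t E h v"
  then obtain m where "(v, u) \<in> msteps s t E ^^ m" by (auto simp: mball_def)
  then show "u \<in> insert v (s ` E \<union> t ` E)"
    by (cases m) (auto simp: msteps_def)
qed

lemma finite_mball: "finite E \<Longrightarrow> finite (mball s t E h v)"
  using mball_subset_endpoints by (rule finite_subset) auto

text \<open>What the covering argument needs of a walk, with its order forgotten: the edge set
  \<open>P\<close>, a small vertex set \<open>X\<close> containing all its endpoints, and that
  \<open>P\<close> crosses every cut between the two ends.\<close>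

definition mpath :: "('e \<Rightarrow> int) \<Rightarrow> ('e \<Rightarrow> int) \<Rightarrow> 'e set \<Rightarrow> nat \<Rightarrow> int \<Rightarrow> int \<Rightarrow> 'e set \<Rightarrow> int set \<Rightarrow> bool" where
  "mpath s t E m v u P X \<longleftrightarrow> P \<subseteq> E \<and> finite X \<and> card X \<le> Suc m \<and> v \<in> X \<and> u \<in> X
      \<and> s ` P \<union> t ` P \<subseteq> X
      \<and> (\<forall>j. (v \<le> j \<and> j < u) \<or> (u \<le> j \<and> j < v) \<longrightarrow> (\<exists>e\<in>P. s e \<le> j \<and> j < t e))"

lemma mpathD:
  assumes "mpath s t E m v u P X"
  shows "P \<subseteq> E" "finite X" "card X \<le> Suc m" "v \<in> X" "u \<in> X" "s ` P \<union> t ` P \<subseteq> X"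
    and "(v \<le> j \<and> j < u) \<or> (u \<le> j \<and> j < v) \<Longrightarrow> \<exists>e\<in>P. s e \<le> j \<and> j < t e"
  using assms unfolding mpath_def by blast+

lemma msteps_path:
  assumes "(v, u) \<in> msteps s t E ^^ m" and st: "\<And>e. s e \<le> t e"
  shows "\<exists>P X. mpath s t E m v u P X"
  using assms(1)
proof (induction m arbitrary: u)
  case 0
  then have "mpath s t E 0 v u {} {v}" by (auto simp: mpath_def)
  then show ?case by blast
next
  case (Suc m)
  then obtain w where w: "(v, w) \<in> msteps s t E ^^ m" "(w, u) \<in> msteps s t E" by auto
  from w(2) obtain e where e: "e \<in> E" "(w = s e \<and> u = t e) \<or> (w = t e \<and> u = s e)"
    by (auto simp: msteps_def)
  from Suc.IH[OF w(1)] obtain P X where "mpath s t E m v w P X" by blast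
  note PX = mpathD[OF this]
  have cross: "\<exists>e\<in>insert e P. s e \<le> j \<and> j < t e" if "(v \<le> j \<and> j < u) \<or> (u \<le> j \<and> j < v)" for j
  proof (cases "s e \<le> j \<and> j < t e")
    case False
    \<comment> \<open>The last edge does not cross \<open>j\<close>, so \<open>w\<close> and
      \<open>u\<close> lie on the same side and the earlier part of the walk already
      crosses.\<close>
    then have "(v \<le> j \<and> j < w) \<or> (w \<le> j \<and> j < v)" using that e(2) st[of e] by auto
    from PX(7)[OF this] show ?thesis by blast
  qed blast
  have "mpath s t E (Suc m) v u (insert e P) (insert u X)"
    unfolding mpath_def
  proof (intro conjI allI impI)
    show "s ` insert e P \<union> t ` insert e P \<subseteq> insert u X" using PX(5,6) e(2) by auto
    show "card (insert u X) \<le> Suc (Suc m)" using PX(2,3) by (simp add: card_insert_if)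
  qed (use PX(1,2,4) e(1) cross in \<open>blast+\<close>)
  then show ?case by blast
qed

text \<open>If every cut is crossed at most \<open>w\<close> times, remove shortest paths from the centre to the two
  extreme points of the ball: they cross every cut inside the ball, so the remaining graph has
  crossing number \<open>w - 1\<close>, and the ball is covered by the balls of the remaining graph around the
  at most \<open>2 h + 1\<close> vertices of the two paths.\<close>

theorem card_mball_le:
  assumes "finite E" and st: "\<And>e. s e \<le> t e"
    and "\<And>j. card {e\<in>E. s e \<le> j \<and> j < t e} \<le> w"
  shows "card (mball s t E h v) \<le> (2 * h + 1) ^ w"
  using assms(1,3)
proof (induction w arbitrary: E v)
  case 0
  \<comment> \<open>With no crossed cut at all, every edge is a loop and the ball is its
    centre.\<close>
  have eq: "s e = t e" if "e \<in> E" for e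
  proof (rule ccontr)
    assume "s e \<noteq> t e"
    then have "e \<in> {e'\<in>E. s e' \<le> s e \<and> s e < t e'}" using that st[of e] by auto
    moreover have "finite {e'\<in>E. s e' \<le> s e \<and> s e < t e'}" using 0(1) by simp
    ultimately have "card {e'\<in>E. s e' \<le> s e \<and> s e < t e'} > 0" by (subst card_gt_0_iff) blast
    with 0(2)[of "s e"] show False by simp
  qed
  have "u = v" if "(v, u) \<in> msteps s t E ^^ m" for u m
    using that by (induction m arbitrary: u) (auto simp: msteps_def eq)
  then have "mball s t E h v \<subseteq> {v}" by (auto simp: mball_def)
  then have "card (mball s t E h v) \<le> card {v}" by (intro card_mono) auto
  then show ?case by simp
next
  case (Suc w)
  define B where "B = mball s t E h v"
  have fB: "finite B" and vB: "v \<in> B"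
    using finite_mball[OF Suc.prems(1)] mball_center by (auto simp: B_def)
  define y where "y = Max B"
  define z where "z = Min B"
  have "B \<noteq> {}" using vB by blast
  then have yz: "y \<in> B" "z \<in> B" "\<And>u. u \<in> B \<Longrightarrow> z \<le> u \<and> u \<le> y"
    unfolding y_def z_def using fB by (simp_all only: Max_in Min_in Max_ge Min_le simp_thms)
  from yz obtain m1 m2 where m: "m1 \<le> h" "m2 \<le> h" "(v, y) \<in> msteps s t E ^^ m1" "(v, z) \<in> msteps s t E ^^ m2"
    by (auto simp: B_def mball_def)
  from msteps_path[OF m(3) st] msteps_path[OF m(4) st] obtain P1 X1 P2 X2
    where paths: "mpath s t E m1 v y P1 X1" "mpath s t E m2 v z P2 X2" by blast
  note 1 = mpathD[OF paths(1)] and 2 = mpathD[OF paths(2)]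
  define X where "X = X1 \<union> X2"
  \<comment> \<open>Edges leaving the ball are discarded too: outside the range from
    \<open>z\<close> to \<open>y\<close> the two paths give no crossing, and there the remaining
    graph must have none.\<close>
  define E' where "E' = {e\<in>E - (P1 \<union> P2). s e \<in> B \<and> t e \<in> B}"
  have fX: "finite X" using 1(2) 2(2) by (simp add: X_def)
  have cX: "card X \<le> 2 * h + 1"
  proof -
    have "card X + card (X1 \<inter> X2) = card X1 + card X2"
      unfolding X_def by (rule card_Un_Int[OF 1(2) 2(2), symmetric])
    \<comment> \<open>Both paths contain \<open>v\<close>; sharing it improves 2 h + 2 to 2 h +
      1.\<close>
    moreover have "card (X1 \<inter> X2) > 0" 
      using 1(2,4) 2(4) by (subst card_gt_0_iff) blast
    ultimately show ?thesis using 1(3) 2(3) m(1,2) by linarith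
  qed
  have cr: "card {e\<in>E'. s e \<le> j \<and> j < t e} \<le> w" for j
  proof (cases "z \<le> j \<and> j < y")
    case True
    then have "\<exists>e\<in>P1 \<union> P2. s e \<le> j \<and> j < t e"
      using 1(7)[of j] 2(7)[of j] by (cases "v \<le> j") (blast, force)
    then obtain e where e: "e \<in> P1 \<union> P2" "s e \<le> j" "j < t e" by blast
    then have "{e\<in>E'. s e \<le> j \<and> j < t e} \<subset> {e\<in>E. s e \<le> j \<and> j < t e}"
      using 1(1) 2(1) unfolding E'_def by blast
    then have "card {e\<in>E'. s e \<le> j \<and> j < t e} < card {e\<in>E. s e \<le> j \<and> j < t e}"
      using Suc.prems(1) by (intro psubset_card_mono) auto
    with Suc.prems(2)[of j] show ?thesis by linarith
  next
    case False
    then have "{e\<in>E'. s e \<le> j \<and> j < t e} = {}"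
      using yz(3) unfolding E'_def by (smt (verit) Collect_empty_eq mem_Collect_eq)
    then show ?thesis by (metis card.empty le0)
  qed
  \<comment> \<open>A walk is restarted whenever it uses a removed edge, since the endpoint reached
    lies in \<open>X\<close>. After the last restart only edges of \<open>E'\<close> occur.\<close>
  have cov: "\<exists>p\<in>X. \<exists>m'\<le>m. (p, u) \<in> msteps s t E' ^^ m'"
    if "(v, u) \<in> msteps s t E ^^ m" "m \<le> h" for u m
    using that
  proof (induction m arbitrary: u)
    case 0
    then show ?case using 1(4) by (intro bexI[of _ v] exI[of _ 0]) (auto simp: X_def)
  next
    case (Suc m)
    then obtain w where w: "(v, w) \<in> msteps s t E ^^ m" "(w, u) \<in> msteps s t E" by auto
    from w(2) obtain e where e: "e \<in> E" "(w = s e \<and> u = t e) \<or> (w = t e \<and> u = s e)"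
      by (auto simp: msteps_def)
    have wB: "w \<in> B" using w(1) Suc.prems(2) by (auto simp: B_def mball_def intro!: exI[of _ m])
    have uB: "u \<in> B" using Suc.prems unfolding B_def mball_def by blast
    show ?case
    proof (cases "e \<in> P1 \<union> P2")
      case True
      then have "u \<in> X" using e(2) 1(6) 2(6) unfolding X_def by blast
      then show ?thesis by (intro bexI[of _ u] exI[of _ 0]) auto
    next
      case False
      then have "e \<in> E'" using e wB uB by (auto simp: E'_def)
      then have "(w, u) \<in> msteps s t E'" using e by (auto simp: msteps_def)
      moreover obtain p m' where "p \<in> X" "m' \<le> m" "(p, w) \<in> msteps s t E' ^^ m'"
        using Suc.IH[OF w(1)] Suc.prems(2) by auto
      ultimately show ?thesis by (intro bexI[of _ p] exI[of _ "Suc m'"]) auto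
    qed
  qed
  have "B \<subseteq> (\<Union>p\<in>X. mball s t E' h p)"
  proof
    fix u assume "u \<in> B"
    then obtain m where "m \<le> h" "(v, u) \<in> msteps s t E ^^ m" by (auto simp: B_def mball_def)
    with cov[of u m] obtain p m' where "p \<in> X" "m' \<le> m" "(p, u) \<in> msteps s t E' ^^ m'" by blast
    then show "u \<in> (\<Union>p\<in>X. mball s t E' h p)"
      using \<open>m \<le> h\<close> by (auto simp: mball_def intro!: bexI[of _ p] exI[of _ m'])
  qed
  moreover have fE': "finite E'" using Suc.prems(1) by (simp add: E'_def)
  ultimately have "card B \<le> card (\<Union>p\<in>X. mball s t E' h p)"
    using fX finite_mball by (intro card_mono) auto
  also have "\<dots> \<le> (\<Sum>p\<in>X. card (mball s t E' h p))"
    by (rule card_UN_le[OF fX])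
  also have "\<dots> \<le> (\<Sum>p\<in>X. (2 * h + 1) ^ w)"
    by (intro sum_mono Suc.IH fE' cr)
  also have "\<dots> \<le> (2 * h + 1) ^ Suc w"
    using mult_le_mono1[OF cX, of "(2 * h + 1) ^ w"] by simp
  finally show ?case by (simp add: B_def)
qed

section \<open>Graph distance and energy\<close>

definition adj :: "int set set \<Rightarrow> (int \<times> int) set" where
  "adj E = {(x, y). {x, y} \<in> E}"

text \<open>Replaces lists of vertices by relational powers, in which concatenation, symmetry and
  monotonicity of paths are immediate.\<close>

lemma gdist_le_iff:
  assumes "x \<in> fst g"
  shows "gdist g x y \<le> enat n \<longleftrightarrow> (\<exists>m\<le>n. (x, y) \<in> adj (snd g) ^^ m)"
proof
  assume le: "gdist g x y \<le> enat n"
  show "\<exists>m\<le>n. (x, y) \<in> adj (snd g) ^^ m"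
  proof (rule ccontr)
    assume no: "\<not> (\<exists>m\<le>n. (x, y) \<in> adj (snd g) ^^ m)"
    have "enat (Suc n) \<le> gdist g x y"
      unfolding gdist_def
    proof (rule INF_greatest)
      fix xs assume "xs \<in> {xs. walk (snd g) xs \<and> hd xs = x \<and> last xs = y \<and> x \<in> fst g}"
      then have xs: "walk (snd g) xs" "hd xs = x" "last xs = y" "xs \<noteq> []" by (auto simp: walk_def)
      then have "(x, y) \<in> adj (snd g) ^^ (length xs - 1)"
        unfolding relpow_fun_conv
        by (intro exI[of _ "\<lambda>i. xs ! i"]) (auto simp: hd_conv_nth last_conv_nth walk_def adj_def)
      with no have "n < length xs - 1" by (meson not_le)
      then show "enat (Suc n) \<le> enat (length xs - 1)" by simp
    qed
    from order_trans[OF this le] show False by simp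
  qed
next
  assume "\<exists>m\<le>n. (x, y) \<in> adj (snd g) ^^ m"
  then obtain m f where m: "m \<le> n" "f 0 = x" "f m = y" "\<forall>i<m. (f i, f (Suc i)) \<in> adj (snd g)"
    unfolding relpow_fun_conv by blast
  define xs where "xs = map f [0..<Suc m]"
  have "xs \<in> {xs. walk (snd g) xs \<and> hd xs = x \<and> last xs = y \<and> x \<in> fst g}"
    using m assms by (auto simp: xs_def walk_def adj_def hd_conv_nth last_conv_nth nth_append simp del: upt_Suc)
  then have "gdist g x y \<le> enat (length xs - 1)"
    unfolding gdist_def by (rule INF_lower)
  also have "\<dots> \<le> enat n" using m by (simp add: xs_def)
  finally show "gdist g x y \<le> enat n" .
qed

lemma fst_fin_graph [simp]: "fst (fin_graph N S) = {1..int N}"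
  by (simp add: fin_graph_def)

lemma fin_graph_unit_edge: "1 \<le> x \<Longrightarrow> x + 1 \<le> int N \<Longrightarrow> (x, x + 1) \<in> adj (snd (fin_graph N S))"
  by (auto simp: fin_graph_def adj_def)

lemma adj_sym: "(x, y) \<in> adj E \<Longrightarrow> (y, x) \<in> adj E"
  by (simp add: adj_def insert_commute)

lemma relpow_sym:
  assumes "\<And>x y. (x, y) \<in> R \<Longrightarrow> (y, x) \<in> R" "(x, y) \<in> R ^^ n"
  shows "(y, x) \<in> R ^^ n"
  using assms(2)
proof (induction n arbitrary: y)
  case (Suc n)
  then obtain z where "(x, z) \<in> R ^^ n" "(z, y) \<in> R" by auto
  with Suc.IH assms(1) show ?case by (metis relpow_Suc_I2)
qed auto

lemma adj_relpow_sym: "(x, y) \<in> adj E ^^ n \<Longrightarrow> (y, x) \<in> adj E ^^ n"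
  by (rule relpow_sym[OF adj_sym])

lemma fin_graph_interval_path:
  assumes "1 \<le> x" "x + int m \<le> int N"
  shows "(x, x + int m) \<in> adj (snd (fin_graph N S)) ^^ m"
  using assms
proof (induction m)
  case (Suc m)
  then have "(x + int m, x + int m + 1) \<in> adj (snd (fin_graph N S))"
    by (intro fin_graph_unit_edge) auto
  with Suc show ?case by (auto simp: algebra_simps)
qed auto

lemma fin_graph_gdist_finite:
  assumes "x \<in> {1..int N}" "y \<in> {1..int N}"
  obtains d where "gdist (fin_graph N S) x y = enat d"
proof -
  have *: "\<exists>m. (x, y) \<in> adj (snd (fin_graph N S)) ^^ m" if "x \<le> y" "x \<in> {1..int N}" "y \<in> {1..int N}" for x y
    using fin_graph_interval_path[of x "nat (y - x)" N S] that by auto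
  then have "\<exists>m. (x, y) \<in> adj (snd (fin_graph N S)) ^^ m"
    using assms adj_relpow_sym by (metis linear)
  then obtain m where "gdist (fin_graph N S) x y \<le> enat m"
    using gdist_le_iff[of x "fin_graph N S" y] assms by auto
  then show ?thesis using that by (cases "gdist (fin_graph N S) x y") auto
qed

lemma the_enat_gdist_le_iff:
  assumes "x \<in> {1..int N}" "y \<in> {1..int N}"
  shows "the_enat (gdist (fin_graph N S) x y) \<le> n \<longleftrightarrow> (\<exists>m\<le>n. (x, y) \<in> adj (snd (fin_graph N S)) ^^ m)"
proof -
  obtain d where "gdist (fin_graph N S) x y = enat d" using fin_graph_gdist_finite assms by blast
  with gdist_le_iff[of x "fin_graph N S" y n] assms show ?thesis by simp
qed

lemma card_increasing_pairs:
  "finite {(x, y). x \<in> {1..int N} \<and> y \<in> {1..int N} \<and> x < y}"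
  "card {(x, y). x \<in> {1..int N} \<and> y \<in> {1..int N} \<and> x < y} = N choose 2"
proof -
  have eq: "{(x, y). x \<in> {1..int N} \<and> y \<in> {1..int N} \<and> x < y} = Sigma {1..int N} (\<lambda>x. {x<..int N})"
    by auto
  show "finite {(x, y). x \<in> {1..int N} \<and> y \<in> {1..int N} \<and> x < y}" unfolding eq by auto
  have "(\<Sum>x\<in>{1..int N}. nat (int N - x)) = N choose 2"
  proof -
    have "(\<Sum>x\<in>{1..int N}. nat (int N - x)) = (\<Sum>i<N. i)"
      by (rule sum.reindex_bij_witness[of _ "\<lambda>i. int N - int i" "\<lambda>x. nat (int N - x)"]) auto
    also have "\<dots> = N choose 2"
      by (induction N) (auto simp: numeral_2_eq_2)
    finally show ?thesis .
  qed
  then show "card {(x, y). x \<in> {1..int N} \<and> y \<in> {1..int N} \<and> x < y} = N choose 2"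
    unfolding eq by (subst card_SigmaI) auto
qed

lemma Hp_upper:
  assumes p: "1 \<le> p" and N: "N \<ge> 1"
    and d: "\<And>x y. x \<in> {1..int N} \<Longrightarrow> y \<in> {1..int N} \<Longrightarrow> the_enat (gdist (fin_graph N S) x y) \<le> h"
  shows "Hp p (fin_graph N S) \<le> real h"
proof (cases p)
  case (real q)
  then have q: "1 \<le> q" using p by simp
  let ?P = "{(x, y). x \<in> {1..int N} \<and> y \<in> {1..int N} \<and> x < y}"
  let ?s = "\<Sum>(x, y)\<in>?P. real (the_enat (gdist (fin_graph N S) x y)) powr q"
  have "?s \<le> (\<Sum>(x, y)\<in>?P. real h powr q)"
    using d q by (intro sum_mono) (auto intro!: powr_mono2)
  also have "\<dots> = real (N choose 2) * real h powr q"
    using card_increasing_pairs[of N] by (simp add: case_prod_beta)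
  \<comment> \<open>For N = 1 the binomial coefficient is 0 and the quotient is 0 by convention, so
    the bound persists.\<close>
  finally have "?s / real (N choose 2) \<le> real h powr q"
    by (cases "N choose 2 = 0") (auto simp: divide_le_eq mult.commute)
  moreover have "0 \<le> ?s" by (intro sum_nonneg) auto
  ultimately have "(?s / real (N choose 2)) powr (1 / q) \<le> (real h powr q) powr (1 / q)"
    using q by (intro powr_mono2) auto
  also have "\<dots> = real h" using q by (simp add: powr_powr)
  finally show ?thesis using real by (simp add: Hp_def)
next
  case PInf
  have "Sup {real (the_enat (gdist (fin_graph N S) x y)) | x y. x \<in> {1..int N} \<and> y \<in> {1..int N}} \<le> real h"
    using N d by (intro cSup_least) (fastforce intro!: exI[of _ 1])+
  then show ?thesis using PInf by (simp add: Hp_def)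
qed (use p in auto)

lemma bdd_above_gdist:
  "bdd_above {real (the_enat (gdist (fin_graph N S) x y)) | x y. x \<in> {1..int N} \<and> y \<in> {1..int N}}"
proof (rule bdd_above_finite, rule finite_subset)
  show "{real (the_enat (gdist (fin_graph N S) x y)) | x y. x \<in> {1..int N} \<and> y \<in> {1..int N}}
     \<subseteq> (\<lambda>z. real (the_enat (gdist (fin_graph N S) (fst z) (snd z)))) ` ({1..int N} \<times> {1..int N})"
    by force
qed auto

lemma Hp_nonneg:
  assumes "1 \<le> p" "N \<ge> 1"
  shows "0 \<le> Hp p (fin_graph N S)"
proof (cases p)
  case PInf
  let ?D = "{real (the_enat (gdist (fin_graph N S) x y)) | x y. x \<in> {1..int N} \<and> y \<in> {1..int N}}"
  have "bdd_above ?D" by (rule bdd_above_gdist)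
  moreover have "real (the_enat (gdist (fin_graph N S) 1 1)) \<in> ?D" using assms by force
  ultimately have "0 \<le> Sup ?D" by (meson cSup_upper2 of_nat_0_le_iff)
  then show ?thesis using PInf by (simp add: Hp_def)
qed (use assms in \<open>auto simp: Hp_def\<close>)

text \<open>A fraction \<open>c\<close> of far pairs serves all p at once: for finite p the root
  turns \<open>c\<close> into c^(1/q), which is at least \<open>c\<close> as c \<le> 1 \<le> q; for
  the supremum one far pair is enough.\<close>

lemma Hp_lower:
  assumes p: "1 \<le> p" and c: "0 < c" "c \<le> 1" and N: "N \<ge> 2"
    and Q: "Q \<subseteq> {(x, y). x \<in> {1..int N} \<and> y \<in> {1..int N} \<and> x < y}"
    and cQ: "c * real (N choose 2) \<le> real (card Q)"
    and d: "\<And>x y. (x, y) \<in> Q \<Longrightarrow> h \<le> the_enat (gdist (fin_graph N S) x y)"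
  shows "c * real h \<le> Hp p (fin_graph N S)"
proof -
  have N2: "real (N choose 2) > 0" using N by simp
  have fQ: "finite Q" using Q card_increasing_pairs(1) finite_subset by blast
  show ?thesis
  proof (cases p)
    case (real q)
    then have q: "1 \<le> q" using p by simp
    let ?P = "{(x, y). x \<in> {1..int N} \<and> y \<in> {1..int N} \<and> x < y}"
    let ?s = "\<Sum>(x, y)\<in>?P. real (the_enat (gdist (fin_graph N S) x y)) powr q"
    have "c * real (N choose 2) * real h powr q \<le> real (card Q) * real h powr q"
      using cQ by (intro mult_right_mono) auto
    also have "\<dots> = (\<Sum>(x, y)\<in>Q. real h powr q)" by (simp add: case_prod_beta)
    also have "\<dots> \<le> (\<Sum>(x, y)\<in>Q. real (the_enat (gdist (fin_graph N S) x y)) powr q)"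
      using d q by (intro sum_mono) (auto intro!: powr_mono2)
    also have "\<dots> \<le> ?s"
      using Q card_increasing_pairs(1)[of N] by (intro sum_mono2) auto
    finally have "c * real h powr q \<le> ?s / real (N choose 2)"
      using N2 by (simp add: le_divide_eq mult_ac)
    then have "(c * real h powr q) powr (1 / q) \<le> (?s / real (N choose 2)) powr (1 / q)"
      using q c by (intro powr_mono2) auto
    moreover have "(c * real h powr q) powr (1 / q) = c powr (1 / q) * real h"
      using c q by (simp add: powr_mult powr_powr)
    moreover have "c powr 1 \<le> c powr (1 / q)"
      using c q by (intro powr_mono') auto
    ultimately have "c * real h \<le> (?s / real (N choose 2)) powr (1 / q)"
      using c by (smt (verit) mult_right_mono of_nat_0_le_iff powr_one)
    then show ?thesis using real by (simp add: Hp_def)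
  next
    case PInf
    have "0 < real (card Q)" using cQ c N2 by (smt (verit) mult_pos_pos)
    then obtain x y where xy: "(x, y) \<in> Q" 
      by (metis card.empty equals0I less_numeral_extra(3) of_nat_0 surj_pair)
    let ?D = "{real (the_enat (gdist (fin_graph N S) x y)) | x y. x \<in> {1..int N} \<and> y \<in> {1..int N}}"
    have "bdd_above ?D" by (rule bdd_above_gdist)
    moreover have "real (the_enat (gdist (fin_graph N S) x y)) \<in> ?D" using Q xy by auto
    ultimately have "real h \<le> Sup ?D"
      using d[OF xy] by (meson cSup_upper2 of_nat_le_iff)
    moreover have "c * real h \<le> real h" using c by (intro mult_left_le_one_le) auto
    ultimately show ?thesis using PInf by (simp add: Hp_def)
  qed (use p in auto)
qed

section \<open>Graphs whose long edges have small total length\<close>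

lemma finite_LR: "finite (LR N)"
  by (rule finite_subset[of _ "{1..int N} \<times> {1..int N}"]) (auto simp: LR_def)

definition long_len :: "nat \<Rightarrow> (int \<times> int) set \<Rightarrow> real" where
  "long_len L S = (\<Sum>e\<in>{e\<in>S. int L < snd e - fst e}. real_of_int (snd e - fst e))"

text \<open>Edges of length at most \<open>L\<close> are left out, as each can be replaced by at
  most \<open>L\<close> unit edges.\<close>

definition skeleton :: "nat \<Rightarrow> nat \<Rightarrow> (int \<times> int) set \<Rightarrow> (int \<times> int) set" where
  "skeleton N L S = (\<lambda>x. (x, x + 1)) ` {1..<int N} \<union> {e\<in>S. int L < snd e - fst e}"

lemma finite_skeleton: "S \<subseteq> LR N \<Longrightarrow> finite (skeleton N L S)"
  using finite_LR[of N] by (auto simp: skeleton_def intro: finite_subset)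

text \<open>Double counting: an edge crosses as many cuts as it is long, and each of the N - 1 unit
  edges crosses exactly one. Cut \<open>i\<close> lies between the vertices \<open>i\<close> and
  \<open>i + 1\<close>.\<close>

lemma sum_cut_crossings:
  assumes S: "S \<subseteq> LR N" and N: "N \<ge> 1"
  shows "(\<Sum>i\<in>{1..<int N}. real (card {e\<in>skeleton N L S. fst e \<le> i \<and> i < snd e})) = real N - 1 + long_len L S"
proof -
  let ?E = "skeleton N L S" and ?U = "(\<lambda>x. (x, x + 1)) ` {1..<int N}" and ?T = "{e\<in>S. int L < snd e - fst e}"
  have fin: "finite ?E" "finite ?T" using finite_skeleton[OF S] by (auto simp: skeleton_def)
  have "(\<Sum>i\<in>{1..<int N}. real (card {e\<in>?E. fst e \<le> i \<and> i < snd e}))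
      = (\<Sum>i\<in>{1..<int N}. \<Sum>e\<in>?E. if fst e \<le> i \<and> i < snd e then 1 else 0)"
    using fin by (intro sum.cong) (auto simp: sum.inter_filter[symmetric])
  also have "\<dots> = (\<Sum>e\<in>?E. \<Sum>i\<in>{1..<int N}. if fst e \<le> i \<and> i < snd e then 1 else 0)"
    by (rule sum.swap)
  also have "\<dots> = (\<Sum>e\<in>?E. real_of_int (snd e - fst e))"
  proof (rule sum.cong[OF refl])
    fix e assume "e \<in> ?E"
    then have e: "1 \<le> fst e" "fst e \<le> snd e" "snd e \<le> int N" using S by (auto simp: skeleton_def LR_def)
    have "(\<Sum>i\<in>{1..<int N}. if fst e \<le> i \<and> i < snd e then 1 else 0)
        = real (card {i\<in>{1..<int N}. fst e \<le> i \<and> i < snd e})"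
      by (simp add: sum.inter_filter[symmetric])
    also have "{i\<in>{1..<int N}. fst e \<le> i \<and> i < snd e} = {fst e..<snd e}" using e by auto
    finally show "(\<Sum>i\<in>{1..<int N}. if fst e \<le> i \<and> i < snd e then 1 else 0) = real_of_int (snd e - fst e)"
      using e by simp
  qed
  also have "\<dots> = (\<Sum>e\<in>?U. real_of_int (snd e - fst e)) + (\<Sum>e\<in>?T. real_of_int (snd e - fst e))"
    unfolding skeleton_def using fin S by (intro sum.union_disjoint) (auto simp: LR_def)
  also have "(\<Sum>e\<in>?U. real_of_int (snd e - fst e)) = real N - 1"
    using N by (subst sum.reindex) (auto simp: inj_on_def of_nat_diff)
  finally show ?thesis by (simp add: long_len_def)
qed

text \<open>Markov's inequality for the crossing numbers. The unit edge crosses each cut once, so a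
  cut with more than \<open>k\<close> crossings is crossed by at least \<open>k\<close> long
  edges.\<close>

lemma card_low_cuts:
  assumes S: "S \<subseteq> LR N" and N: "N \<ge> 1"
  shows "real (k + 1) * (real N - 1 - real (card {i\<in>{1..<int N}. card {e\<in>skeleton N L S. fst e \<le> i \<and> i < snd e} \<le> k}))
         \<le> real N - 1 + long_len L S"
proof -
  let ?c = "\<lambda>i. card {e\<in>skeleton N L S. fst e \<le> i \<and> i < snd e}"
  let ?A = "{i\<in>{1..<int N}. ?c i \<le> k}" and ?B = "{i\<in>{1..<int N}. \<not> ?c i \<le> k}"
  have "card ?A + card ?B = card {1..<int N}"
  proof (subst card_Un_disjoint[symmetric])
    show "card (?A \<union> ?B) = card {1..<int N}" by (rule arg_cong[where f=card]) auto
  qed (auto intro: finite_subset[of _ "{1..<int N}"])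
  then have "real (card ?B) = real N - 1 - real (card ?A)" using N by (simp add: of_nat_diff)
  then have "real (k + 1) * (real N - 1 - real (card ?A)) = (\<Sum>i\<in>?B. real (k + 1))" by simp
  also have "\<dots> \<le> (\<Sum>i\<in>?B. real (?c i))" by (intro sum_mono) auto
  also have "\<dots> \<le> (\<Sum>i\<in>{1..<int N}. real (?c i))" by (intro sum_mono2) auto
  also have "\<dots> = real N - 1 + long_len L S" by (rule sum_cut_crossings[OF S N])
  finally show ?thesis .
qed

lemma msteps_sym: "(x, y) \<in> msteps s t E \<Longrightarrow> (y, x) \<in> msteps s t E"
  by (auto simp: msteps_def)

text \<open>Contracting all cuts outside \<open>A\<close> by the map \<open>\<phi>\<close> only decreases distances, and leaves a
  multigraph in which all cuts are crossed at most \<open>k\<close> times.\<close>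

lemma card_low_cuts_near:
  assumes S: "S \<subseteq> LR N" and L: "L \<ge> 1" and A: "A \<subseteq> {1..<int N}"
    and k: "\<And>i. i \<in> A \<Longrightarrow> card {e\<in>skeleton N L S. fst e \<le> i \<and> i < snd e} \<le> k"
    and a: "a \<in> A"
  shows "card {a'\<in>A. \<exists>m\<le>h. (a, a') \<in> adj (snd (fin_graph N S)) ^^ m} \<le> (2 * (L * h) + 1) ^ k"
proof -
  have fA: "finite A" using A finite_subset by blast
  \<comment> \<open>Counts the cuts of \<open>A\<close> to the left of a vertex, so vertices not
    separated by a cut of \<open>A\<close> get identified.\<close>
  define \<phi> where "\<phi> x = int (card {i\<in>A. i < x})" for x
  define E where "E = skeleton N L S"
  have fE: "finite E" using finite_skeleton[OF S] by (simp add: E_def)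
  \<comment> \<open>\<open>min\<close> and \<open>max\<close> ensure \<open>s e \<le> t e\<close>
    for every pair, as \<open>card_mball_le\<close> asks this of all labels and not only of those in
    \<open>E\<close>.\<close>
  define s t where "s = (\<lambda>e. \<phi> (min (fst e) (snd e)))" and "t = (\<lambda>e. \<phi> (max (fst e) (snd e)))"
  have mono: "\<phi> x \<le> \<phi> y" if "x \<le> y" for x y
    unfolding \<phi>_def using that fA by (auto intro!: card_mono)
  have strict: "\<phi> x < \<phi> y" if "x < y" "x \<in> A" for x y
  proof -
    have "{i\<in>A. i < x} \<subset> {i\<in>A. i < y}" using that by auto
    then show ?thesis unfolding \<phi>_def using fA by (simp add: psubset_card_mono)
  qed
  have inj: "inj_on \<phi> A"
    by (rule inj_onI) (metis strict less_irrefl linorder_neqE)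
  have Elt: "fst e < snd e" if "e \<in> E" for e
    using that S by (auto simp: E_def skeleton_def LR_def)
  have st: "s e = \<phi> (fst e)" "t e = \<phi> (snd e)" if "e \<in> E" for e
    using Elt[OF that] by (auto simp: s_def t_def)
  have st_le: "s e \<le> t e" for e
    unfolding s_def t_def by (intro mono) auto
  have im: "\<phi> ` A = {0..<int (card A)}"
  proof (rule card_subset_eq)
    show "\<phi> ` A \<subseteq> {0..<int (card A)}"
    proof
      fix j assume "j \<in> \<phi> ` A"
      then obtain x where x: "x \<in> A" "j = \<phi> x" by auto
      have "{i\<in>A. i < x} \<subset> A" using x by auto
      then show "j \<in> {0..<int (card A)}" using x fA by (auto simp: \<phi>_def psubset_card_mono)
    qed
    show "card (\<phi> ` A) = card {0..<int (card A)}" using card_image[OF inj] by simp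
  qed auto
  have cr: "card {e\<in>E. s e \<le> j \<and> j < t e} \<le> k" for j
  proof (cases "{e\<in>E. s e \<le> j \<and> j < t e} = {}")
    case True
    then show ?thesis by (metis card.empty le0)
  next
    case False
    then obtain e where e: "s e \<le> j" "j < t e" by blast
    \<comment> \<open>A crossed level lies in the image of \<open>A\<close>, hence is \<phi> of an
      uncontracted cut \<open>i\<close>, and edges crossing the level come from edges crossing
      \<open>i\<close>.\<close>
    have "0 \<le> s e" by (simp add: s_def \<phi>_def)
    moreover have "t e \<le> int (card A)" unfolding t_def \<phi>_def using fA by (auto intro!: card_mono)
    ultimately have "j \<in> \<phi> ` A" unfolding im using e by auto
    then obtain i where i: "i \<in> A" "j = \<phi> i" by auto
    have "{e\<in>E. s e \<le> j \<and> j < t e} \<subseteq> {e\<in>E. fst e \<le> i \<and> i < snd e}"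
    proof safe
      fix x y assume xy: "(x, y) \<in> E" "s (x, y) \<le> j" "j < t (x, y)"
      then have "\<phi> x \<le> \<phi> i" "\<phi> i < \<phi> y" using st[OF xy(1)] i by auto
      then show "fst (x, y) \<le> i" "i < snd (x, y)"
        using strict[of i x] mono[of y i] i by force+
    qed
    then have "card {e\<in>E. s e \<le> j \<and> j < t e} \<le> card {e\<in>E. fst e \<le> i \<and> i < snd e}"
      using fE by (intro card_mono) auto
    also have "\<dots> \<le> k" unfolding E_def by (rule k[OF i(1)])
    finally show ?thesis .
  qed
  define M where "M = msteps s t E"
  have edge: "(\<phi> x, \<phi> y) \<in> M" if "(x, y) \<in> E" for x y
    using that st[OF that] by (force simp: M_def msteps_def)
  have unit: "(\<phi> x, \<phi> (x + int m)) \<in> M ^^ m" if "1 \<le> x" "x + int m \<le> int N" for x m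
    using that
  proof (induction m)
    case (Suc m)
    have "(x + int m, x + int m + 1) \<in> E" using Suc.prems by (auto simp: E_def skeleton_def)
    from edge[OF this] Suc show ?case by (auto simp: algebra_simps)
  qed auto
  have M_sym: "(y, x) \<in> M ^^ m" if "(x, y) \<in> M ^^ m" for x y m
    using relpow_sym[OF msteps_sym that[unfolded M_def]] by (simp add: M_def)
  have pair: "\<exists>m\<le>L. (\<phi> x, \<phi> y) \<in> M ^^ m" if "(x, y) \<in> S" for x y
  proof (cases "int L < y - x")
    case True
    then have "(x, y) \<in> E" using that by (auto simp: E_def skeleton_def)
    from edge[OF this] show ?thesis using L by (intro exI[of _ 1]) auto
  next
    case False
    have "1 \<le> x" "x < y" "y \<le> int N" using that S by (auto simp: LR_def)
    then show ?thesis using unit[of x "nat (y - x)"] False by (intro exI[of _ "nat (y - x)"]) auto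
  qed
  \<comment> \<open>An edge missing from the skeleton is simulated by at most \<open>L\<close> unit
    steps, so radius \<open>h\<close> becomes \<open>L * h\<close> in the contraction.\<close>
  have step: "\<exists>m\<le>L. (\<phi> x, \<phi> y) \<in> M ^^ m" if "(x, y) \<in> adj (snd (fin_graph N S))" for x y
  proof -
    from that consider z where "1 \<le> z" "z + 1 \<le> int N" "{x, y} = {z, z + 1}" | u v where "(u, v) \<in> S" "{x, y} = {u, v}"
      by (auto simp: adj_def fin_graph_def)
    then show ?thesis
    proof cases
      case (1 z)
      have "(\<phi> z, \<phi> (z + 1)) \<in> M ^^ 1" using unit[of z 1] 1 by simp
      with M_sym[OF this] 1(3) have "(\<phi> x, \<phi> y) \<in> M ^^ 1" by (auto simp: doubleton_eq_iff)
      then show ?thesis using L by blast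
    next
      case (2 u v)
      from pair[OF 2(1)] obtain m where "m \<le> L" "(\<phi> u, \<phi> v) \<in> M ^^ m" by blast
      with M_sym[OF this(2)] 2(2) show ?thesis by (auto simp: doubleton_eq_iff)
    qed
  qed
  have path: "\<exists>m'\<le>L * m. (\<phi> x, \<phi> y) \<in> M ^^ m'" if "(x, y) \<in> adj (snd (fin_graph N S)) ^^ m" for x y m
    using that
  proof (induction m arbitrary: y)
    case 0
    then show ?case by (intro exI[of _ 0]) auto
  next
    case (Suc m)
    then obtain z where z: "(x, z) \<in> adj (snd (fin_graph N S)) ^^ m" "(z, y) \<in> adj (snd (fin_graph N S))" by auto
    from Suc.IH[OF z(1)] step[OF z(2)] obtain m1 m2 where
      "m1 \<le> L * m" "(\<phi> x, \<phi> z) \<in> M ^^ m1" "m2 \<le> L" "(\<phi> z, \<phi> y) \<in> M ^^ m2" by blast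
    then show ?case by (intro exI[of _ "m1 + m2"]) (auto simp: relpow_add)
  qed
  let ?C = "{a'\<in>A. \<exists>m\<le>h. (a, a') \<in> adj (snd (fin_graph N S)) ^^ m}"
  have "card ?C = card (\<phi> ` ?C)"
    using inj by (intro card_image[symmetric]) (auto intro: inj_on_subset)
  also have "\<dots> \<le> card (mball s t E (L * h) (\<phi> a))"
  proof (rule card_mono[OF finite_mball[OF fE]])
    show "\<phi> ` ?C \<subseteq> mball s t E (L * h) (\<phi> a)"
    proof safe
      fix x m assume "m \<le> h" "(a, x) \<in> adj (snd (fin_graph N S)) ^^ m"
      with path[of a x m] obtain m' where "m' \<le> L * m" "(\<phi> a, \<phi> x) \<in> M ^^ m'" by blast
      moreover have "L * m \<le> L * h" using \<open>m \<le> h\<close> by simp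
      ultimately show "\<phi> x \<in> mball s t E (L * h) (\<phi> a)"
        unfolding mball_def M_def by (blast intro: order_trans)
    qed
  qed
  also have "\<dots> \<le> (2 * (L * h) + 1) ^ k"
    by (rule card_mball_le[OF fE st_le cr])
  finally show ?thesis .
qed

lemma card_ordered_pairs:
  fixes A :: "'a::linorder set"
  assumes "finite A"
  shows "2 * card {z\<in>A \<times> A. fst z < snd z} + card A = card A * card A"
proof -
  let ?U = "{z\<in>A \<times> A. fst z < snd z}"
  have fU: "finite ?U" using assms by auto
  have "A \<times> A = (?U \<union> prod.swap ` ?U) \<union> (\<lambda>x. (x, x)) ` A"
    by (auto simp: image_iff neq_iff)
  then have "card A * card A = card ((?U \<union> prod.swap ` ?U) \<union> (\<lambda>x. (x, x)) ` A)"
    by (metis card_cartesian_product)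
  also have "\<dots> = card (?U \<union> prod.swap ` ?U) + card ((\<lambda>x. (x, x)) ` A)"
    using fU assms by (intro card_Un_disjoint) auto
  also have "card (?U \<union> prod.swap ` ?U) = card ?U + card (prod.swap ` ?U)"
    using fU by (intro card_Un_disjoint) auto
  also have "card (prod.swap ` ?U) = card ?U" by (intro card_image) simp
  also have "card ((\<lambda>x. (x, x)) ` A) = card A" by (intro card_image) (auto simp: inj_on_def)
  finally show ?thesis by simp
qed

text \<open>With n = \<open>card A\<close> there are (n^2 - n)/2 ordered pairs and at most n^2/8
  near ones; n \<ge> 4 gives n/2 \<le> n^2/8, which leaves n^2/4.\<close>

lemma card_far_low_cuts:
  assumes S: "S \<subseteq> LR N" and L: "L \<ge> 1" and A: "A \<subseteq> {1..<int N}"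
    and k: "\<And>i. i \<in> A \<Longrightarrow> card {e\<in>skeleton N L S. fst e \<le> i \<and> i < snd e} \<le> k"
    and B: "real ((2 * (L * h) + 1) ^ k) \<le> real (card A) / 8" and A4: "card A \<ge> 4"
  shows "(real (card A))\<^sup>2 / 4
      \<le> real (card {z\<in>A \<times> A. fst z < snd z \<and> \<not> (\<exists>m\<le>h. z \<in> adj (snd (fin_graph N S)) ^^ m)})"
proof -
  let ?near = "\<lambda>a. {a'\<in>A. \<exists>m\<le>h. (a, a') \<in> adj (snd (fin_graph N S)) ^^ m}"
  let ?Q = "{z\<in>A \<times> A. fst z < snd z \<and> \<not> (\<exists>m\<le>h. z \<in> adj (snd (fin_graph N S)) ^^ m)}"
  let ?U = "{z\<in>A \<times> A. fst z < snd z}"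
  have fA: "finite A" using A finite_subset by blast
  have "card ?U \<le> card (?Q \<union> Sigma A ?near)"
    using fA by (intro card_mono) auto
  also have "\<dots> \<le> card ?Q + card (Sigma A ?near)" by (rule card_Un_le)
  also have "card (Sigma A ?near) = (\<Sum>a\<in>A. card (?near a))"
    using fA by (intro card_SigmaI) auto
  also have "\<dots> \<le> (\<Sum>a\<in>A. (2 * (L * h) + 1) ^ k)"
    by (intro sum_mono card_low_cuts_near[OF S L A k])
  finally have "card ?U \<le> card ?Q + card A * (2 * (L * h) + 1) ^ k" by simp
  then have "real (card ?U) \<le> real (card ?Q) + real (card A) * real ((2 * (L * h) + 1) ^ k)"
    by (subst of_nat_mult[symmetric], subst of_nat_add[symmetric], subst of_nat_le_iff)
  also have "\<dots> \<le> real (card ?Q) + real (card A) * (real (card A) / 8)"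
    using B by (intro add_left_mono mult_left_mono) auto
  finally have 1: "real (card ?U) \<le> real (card ?Q) + (real (card A))\<^sup>2 / 8"
    by (simp add: power2_eq_square)
  have 2: "2 * real (card ?U) + real (card A) = (real (card A))\<^sup>2"
    using arg_cong[OF card_ordered_pairs[OF fA], of real] by (simp add: power2_eq_square)
  have 3: "real (card A) * 4 \<le> (real (card A))\<^sup>2"
    using A4 unfolding power2_eq_square by (intro mult_left_mono) auto
  from 1 2 3 show ?thesis by linarith
qed

theorem Hp_ge_of_long_len:
  assumes p: "1 \<le> p" and k: "k \<ge> 1" and eps: "\<epsilon> > 0" and L: "L \<ge> 1"
  obtains c where "c > 0"
    "eventually (\<lambda>N. \<forall>S. S \<subseteq> LR N \<and> long_len L S < (real k - \<epsilon>) * real N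
        \<longrightarrow> c * real N powr (1 / real k) \<le> Hp p (fin_graph N S)) sequentially"
proof -
  \<comment> \<open>The Markov bound gives at least 2 \<kappa>0 N - 1 low cuts, and one \<kappa>0 N
    absorbs the 1. Capping at 1 makes \<kappa>^2/2 admissible as a fraction in
    \<open>Hp_lower\<close>. The value of \<open>c1\<close> solves 3 L c1 N^(1/k) = (\<kappa> N /
    8)^(1/k), so that balls hold at most an eighth of the low cuts.\<close>
  define \<kappa>0 where "\<kappa>0 = \<epsilon> / (2 * real (k + 1))"
  define \<kappa> where "\<kappa> = min \<kappa>0 1"
  define c1 where "c1 = (\<kappa> / 8) powr (1 / real k) / (3 * real L)"
  have \<kappa>: "0 < \<kappa>0" "0 < \<kappa>" "\<kappa> \<le> 1" "\<kappa> \<le> \<kappa>0" using eps by (auto simp: \<kappa>_def \<kappa>0_def)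
  have c1: "0 < c1" using \<kappa> L by (auto simp: c1_def)
  have "eventually (\<lambda>N. 1 \<le> \<kappa>0 * real N) sequentially" using \<kappa>(1) by real_asymp
  moreover have "eventually (\<lambda>N. 4 \<le> \<kappa> * real N) sequentially" using \<kappa>(2) by real_asymp
  moreover have "eventually (\<lambda>N. 1 \<le> c1 * real N powr (1 / real k)) sequentially"
  proof -
    have "1 / real k > 0" using k by simp
    then show ?thesis using c1 by real_asymp
  qed
  ultimately have "eventually (\<lambda>N. \<forall>S. S \<subseteq> LR N \<and> long_len L S < (real k - \<epsilon>) * real N
        \<longrightarrow> \<kappa>\<^sup>2 / 2 * c1 * real N powr (1 / real k) \<le> Hp p (fin_graph N S)) sequentially"
    using eventually_ge_at_top[of 2]
  proof eventually_elim
    case (elim N)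
    show ?case
    proof (intro allI impI)
      fix S assume asm: "S \<subseteq> LR N \<and> long_len L S < (real k - \<epsilon>) * real N"
      then have S: "S \<subseteq> LR N" by simp
      define A where "A = {i\<in>{1..<int N}. card {e\<in>skeleton N L S. fst e \<le> i \<and> i < snd e} \<le> k}"
      have "real (k + 1) * (real N - 1 - real (card A)) \<le> real N - 1 + long_len L S"
        unfolding A_def using elim by (intro card_low_cuts[OF S]) auto
      also have "\<dots> \<le> real (k + 1) * real N - \<epsilon> * real N"
        using asm by (simp add: algebra_simps)
      also have "\<dots> = real (k + 1) * (real N - 2 * \<kappa>0 * real N)"
        by (simp add: \<kappa>0_def field_simps)
      finally have "real N - 1 - real (card A) \<le> real N - 2 * \<kappa>0 * real N"
        by (subst (asm) mult_le_cancel_left_pos) auto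
      then have "\<kappa>0 * real N \<le> real (card A)" using elim(1) by linarith
      moreover have "\<kappa> * real N \<le> \<kappa>0 * real N" using \<kappa> by (intro mult_right_mono) auto
      ultimately have cA: "\<kappa> * real N \<le> real (card A)" by linarith
      \<comment> \<open>Rounding down loses nothing: far pairs are at distance at least
        \<open>h + 1\<close>.\<close>
      define h where "h = nat \<lfloor>c1 * real N powr (1 / real k)\<rfloor>"
      have h: "real h \<le> c1 * real N powr (1 / real k)" "c1 * real N powr (1 / real k) \<le> real (h + 1)"
        using c1 by (auto simp: h_def) linarith
      have "real (2 * (L * h) + 1) \<le> 3 * real L * (c1 * real N powr (1 / real k))"
      proof -
        have "real L * real h \<le> real L * (c1 * real N powr (1 / real k))"
          using h by (intro mult_left_mono) auto
        moreover have "1 * 1 \<le> real L * (c1 * real N powr (1 / real k))"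
          using L elim(3) by (intro mult_mono) auto
        ultimately show ?thesis by simp
      qed
      also have "\<dots> = (\<kappa> * real N / 8) powr (1 / real k)"
        using L \<kappa> by (simp add: c1_def powr_mult powr_divide)
      finally have "real (2 * (L * h) + 1) ^ k \<le> ((\<kappa> * real N / 8) powr (1 / real k)) ^ k"
        by (intro power_mono) auto
      also have "\<dots> = \<kappa> * real N / 8"
        using k \<kappa> elim(4) by (simp add: powr_realpow[symmetric] powr_powr)
      finally have "real ((2 * (L * h) + 1) ^ k) \<le> real (card A) / 8"
        using cA by simp
      moreover have "card A \<ge> 4" using cA elim(2) by linarith
      ultimately have far: "(real (card A))\<^sup>2 / 4
          \<le> real (card {z\<in>A \<times> A. fst z < snd z \<and> \<not> (\<exists>m\<le>h. z \<in> adj (snd (fin_graph N S)) ^^ m)})"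
        by (intro card_far_low_cuts[OF S L]) (auto simp: A_def)
      \<comment> \<open>There are at least (\<kappa> N)^2/4 far pairs out of at most N^2/2, hence
        the fraction \<kappa>^2/2.\<close>
      have "\<kappa>\<^sup>2 / 2 * real (h + 1) \<le> Hp p (fin_graph N S)"
      proof (rule Hp_lower[OF p])
        let ?Q = "{z\<in>A \<times> A. fst z < snd z \<and> \<not> (\<exists>m\<le>h. z \<in> adj (snd (fin_graph N S)) ^^ m)}"
        show "?Q \<subseteq> {(x, y). x \<in> {1..int N} \<and> y \<in> {1..int N} \<and> x < y}" by (auto simp: A_def)
        have "real (N choose 2) = real N * (real N - 1) / 2"
          using elim(4) by (simp add: choose_two real_of_nat_div of_nat_diff)
        also have "\<dots> \<le> (real N)\<^sup>2 / 2" by (simp add: power2_eq_square algebra_simps)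
        finally have "\<kappa>\<^sup>2 / 2 * real (N choose 2) \<le> \<kappa>\<^sup>2 / 2 * ((real N)\<^sup>2 / 2)"
          by (intro mult_left_mono) auto
        also have "\<dots> = (\<kappa> * real N)\<^sup>2 / 4" by (simp add: power_mult_distrib)
        also have "\<dots> \<le> (real (card A))\<^sup>2 / 4" using cA \<kappa> by (simp add: power_mono)
        finally show "\<kappa>\<^sup>2 / 2 * real (N choose 2) \<le> real (card ?Q)" using far by linarith
        show "h + 1 \<le> the_enat (gdist (fin_graph N S) x y)" if "(x, y) \<in> ?Q" for x y
        proof -
          have "\<not> the_enat (gdist (fin_graph N S) x y) \<le> h"
            using that by (subst the_enat_gdist_le_iff) (auto simp: A_def)
          then show ?thesis by simp
        qed
        show "\<kappa>\<^sup>2 / 2 \<le> 1" using \<kappa> power_le_one[of \<kappa> 2] by simp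
      qed (use \<kappa> elim in auto)
      moreover have "\<kappa>\<^sup>2 / 2 * (c1 * real N powr (1 / real k)) \<le> \<kappa>\<^sup>2 / 2 * real (h + 1)"
        using h by (intro mult_left_mono) auto
      ultimately show "\<kappa>\<^sup>2 / 2 * c1 * real N powr (1 / real k) \<le> Hp p (fin_graph N S)" by (simp add: mult_ac)
    qed
  qed
  then show ?thesis using \<kappa> c1 by (intro that[of "\<kappa>\<^sup>2 / 2 * c1"]) auto
qed

text \<open>Too little long length forces energy of order N^(b + 1/k), which outgrows every multiple
  of N. The multiple k + 1 leaves a margin of 1 over the rate k of the partition function.\<close>

lemma eventually_energy_or_long_len:
  assumes p: "1 \<le> p" and k: "k \<ge> 1" and eps: "\<epsilon> > 0" and L: "L \<ge> 1" and b: "b + 1 / real k > 1"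
  shows "eventually (\<lambda>N. \<forall>S\<subseteq>LR N. (real k + 1) * real N \<le> real N powr b * Hp p (fin_graph N S)
      \<or> (real k - \<epsilon>) * real N \<le> long_len L S) sequentially"
proof -
  obtain c where c: "c > 0" "eventually (\<lambda>N. \<forall>S. S \<subseteq> LR N \<and> long_len L S < (real k - \<epsilon>) * real N
        \<longrightarrow> c * real N powr (1 / real k) \<le> Hp p (fin_graph N S)) sequentially"
    using Hp_ge_of_long_len[OF p k eps L] by blast
  define d where "d = b + 1 / real k - 1"
  have d: "d > 0" using b by (simp add: d_def)
  have "eventually (\<lambda>N. real k + 1 \<le> c * real N powr d) sequentially"
    using c(1) d by real_asymp
  then show ?thesis using c(2) eventually_gt_at_top[of 0]
  proof eventually_elim
    case (elim N)
    show ?case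
    proof (intro allI impI)
      fix S assume S: "S \<subseteq> LR N"
      show "(real k + 1) * real N \<le> real N powr b * Hp p (fin_graph N S) \<or> (real k - \<epsilon>) * real N \<le> long_len L S"
      proof (cases "(real k - \<epsilon>) * real N \<le> long_len L S")
        case False
        then have "real N powr b * (c * real N powr (1 / real k)) \<le> real N powr b * Hp p (fin_graph N S)"
          using elim(2) S by (intro mult_left_mono) auto
        moreover have "real N powr b * (c * real N powr (1 / real k)) = c * real N powr d * real N"
        proof -
          have "real N powr b * real N powr (1 / real k) = real N powr (d + 1)"
            by (simp add: d_def powr_add[symmetric])
          also have "\<dots> = real N powr d * real N" using elim(3) by (simp add: powr_add)
          finally show ?thesis by (simp add: mult_ac)
        qed
        moreover have "(real k + 1) * real N \<le> c * real N powr d * real N"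
          using elim(1) by (intro mult_right_mono) auto
        ultimately show ?thesis by simp
      qed auto
    qed
  qed
qed

section \<open>Lower bound on the partition function\<close>

definition edge_prob :: "real \<Rightarrow> int \<times> int \<Rightarrow> real" where
  "edge_prob \<gamma> e = conn_prob \<gamma> (fst e) (snd e)"

lemma edge_prob_bounds: "0 \<le> edge_prob \<gamma> e" "edge_prob \<gamma> e \<le> 1"
  by (auto simp: edge_prob_def conn_prob_def)

lemma PN_eq_bern: "PN N \<gamma> S = bern (edge_prob \<gamma>) (LR N) S"
  unfolding PN_def bern_def by (intro prod.cong) (auto simp: edge_prob_def)

lemma PN_nonneg: "0 \<le> PN N \<gamma> S"
  unfolding PN_eq_bern using edge_prob_bounds by (intro bern_nonneg) auto

text \<open>Layer \<open>j\<close> joins consecutive points of the progression 1, 1 + l^j, 1 + 2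
  l^j, ...; the unit edges act as layer 0.\<close>

definition hier :: "nat \<Rightarrow> nat \<Rightarrow> nat \<Rightarrow> (int \<times> int) set" where
  "hier N l k = (\<lambda>(j, i). (int (1 + i * l ^ j), int (1 + (i + 1) * l ^ j))) `
     (SIGMA j:{1..k}. {i. 1 + (i + 1) * l ^ j \<le> N})"

lemma hier_index_bound:
  assumes "l \<ge> (1::nat)"
  shows "{i. 1 + (i + 1) * l ^ j \<le> N} \<subseteq> {..<N div l ^ j}"
proof
  fix i assume "i \<in> {i. 1 + (i + 1) * l ^ j \<le> N}"
  then have "(i + 1) * l ^ j \<le> N" by auto
  then have "i + 1 \<le> N div l ^ j" using assms by (simp add: less_eq_div_iff_mult_less_eq)
  then show "i \<in> {..<N div l ^ j}" by simp
qed

lemma hier_subset_LR: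
  assumes "l \<ge> 2"
  shows "hier N l k \<subseteq> LR N"
proof -
  have "2 \<le> l ^ j" if "j \<ge> 1" for j
    using that assms self_le_power[of l j] by linarith
  then have "int (1 + i * l ^ j) + 1 < int (1 + (i + 1) * l ^ j)" if "j \<ge> 1" for i j
    using that by (fastforce simp: algebra_simps simp flip: of_nat_power)
  then show ?thesis by (auto simp: hier_def LR_def simp flip: of_nat_add of_nat_mult)
qed

text \<open>Routing by base-\<open>l\<close> digits: the leading digit of the offset
  \<open>n\<close> is walked on the top layer, the remaining digits by induction, each digit costing
  at most \<open>l\<close> steps.\<close>

lemma hier_path:
  assumes l: "l \<ge> 1" and S: "hier N l k \<subseteq> S" and "j \<le> k" "n < l ^ Suc j" "1 + i * l ^ Suc j + n \<le> N"
  shows "\<exists>m\<le>Suc j * l. (int (1 + i * l ^ Suc j), int (1 + i * l ^ Suc j + n)) \<in> adj (snd (fin_graph N S)) ^^ m"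
  using assms(3-)
proof (induction j arbitrary: i n)
  case 0
  have "(int (1 + i * l), int (1 + i * l) + int n) \<in> adj (snd (fin_graph N S)) ^^ n"
    using 0 by (intro fin_graph_interval_path) (simp_all flip: of_nat_add of_nat_mult)
  then show ?case using 0 by (intro exI[of _ n]) (auto simp: add.assoc)
next
  case (Suc j)
  define b where "b = l ^ Suc j"
  have b: "b > 0" using l by (simp add: b_def)
  define a where "a = n div b"
  define r where "r = n mod b"
  have n: "n = a * b + r" "r < b" using b by (auto simp: a_def r_def)
  have al: "a < l"
    using Suc.prems(2) b by (simp add: a_def b_def less_mult_imp_div_less mult.commute)
  have up: "(int (1 + i * l * b), int (1 + (i * l + c) * b)) \<in> adj (snd (fin_graph N S)) ^^ c" if "c \<le> a" for c
    using that
  proof (induction c)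
    case (Suc c)
    have "(i * l + Suc c) * b \<le> (i * l + a) * b" using Suc.prems by (intro mult_right_mono) auto
    then have "1 + (i * l + c + 1) * b \<le> N" using \<open>1 + i * l ^ Suc (Suc j) + n \<le> N\<close> n(1)
      by (simp add: b_def algebra_simps)
    then have "(int (1 + (i * l + c) * b), int (1 + (i * l + c + 1) * b)) \<in> hier N l k"
      using \<open>Suc j \<le> k\<close> unfolding hier_def b_def
      by (intro image_eqI[of _ _ "(Suc j, i * l + c)"]) auto
    with S have "(int (1 + (i * l + c) * b), int (1 + (i * l + Suc c) * b)) \<in> adj (snd (fin_graph N S))"
      by (force simp: adj_def fin_graph_def)
    with Suc show ?case by auto
  qed auto
  have "\<exists>m\<le>Suc j * l. (int (1 + (i * l + a) * l ^ Suc j), int (1 + (i * l + a) * l ^ Suc j + r)) \<in> adj (snd (fin_graph N S)) ^^ m"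
    using Suc.prems n by (intro Suc.IH) (auto simp: b_def algebra_simps)
  then obtain m where m: "m \<le> Suc j * l"
    "(int (1 + (i * l + a) * b), int (1 + (i * l + a) * b + r)) \<in> adj (snd (fin_graph N S)) ^^ m"
    unfolding b_def by blast
  have eq: "1 + (i * l + a) * b + r = 1 + i * l ^ Suc (Suc j) + n" "1 + i * l * b = 1 + i * l ^ Suc (Suc j)"
    using n(1) by (simp_all add: b_def algebra_simps)
  have "(int (1 + i * l ^ Suc (Suc j)), int (1 + i * l ^ Suc (Suc j) + n)) \<in> adj (snd (fin_graph N S)) ^^ (a + m)"
    using relcompI[OF up[OF order_refl] m(2)] unfolding relpow_add[symmetric] eq .
  moreover have "a + m \<le> Suc (Suc j) * l" using al m(1) by simp
  ultimately show ?case by blast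
qed

text \<open>Both vertices are routed through vertex 1, hence the factor 2.\<close>

lemma hier_diameter:
  assumes l: "l \<ge> 1" and S: "hier N l k \<subseteq> S" and N: "N \<le> l ^ Suc k"
    and x: "x \<in> {1..int N}" and y: "y \<in> {1..int N}"
  shows "the_enat (gdist (fin_graph N S) x y) \<le> 2 * (Suc k * l)"
proof -
  have *: "\<exists>m\<le>Suc k * l. (1, x) \<in> adj (snd (fin_graph N S)) ^^ m" if x: "x \<in> {1..int N}" for x
  proof -
    define n where "n = nat (x - 1)"
    have "n < l ^ Suc k" "1 + 0 * l ^ Suc k + n \<le> N" using x N by (auto simp: n_def)
    from hier_path[OF l S order_refl this] x show ?thesis by (simp add: n_def)
  qed
  from *[OF x] *[OF y] obtain m1 m2 where m: "m1 \<le> Suc k * l" "(1, x) \<in> adj (snd (fin_graph N S)) ^^ m1"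
      "m2 \<le> Suc k * l" "(1, y) \<in> adj (snd (fin_graph N S)) ^^ m2" by blast
  from adj_relpow_sym[OF m(2)] m(4) have "(x, y) \<in> adj (snd (fin_graph N S)) ^^ (m1 + m2)"
    unfolding relpow_add by blast
  moreover have "m1 + m2 \<le> 2 * (Suc k * l)" using m by linarith
  ultimately show ?thesis using the_enat_gdist_le_iff[OF x y] by blast
qed

text \<open>Layer \<open>j\<close> has at most N / l^j edges of cost l^(j \<gamma>) each. For
  \<gamma> = 1 every layer costs at most N; for \<gamma> < 1 a growing \<open>l\<close> makes the
  total o(N). With k = 0 there are no layers, so any \<gamma> is allowed.\<close>

lemma hier_cost:
  assumes l: "l \<ge> 1" and \<gamma>: "\<gamma> \<le> 1 \<or> k = 0"
  shows "(\<Sum>e\<in>hier N l k. real_of_int \<bar>snd e - fst e\<bar> powr \<gamma>) \<le> real k * real N * real l powr (\<gamma> - 1)"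
proof -
  let ?I = "\<lambda>j. {i. 1 + (i + 1) * l ^ j \<le> N}"
  let ?f = "\<lambda>(j, i). (int (1 + i * l ^ j), int (1 + (i + 1) * l ^ j))"
  have fin: "finite (?I j)" for j
    using hier_index_bound[OF l] finite_subset by blast
  have "(\<Sum>e\<in>hier N l k. real_of_int \<bar>snd e - fst e\<bar> powr \<gamma>)
      \<le> (\<Sum>z\<in>(SIGMA j:{1..k}. ?I j). real_of_int \<bar>snd (?f z) - fst (?f z)\<bar> powr \<gamma>)"
    unfolding hier_def using fin by (intro order_trans[OF sum_image_le]) (auto intro: finite_SigmaI)
  also have "\<dots> = (\<Sum>z\<in>(SIGMA j:{1..k}. ?I j). real (l ^ fst z) powr \<gamma>)"
    by (intro sum.cong) (auto simp: algebra_simps)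
  also have "\<dots> = (\<Sum>j\<in>{1..k}. \<Sum>i\<in>?I j. real (l ^ j) powr \<gamma>)"
    using fin by (subst sum.Sigma) (auto simp: case_prod_beta)
  also have "\<dots> \<le> (\<Sum>j\<in>{1..k}. real N * real l powr (\<gamma> - 1))"
  proof (rule sum_mono)
    fix j assume j: "j \<in> {1..k}"
    then have \<gamma>1: "\<gamma> \<le> 1" using \<gamma> by auto
    have pos: "real (l ^ j) > 0" using l by simp
    have "card (?I j) \<le> N div l ^ j"
      using card_mono[OF _ hier_index_bound[OF l, of j N]] by simp
    then have "real (card (?I j)) \<le> real N / real (l ^ j)"
      by (meson of_nat_le_iff of_nat_div_le_of_nat order_trans)
    then have "(\<Sum>i\<in>?I j. real (l ^ j) powr \<gamma>) \<le> real N / real (l ^ j) * real (l ^ j) powr \<gamma>"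
      by (simp only: sum_constant) (intro mult_right_mono, auto)
    also have "\<dots> = real N * real (l ^ j) powr (\<gamma> - 1)"
      using pos by (simp add: powr_diff del: of_nat_power)
    also have "real (l ^ j) powr (\<gamma> - 1) \<le> real l powr (\<gamma> - 1)"
    proof (rule powr_mono2')
      show "real l \<le> real (l ^ j)" using l j self_le_power[of l j] by (simp del: of_nat_power)
    qed (use l \<gamma>1 in auto)
    finally show "(\<Sum>i\<in>?I j. real (l ^ j) powr \<gamma>) \<le> real N * real l powr (\<gamma> - 1)"
      by (simp add: mult_left_mono)
  qed
  finally show ?thesis by simp
qed

text \<open>Only the presence of \<open>S0\<close> is prescribed, so all other edges stay free and
  the probability is just a product of edge probabilities; in exchange the distance bound must hold
  for all supersets.\<close>

lemma Zfun_ge: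
  assumes p: "1 \<le> p" and N: "N \<ge> 1" and S0: "S0 \<subseteq> LR N"
    and d: "\<And>S x y. S0 \<subseteq> S \<Longrightarrow> x \<in> {1..int N} \<Longrightarrow> y \<in> {1..int N} \<Longrightarrow> the_enat (gdist (fin_graph N S) x y) \<le> h"
  shows "exp (- (real N powr b * real h) - (\<Sum>e\<in>S0. real_of_int \<bar>snd e - fst e\<bar> powr \<gamma>)) \<le> Zfun N \<gamma> b p"
proof -
  let ?A = "{S\<in>Pow (LR N). S0 \<subseteq> S}"
  have "exp (- (real N powr b * real h)) * (\<Sum>S\<in>?A. PN N \<gamma> S) \<le> (\<Sum>S\<in>?A. tilt_weight N \<gamma> b p S)"
    unfolding sum_distrib_left tilt_weight_def
  proof (intro sum_mono mult_right_mono PN_nonneg)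
    fix S assume "S \<in> ?A"
    then have "Hp p (fin_graph N S) \<le> real h" using d by (intro Hp_upper[OF p N]) auto
    then show "exp (- (real N powr b * real h)) \<le> exp (- (real N powr b * Hp p (fin_graph N S)))"
      by (simp add: mult_left_mono)
  qed
  also have "\<dots> \<le> Zfun N \<gamma> b p"
    unfolding Zfun_def using PN_nonneg finite_LR by (intro sum_mono2) (auto simp: tilt_weight_def)
  also have "(\<Sum>S\<in>?A. PN N \<gamma> S) = (\<Prod>e\<in>S0. edge_prob \<gamma> e)"
    unfolding PN_eq_bern by (rule sum_bern_superset[OF finite_LR S0])
  also have "(\<Prod>e\<in>S0. edge_prob \<gamma> e) = exp (- (\<Sum>e\<in>S0. real_of_int \<bar>snd e - fst e\<bar> powr \<gamma>))"
    using finite_subset[OF S0 finite_LR] by (simp add: edge_prob_def conn_prob_def exp_sum sum_negf[symmetric])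
  finally show ?thesis by (simp add: mult_exp_exp)
qed

text \<open>With \<open>l\<close> near N^(1/(k+1)) the diameter is of the same order as
  \<open>l\<close>, so the energy is o(N) and only the cost of the planted edges matters. The case k
  = 0 plants nothing and uses the trivial linear diameter.\<close>

lemma eventually_Zfun_ge:
  assumes p: "1 \<le> p" and b: "b + 1 / real (k + 1) < 1" and \<gamma>: "\<gamma> \<le> 1 \<or> k = 0" and \<eta>: "\<eta> > 0"
  shows "eventually (\<lambda>N. exp (- (((if \<gamma> = 1 then real k else 0) + \<eta>) * real N)) \<le> Zfun N \<gamma> b p) sequentially"
proof -
  define a where "a = 1 / real (k + 1)"
  have a: "a > 0" by (simp add: a_def)
  define r where "r = (if \<gamma> = 1 then real k else 0)"
  define \<beta> where "\<beta> = b + a - 1"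
  have \<beta>: "\<beta> < 0" using b by (simp add: \<beta>_def a_def)
  define M where "M = 4 * real (k + 1)"
  have "eventually (\<lambda>N. M * real N powr \<beta> \<le> \<eta> / 2) sequentially"
    using \<eta> \<beta> by real_asymp
  moreover have "eventually (\<lambda>N. real k * (real N powr a) powr (\<gamma> - 1) \<le> r + \<eta> / 2) sequentially"
  proof -
    consider "k = 0" | "\<gamma> = 1" | "\<gamma> < 1" using \<gamma> by linarith
    then show ?thesis
    proof cases
      case 1
      then show ?thesis using \<eta> by (auto simp: r_def)
    next
      case 2
      then show ?thesis using \<eta> by (auto simp: r_def intro!: always_eventually)
    next
      case 3
      define c where "c = \<gamma> - 1"
      have c: "c < 0" using 3 by (simp add: c_def)
      define s where "s = a * c"
      have s: "s < 0" using a c by (simp add: s_def mult_pos_neg)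
      define K where "K = real k"
      have "eventually (\<lambda>N. K * real N powr s \<le> \<eta> / 2) sequentially"
        using \<eta> s by real_asymp
      then show ?thesis using 3 by (simp add: r_def powr_powr s_def c_def K_def)
    qed
  qed
  ultimately show ?thesis using eventually_ge_at_top[of 2]
  proof eventually_elim
    case (elim N)
    \<comment> \<open>Rounding up secures N \<le> l^(k+1), so \<open>k\<close> layers reach every
      vertex, and costs at most a factor 2.\<close>
    define l where "l = nat \<lceil>real N powr a\<rceil>"
    have N1: "1 < real N powr a" using elim(3) a by (intro gr_one_powr) auto
    have l1: "real N powr a \<le> real l" unfolding l_def by linarith
    have "real l \<le> real N powr a + 1" unfolding l_def using N1 by linarith
    then have l2: "real l \<le> 2 * real N powr a" using N1 by linarith
    have l3: "l \<ge> 2" using N1 l1 by linarith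
    have Nl: "N \<le> l ^ Suc k"
    proof -
      have "real N = (real N powr a) powr real (k + 1)"
        using elim(3) by (simp add: powr_powr a_def)
      also have "\<dots> \<le> real l powr real (k + 1)" using l1 by (intro powr_mono2) auto
      also have "\<dots> = real (l ^ Suc k)" using l3 by (subst powr_realpow) auto
      finally show ?thesis by (simp only: of_nat_le_iff)
    qed
    have "exp (- (real N powr b * real (2 * (Suc k * l))) - (\<Sum>e\<in>hier N l k. real_of_int \<bar>snd e - fst e\<bar> powr \<gamma>))
        \<le> Zfun N \<gamma> b p"
      using l3 elim(3) hier_diameter[OF _ _ Nl] by (intro Zfun_ge[OF p] hier_subset_LR) auto
    moreover have "real N powr b * real (2 * (Suc k * l)) \<le> \<eta> / 2 * real N"
    proof -
      have "real N powr b * real (2 * (Suc k * l)) = real N powr b * (2 * real (k + 1)) * real l" by (simp add: algebra_simps)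
      also have "\<dots> \<le> real N powr b * (2 * real (k + 1)) * (2 * real N powr a)"
        using l2 by (intro mult_left_mono) auto
      also have "\<dots> = M * real N powr \<beta> * real N"
      proof -
        have "real N powr b * real N powr a = real N powr (\<beta> + 1)"
          by (simp add: \<beta>_def powr_add[symmetric])
        also have "\<dots> = real N powr \<beta> * real N" using elim(3) by (simp add: powr_add)
        finally have *: "real N powr b * real N powr a = real N powr \<beta> * real N" .
        have "real N powr b * (2 * real (k + 1)) * (2 * real N powr a) = M * (real N powr b * real N powr a)"
          by (simp add: M_def)
        then show ?thesis unfolding * by simp
      qed
      also have "\<dots> \<le> \<eta> / 2 * real N" using elim(1) by (intro mult_right_mono) auto
      finally show ?thesis .
    qed
    moreover have "(\<Sum>e\<in>hier N l k. real_of_int \<bar>snd e - fst e\<bar> powr \<gamma>) \<le> (r + \<eta> / 2) * real N"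
    proof -
      have "(\<Sum>e\<in>hier N l k. real_of_int \<bar>snd e - fst e\<bar> powr \<gamma>) \<le> real k * real N * real l powr (\<gamma> - 1)"
        using l3 \<gamma> by (intro hier_cost) auto
      also have "\<dots> \<le> real k * real N * (real N powr a) powr (\<gamma> - 1)"
      proof (cases "k = 0")
        case False
        then have "\<gamma> \<le> 1" using \<gamma> by auto
        then show ?thesis using l1 N1 elim(3) by (intro mult_left_mono powr_mono2') auto
      qed auto
      also have "\<dots> = real k * (real N powr a) powr (\<gamma> - 1) * real N" by simp
      also have "\<dots> \<le> (r + \<eta> / 2) * real N" using elim(2) by (intro mult_right_mono) auto
      finally show ?thesis .
    qed
    ultimately have "exp (- ((r + \<eta>) * real N)) \<le> Zfun N \<gamma> b p"
      by (elim order_trans[rotated]) (simp add: algebra_simps)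
    then show ?case by (simp add: r_def)
  qed
qed

section \<open>Locality of the ball event\<close>

definition bverts :: "int set \<Rightarrow> int set set \<Rightarrow> nat \<Rightarrow> int \<Rightarrow> int set" where
  "bverts V E \<rho> v = {x\<in>V. \<exists>m\<le>\<rho>. (v, x) \<in> adj E ^^ m}"

definition target :: "graph \<Rightarrow> int \<Rightarrow> int \<Rightarrow> int set" where
  "target g r v = (\<lambda>x. x - r + v) ` fst g"

text \<open>The isomorphism can only be the translation taking one root to the other, so a match
  means that the ball is one prescribed vertex set. Stating it through that fixed set makes locality
  visible; \<open>V\<close> and \<open>E\<close> are separate so that the finite and infinite graphs
  share it.\<close>

definition ball_match :: "graph \<Rightarrow> int \<Rightarrow> nat \<Rightarrow> int set \<Rightarrow> int set set \<Rightarrow> int \<Rightarrow> bool" where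
  "ball_match g r \<rho> V E v \<longleftrightarrow> bverts V E \<rho> v = target g r v \<and>
     {e\<in>E. e \<subseteq> target g r v} = (\<lambda>e. (\<lambda>x. x - r + v) ` e) ` snd g"

lemma rooted_iso_ball_iff:
  assumes v: "v \<in> V" and R: "0 \<le> R"
  shows "rooted_iso (ball_graph (V, E) v R, v) (g, r) \<longleftrightarrow> ball_match g r (nat \<lfloor>R\<rfloor>) V E v"
proof -
  let ?B = "bverts V E (nat \<lfloor>R\<rfloor>) v" and ?t = "\<lambda>x. x - v + r" and ?u = "\<lambda>x. x - r + v"
  have "(\<exists>n. gdist (V, E) v x = enat n \<and> real n \<le> R) \<longleftrightarrow> gdist (V, E) v x \<le> enat (nat \<lfloor>R\<rfloor>)" for x
    using R by (cases "gdist (V, E) v x") (auto simp: le_nat_iff le_floor_iff)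
  then have ball: "ball_graph (V, E) v R = (?B, {e\<in>E. e \<subseteq> ?B})"
    using v by (auto simp: ball_graph_def Let_def bverts_def gdist_le_iff)
  have tu: "?t ` X = Y \<longleftrightarrow> X = ?u ` Y" for X Y :: "int set"
    by (auto simp: image_image image_iff)
  have tu2: "(\<lambda>e. ?t ` e) ` \<X> = \<Y> \<longleftrightarrow> \<X> = (\<lambda>e. ?u ` e) ` \<Y>" for \<X> \<Y> :: "int set set"
  proof -
    have "(\<lambda>e. ?u ` e) ` (\<lambda>e. ?t ` e) ` \<X> = \<X>" "(\<lambda>e. ?t ` e) ` (\<lambda>e. ?u ` e) ` \<Y> = \<Y>"
      by (simp_all add: image_image)
    then show ?thesis by metis
  qed
  show ?thesis
    unfolding rooted_iso_def Let_def ball ball_match_def target_def fst_conv snd_conv tu tu2 by metis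
qed

lemma relpow_mono: "(R :: ('a \<times> 'a) set) \<subseteq> R' \<Longrightarrow> (x, y) \<in> R ^^ n \<Longrightarrow> (x, y) \<in> R' ^^ n"
  by (induction n arbitrary: y) auto

lemma adj_mono: "E \<subseteq> E' \<Longrightarrow> adj E \<subseteq> adj E'"
  by (auto simp: adj_def)

lemma ball_match_path_target:
  assumes "ball_match g r \<rho> V E v" "(v, x) \<in> adj E ^^ m" "m \<le> \<rho>" "v \<in> V" "\<And>e. e \<in> E \<Longrightarrow> e \<subseteq> V"
  shows "x \<in> target g r v"
proof -
  have "x \<in> V"
  proof (cases m)
    case (Suc n)
    then obtain u where "(u, x) \<in> adj E" using assms(2) by auto
    then show ?thesis using assms(5) by (auto simp: adj_def)
  qed (use assms in auto)
  then have "x \<in> bverts V E \<rho> v" using assms(2,3) by (auto simp: bverts_def)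
  then show ?thesis using assms(1) by (simp add: ball_match_def)
qed

text \<open>Exploring \<rho> steps from \<open>v\<close> never leaves the target, so only edges
  meeting the target are inspected. Edges with just one end inside count as well, since their
  presence could enlarge the ball.\<close>

lemma ball_match_cong_imp:
  assumes bm: "ball_match g r \<rho> V E v" and v: "v \<in> V"
    and E: "\<And>e. e \<in> E \<Longrightarrow> e \<subseteq> V" and W: "target g r v \<subseteq> V'"
    and eq: "\<And>e. e \<inter> target g r v \<noteq> {} \<Longrightarrow> e \<in> E \<longleftrightarrow> e \<in> E'"
    and ne: "{} \<notin> E" "{} \<notin> E'"
  shows "ball_match g r \<rho> V' E' v"
proof -
  let ?W = "target g r v"
  have path: "(v, x) \<in> adj E ^^ m \<longleftrightarrow> (v, x) \<in> adj E' ^^ m" if "m \<le> \<rho>" for m x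
    using that
  proof (induction m arbitrary: x)
    case (Suc m)
    have "u \<in> ?W" if "(v, u) \<in> adj E ^^ m" for u
      using ball_match_path_target[OF bm that _ v E] Suc.prems by simp
    then have step: "(u, x) \<in> adj E \<longleftrightarrow> (u, x) \<in> adj E'" if "(v, u) \<in> adj E ^^ m" for u
      using eq[of "{u, x}"] that by (auto simp: adj_def)
    have IH: "(v, u) \<in> adj E ^^ m \<longleftrightarrow> (v, u) \<in> adj E' ^^ m" for u
      using Suc by simp
    show ?case unfolding relpow.simps relcomp_unfold using step IH by blast
  qed auto
  have bW: "bverts V E \<rho> v = ?W" using bm by (simp add: ball_match_def)
  have "bverts V' E' \<rho> v = bverts V E \<rho> v"
  proof
    show "bverts V E \<rho> v \<subseteq> bverts V' E' \<rho> v"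
    proof
      fix x assume x: "x \<in> bverts V E \<rho> v"
      then obtain m where "m \<le> \<rho>" "(v, x) \<in> adj E' ^^ m" using path by (auto simp: bverts_def)
      moreover have "x \<in> V'" using x W bW by blast
      ultimately show "x \<in> bverts V' E' \<rho> v" by (auto simp: bverts_def)
    qed
    show "bverts V' E' \<rho> v \<subseteq> bverts V E \<rho> v"
    proof
      fix x assume "x \<in> bverts V' E' \<rho> v"
      then obtain m where "m \<le> \<rho>" "(v, x) \<in> adj E ^^ m" using path by (auto simp: bverts_def)
      then show "x \<in> bverts V E \<rho> v"
        using ball_match_path_target[OF bm _ _ v E] bm by (simp add: ball_match_def)
    qed
  qed
  \<comment> \<open>The empty set would be contained in the target without meeting it;
    \<open>ne\<close> excludes this.\<close>
  moreover have "{e\<in>E'. e \<subseteq> ?W} = {e\<in>E. e \<subseteq> ?W}"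
    using eq ne by (metis (no_types, lifting) Collect_cong Int_absorb2)
  ultimately show ?thesis using bm by (simp add: ball_match_def)
qed

text \<open>Paths of length at most \<rho> use edges inside the target only, so deleting other edges
  breaks none of them. This is one-sided: an added edge may enlarge the ball.\<close>

lemma ball_match_drop:
  assumes bm: "ball_match g r \<rho> V E v" and v: "v \<in> V" and E: "\<And>e. e \<in> E \<Longrightarrow> e \<subseteq> V"
    and sub: "E' \<subseteq> E" "{e\<in>E. e \<subseteq> target g r v} \<subseteq> E'"
  shows "ball_match g r \<rho> V E' v"
proof -
  let ?W = "target g r v"
  have path: "(v, x) \<in> adj E' ^^ m" if "(v, x) \<in> adj E ^^ m" "m \<le> \<rho>" for m x
    using that
  proof (induction m arbitrary: x)
    case (Suc m)
    then obtain u where u: "(v, u) \<in> adj E ^^ m" "(u, x) \<in> adj E" by auto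
    have "u \<in> ?W" "x \<in> ?W"
      using ball_match_path_target[OF bm u(1) _ v E] ball_match_path_target[OF bm Suc.prems v E] Suc.prems by auto
    then have "(u, x) \<in> adj E'" using u(2) sub(2) by (auto simp: adj_def)
    then show ?case using Suc.IH[OF u(1)] Suc.prems(2) by auto
  qed auto
  have "bverts V E' \<rho> v = bverts V E \<rho> v"
    using path relpow_mono[OF adj_mono[OF sub(1)]] by (fastforce simp: bverts_def)
  moreover have "{e\<in>E'. e \<subseteq> ?W} = {e\<in>E. e \<subseteq> ?W}" using sub by auto
  ultimately show ?thesis using bm by (simp add: ball_match_def)
qed

text \<open>Edges inside the target are translates of edges of \<open>g\<close>, whose degrees are
  finite, so each sphere of the ball is finite by induction on its radius.\<close>

lemma ball_match_finite:
  assumes bm: "ball_match g r \<rho> V E v" and v: "v \<in> V" and E: "\<And>e. e \<in> E \<Longrightarrow> e \<subseteq> V" and g: "is_graph g"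
  shows "finite (fst g)"
proof -
  let ?W = "target g r v" and ?t = "\<lambda>x. x - v + r"
  have fin: "finite {x. (v, x) \<in> adj E ^^ m}" if "m \<le> \<rho>" for m
    using that
  proof (induction m)
    case 0
    then show ?case by simp
  next
    case (Suc m)
    have "{x. (v, x) \<in> adj E ^^ Suc m} \<subseteq> (\<Union>u\<in>{u. (v, u) \<in> adj E ^^ m}. (\<lambda>y. y - r + v) ` {y. {?t u, y} \<in> snd g})"
    proof
      fix x assume "x \<in> {x. (v, x) \<in> adj E ^^ Suc m}"
      then obtain u where u: "(v, u) \<in> adj E ^^ m" "(u, x) \<in> adj E" by auto
      have "u \<in> ?W" "x \<in> ?W"
        using ball_match_path_target[OF bm u(1) _ v E] ball_match_path_target[OF bm relpow_Suc_I[OF u] _ v E] Suc.prems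
        by auto
      then have "{u, x} \<in> (\<lambda>e. (\<lambda>x. x - r + v) ` e) ` snd g"
        using u(2) bm by (auto simp: ball_match_def adj_def)
      then obtain e where e: "e \<in> snd g" "{u, x} = (\<lambda>x. x - r + v) ` e" by auto
      have "{?t u, ?t x} = ?t ` {u, x}" by simp
      also have "\<dots> = e" unfolding e(2) by (simp add: image_image)
      finally have "{?t u, ?t x} \<in> snd g" using e(1) by simp
      then have "x \<in> (\<lambda>y. y - r + v) ` {y. {?t u, y} \<in> snd g}"
        by (intro image_eqI[of _ _ "?t x"]) auto
      then show "x \<in> (\<Union>u\<in>{u. (v, u) \<in> adj E ^^ m}. (\<lambda>y. y - r + v) ` {y. {?t u, y} \<in> snd g})"
        using u(1) by blast
    qed
    moreover have "finite {y. {?t u, y} \<in> snd g}" if "(v, u) \<in> adj E ^^ m" for u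
    proof -
      have "u \<in> ?W" using ball_match_path_target[OF bm that _ v E] Suc.prems by simp
      then have "?t u \<in> fst g" by (auto simp: target_def)
      then show ?thesis using g by (auto simp: is_graph_def)
    qed
    ultimately show ?case using Suc by (elim finite_subset) auto
  qed
  have "bverts V E \<rho> v \<subseteq> (\<Union>m\<le>\<rho>. {x. (v, x) \<in> adj E ^^ m})" by (auto simp: bverts_def)
  then have "finite (bverts V E \<rho> v)" using fin by (elim finite_subset) auto
  then have "finite ?W" using bm by (simp add: ball_match_def)
  then show ?thesis unfolding target_def by (subst (asm) finite_image_iff) (auto simp: inj_on_def)
qed

section \<open>Truncation to finitely many pairs\<close>

definition line_edges :: "(int \<times> int) set \<Rightarrow> int set set" where
  "line_edges T = {{x, x + 1} | x. True} \<union> {{x, y} | x y. (x, y) \<in> T}"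

lemma line_edges_mono: "T \<subseteq> T' \<Longrightarrow> line_edges T \<subseteq> line_edges T'"
  by (auto simp: line_edges_def)

text \<open>The length bound \<open>K\<close> is there because infinitely many pairs touch even a
  finite target.\<close>

definition local_pairs :: "graph \<Rightarrow> int \<Rightarrow> nat \<Rightarrow> int \<Rightarrow> (int \<times> int) set" where
  "local_pairs g r K v = {(x, y)\<in>LRZ. y - x \<le> int K \<and> (x \<in> target g r v \<or> y \<in> target g r v)}"

lemma finite_local_pairs:
  assumes "finite (fst g)"
  shows "finite (local_pairs g r K v)"
proof -
  have "finite (target g r v)" using assms by (simp add: target_def)
  then have "finite ((\<lambda>(x, d). (x, x + d)) ` (target g r v \<times> {0..int K}) \<union> (\<lambda>(x, d). (x - d, x)) ` (target g r v \<times> {0..int K}))"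
    by auto
  moreover have "local_pairs g r K v \<subseteq> (\<lambda>(x, d). (x, x + d)) ` (target g r v \<times> {0..int K}) \<union> (\<lambda>(x, d). (x - d, x)) ` (target g r v \<times> {0..int K})"
  proof
    fix z assume "z \<in> local_pairs g r K v"
    then obtain x y where z: "z = (x, y)" "x + 1 < y" "y - x \<le> int K" "x \<in> target g r v \<or> y \<in> target g r v"
      by (auto simp: local_pairs_def LRZ_def)
    from z(4) show "z \<in> (\<lambda>(x, d). (x, x + d)) ` (target g r v \<times> {0..int K}) \<union> (\<lambda>(x, d). (x - d, x)) ` (target g r v \<times> {0..int K})"
    proof
      assume "x \<in> target g r v"
      then show ?thesis using z by (intro UnI1 image_eqI[of _ _ "(x, y - x)"]) auto
    next
      assume "y \<in> target g r v"
      then show ?thesis using z by (intro UnI2 image_eqI[of _ _ "(y, y - x)"]) auto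
    qed
  qed
  ultimately show ?thesis by (rule finite_subset[rotated])
qed

lemma local_pairs_mono: "K \<le> K' \<Longrightarrow> local_pairs g r K v \<subseteq> local_pairs g r K' v"
  by (auto simp: local_pairs_def)

lemma line_edges_inside_target:
  assumes K: "\<And>x y. x \<in> target g r v \<Longrightarrow> y \<in> target g r v \<Longrightarrow> y - x \<le> int K" and T: "T \<subseteq> LRZ"
  shows "{e\<in>line_edges T. e \<subseteq> target g r v} \<subseteq> line_edges (T \<inter> local_pairs g r K v)"
proof
  fix e assume "e \<in> {e\<in>line_edges T. e \<subseteq> target g r v}"
  then have W: "e \<subseteq> target g r v"
    and "(\<exists>x. e = {x, x + 1}) \<or> (\<exists>x y. e = {x, y} \<and> (x, y) \<in> T)"
    by (auto simp: line_edges_def)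
  then consider x where "e = {x, x + 1}" | x y where "e = {x, y}" "(x, y) \<in> T" by blast
  then show "e \<in> line_edges (T \<inter> local_pairs g r K v)"
  proof cases
    case (2 x y)
    then have "(x, y) \<in> T \<inter> local_pairs g r K v"
      using W T K[of x y] by (auto simp: local_pairs_def)
    then show ?thesis using 2(1) by (auto simp: line_edges_def)
  qed (auto simp: line_edges_def)
qed

text \<open>Once \<open>K\<close> exceeds the diameter of the target, all edges inside it are
  present, and raising \<open>K\<close> only adds edges that leave it; these can spoil a match but
  not create one.\<close>

lemma ball_match_local_antimono:
  assumes K: "\<And>x y. x \<in> target g r v \<Longrightarrow> y \<in> target g r v \<Longrightarrow> y - x \<le> int K" and T: "T \<subseteq> LRZ" and "K \<le> K'"
    and bm: "ball_match g r \<rho> UNIV (line_edges (T \<inter> local_pairs g r K' v)) v"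
  shows "ball_match g r \<rho> UNIV (line_edges (T \<inter> local_pairs g r K v)) v"
proof (rule ball_match_drop[OF bm])
  show "line_edges (T \<inter> local_pairs g r K v) \<subseteq> line_edges (T \<inter> local_pairs g r K' v)"
    using local_pairs_mono[OF \<open>K \<le> K'\<close>] by (intro line_edges_mono) blast
  show "{e \<in> line_edges (T \<inter> local_pairs g r K' v). e \<subseteq> target g r v} \<subseteq> line_edges (T \<inter> local_pairs g r K v)"
    using line_edges_inside_target[OF K T] line_edges_mono[of "T \<inter> local_pairs g r K' v" T] by blast
qed auto

text \<open>Any path uses finitely many edges and is therefore visible at some truncation level. The
  untruncated event is thus a decreasing intersection of events on finite windows.\<close>

lemma ball_match_iff_all_local:
  assumes K: "\<And>x y. x \<in> target g r v \<Longrightarrow> y \<in> target g r v \<Longrightarrow> y - x \<le> int K" and T: "T \<subseteq> LRZ"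
  shows "ball_match g r \<rho> UNIV (line_edges T) v
     \<longleftrightarrow> (\<forall>K'\<ge>K. ball_match g r \<rho> UNIV (line_edges (T \<inter> local_pairs g r K' v)) v)"
proof safe
  fix K' assume bm: "ball_match g r \<rho> UNIV (line_edges T) v" and K': "K \<le> K'"
  show "ball_match g r \<rho> UNIV (line_edges (T \<inter> local_pairs g r K' v)) v"
  proof (rule ball_match_drop[OF bm])
    show "line_edges (T \<inter> local_pairs g r K' v) \<subseteq> line_edges T" by (rule line_edges_mono) blast
    show "{e \<in> line_edges T. e \<subseteq> target g r v} \<subseteq> line_edges (T \<inter> local_pairs g r K' v)"
      using K K' T by (intro line_edges_inside_target) force+
  qed auto
next
  assume all: "\<forall>K'\<ge>K. ball_match g r \<rho> UNIV (line_edges (T \<inter> local_pairs g r K' v)) v"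
  let ?W = "target g r v" and ?E = "\<lambda>K. line_edges (T \<inter> local_pairs g r K v)"
  have mono: "?E K1 \<subseteq> ?E K2" if "K1 \<le> K2" for K1 K2
    using local_pairs_mono[OF that] by (intro line_edges_mono) blast
  have path: "\<exists>K'\<ge>K. (v, x) \<in> adj (?E K') ^^ m" if "(v, x) \<in> adj (line_edges T) ^^ m" "m \<le> \<rho>" for m x
    using that
  proof (induction m arbitrary: x)
    case 0
    then show ?case by auto
  next
    case (Suc m)
    then obtain u where u: "(v, u) \<in> adj (line_edges T) ^^ m" "(u, x) \<in> adj (line_edges T)" by auto
    with Suc obtain K1 where K1: "K1 \<ge> K" "(v, u) \<in> adj (?E K1) ^^ m" by force
    have uW: "u \<in> ?W"
      using ball_match_path_target[OF all[rule_format, OF K1(1)] K1(2)] Suc.prems by auto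
    have "\<exists>K2. {u, x} \<in> ?E K2"
    proof -
      from u(2) consider y where "{u, x} = {y, y + 1}" | y z where "{u, x} = {y, z}" "(y, z) \<in> T"
        by (auto simp: adj_def line_edges_def)
      then show ?thesis
      proof cases
        case (2 y z)
        \<comment> \<open>One end of the edge is \<open>u\<close>, which lies in the target, so its
          own length serves as truncation level.\<close>
        then have "(y, z) \<in> T \<inter> local_pairs g r (nat (z - y)) v"
          using T uW by (auto simp: local_pairs_def LRZ_def doubleton_eq_iff)
        then show ?thesis using 2(1) by (auto simp: line_edges_def)
      qed (auto simp: line_edges_def)
    qed
    then obtain K2 where K2: "(u, x) \<in> adj (?E K2)" by (auto simp: adj_def)
    have "(v, u) \<in> adj (?E (max K1 K2)) ^^ m"
      using relpow_mono[OF adj_mono[OF mono] K1(2)] by simp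
    moreover have "(u, x) \<in> adj (?E (max K1 K2))"
      using adj_mono[OF mono, of K2 "max K1 K2"] K2 by auto
    ultimately show ?case using K1(1) by (intro exI[of _ "max K1 K2"]) auto
  qed
  have bmK: "ball_match g r \<rho> UNIV (?E K) v" using all by simp
  have sub: "?E K \<subseteq> line_edges T" by (rule line_edges_mono) blast
  have "bverts UNIV (line_edges T) \<rho> v = ?W"
  proof
    show "bverts UNIV (line_edges T) \<rho> v \<subseteq> ?W"
    proof
      fix x assume "x \<in> bverts UNIV (line_edges T) \<rho> v"
      then obtain m where m: "m \<le> \<rho>" "(v, x) \<in> adj (line_edges T) ^^ m" by (auto simp: bverts_def)
      then obtain K' where "K' \<ge> K" "(v, x) \<in> adj (?E K') ^^ m" using path by blast
      then show "x \<in> ?W" using ball_match_path_target[of g r \<rho> UNIV "?E K'" v x m] all m(1) by auto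
    qed
    have "?W = bverts UNIV (?E K) \<rho> v" using bmK by (simp add: ball_match_def)
    also have "\<dots> \<subseteq> bverts UNIV (line_edges T) \<rho> v"
      using relpow_mono[OF adj_mono[OF sub]] by (fastforce simp: bverts_def)
    finally show "?W \<subseteq> bverts UNIV (line_edges T) \<rho> v" .
  qed
  moreover have "{e\<in>line_edges T. e \<subseteq> ?W} = {e\<in>?E K. e \<subseteq> ?W}"
    using line_edges_inside_target[OF K T] sub by blast
  ultimately show "ball_match g r \<rho> UNIV (line_edges T) v"
    using bmK by (simp add: ball_match_def)
qed

lemma inf_graph_line_edges: "inf_graph \<omega> = (UNIV, line_edges {e\<in>LRZ. \<omega> e})"
  by (auto simp: inf_graph_def line_edges_def)

lemma fin_graph_edges_subset: "S \<subseteq> LR N \<Longrightarrow> e \<in> snd (fin_graph N S) \<Longrightarrow> e \<subseteq> {1..int N}"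
  by (auto simp: fin_graph_def LR_def)

lemma ball_match_fin_insert:
  assumes S: "S \<subseteq> LR N" and xy: "(x, y) \<in> LR N" and v: "v \<in> {1..int N}"
    and nW: "x \<notin> target g r v" "y \<notin> target g r v"
  shows "ball_match g r \<rho> {1..int N} (snd (fin_graph N (insert (x, y) S))) v
     \<longleftrightarrow> ball_match g r \<rho> {1..int N} (snd (fin_graph N S)) v"
proof -
  have eq: "e \<in> snd (fin_graph N (insert (x, y) S)) \<longleftrightarrow> e \<in> snd (fin_graph N S)" if "e \<inter> target g r v \<noteq> {}" for e
    using that nW by (auto simp: fin_graph_def)
  have ne: "{} \<notin> snd (fin_graph N S)" for S by (auto simp: fin_graph_def)
  have W: "target g r v \<subseteq> {1..int N}" if "ball_match g r \<rho> {1..int N} E v" for E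
    using that by (auto simp: ball_match_def bverts_def)
  show ?thesis
  proof
    assume bm: "ball_match g r \<rho> {1..int N} (snd (fin_graph N (insert (x, y) S))) v"
    show "ball_match g r \<rho> {1..int N} (snd (fin_graph N S)) v"
      using fin_graph_edges_subset[of "insert (x, y) S" N] S xy eq
      by (intro ball_match_cong_imp[OF bm v _ W[OF bm] _ ne ne]) auto
  next
    assume bm: "ball_match g r \<rho> {1..int N} (snd (fin_graph N S)) v"
    show "ball_match g r \<rho> {1..int N} (snd (fin_graph N (insert (x, y) S))) v"
      using fin_graph_edges_subset[OF S] eq
      by (intro ball_match_cong_imp[OF bm v _ W[OF bm] _ ne ne]) auto
  qed
qed

text \<open>The margin of one vertex at either end guarantees that both unit edges at each target
  vertex exist in the finite graph; otherwise the boundary would be visible.\<close>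

lemma ball_match_fin_iff_line:
  assumes S: "S \<subseteq> LR N" and W: "target g r v \<subseteq> {2..int N - 1}" and v: "v \<in> {1..int N}"
  shows "ball_match g r \<rho> {1..int N} (snd (fin_graph N {e\<in>S. snd e - fst e \<le> int K})) v
     \<longleftrightarrow> ball_match g r \<rho> UNIV (line_edges (S \<inter> local_pairs g r K v)) v"
proof -
  let ?S = "{e\<in>S. snd e - fst e \<le> int K}"
  have eq: "e \<in> snd (fin_graph N ?S) \<longleftrightarrow> e \<in> line_edges (S \<inter> local_pairs g r K v)"
    if e: "e \<inter> target g r v \<noteq> {}" for e
  proof
    assume "e \<in> snd (fin_graph N ?S)"
    then consider x where "e = {x, x + 1}" | x y where "e = {x, y}" "(x, y) \<in> S" "y - x \<le> int K"
      by (auto simp: fin_graph_def)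
    then show "e \<in> line_edges (S \<inter> local_pairs g r K v)"
    proof cases
      case (2 x y)
      then have "(x, y) \<in> local_pairs g r K v" using S e by (auto simp: local_pairs_def LRZ_def LR_def)
      with 2 show ?thesis by (auto simp: line_edges_def)
    qed (auto simp: line_edges_def)
  next
    assume "e \<in> line_edges (S \<inter> local_pairs g r K v)"
    then consider x where "e = {x, x + 1}" | x y where "e = {x, y}" "(x, y) \<in> S" "y - x \<le> int K"
      by (auto simp: line_edges_def local_pairs_def)
    then show "e \<in> snd (fin_graph N ?S)"
    proof cases
      case (1 x)
      then have "x \<in> {2..int N - 1} \<or> x + 1 \<in> {2..int N - 1}" using e W by auto
      then show ?thesis using 1 by (auto simp: fin_graph_def)
    next
      case (2 x y)
      then show ?thesis by (auto simp: fin_graph_def)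
    qed
  qed
  have ne: "{} \<notin> snd (fin_graph N S)" "{} \<notin> line_edges S" for S by (auto simp: fin_graph_def line_edges_def)
  have W': "target g r v \<subseteq> {1..int N}" using W by auto
  show ?thesis
  proof
    assume bm: "ball_match g r \<rho> {1..int N} (snd (fin_graph N ?S)) v"
    show "ball_match g r \<rho> UNIV (line_edges (S \<inter> local_pairs g r K v)) v"
      using fin_graph_edges_subset[of ?S N] S eq
      by (intro ball_match_cong_imp[OF bm v _ _ _ ne]) auto
  next
    assume bm: "ball_match g r \<rho> UNIV (line_edges (S \<inter> local_pairs g r K v)) v"
    show "ball_match g r \<rho> {1..int N} (snd (fin_graph N ?S)) v"
      using eq by (intro ball_match_cong_imp[OF bm _ _ W' _ ne(2,1)]) auto
  qed
qed

section \<open>Translation invariance\<close>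

definition shift_pair :: "int \<Rightarrow> int \<times> int \<Rightarrow> int \<times> int" where
  "shift_pair c e = (fst e + c, snd e + c)"

lemma target_shift: "target g r (v + c) = (\<lambda>x. x + c) ` target g r v"
  by (auto simp: target_def image_image)

lemma image_plus_inject: "(\<lambda>x. x + c) ` A = (\<lambda>x. x + c) ` B \<longleftrightarrow> A = (B :: int set)"
  by (rule inj_image_eq_iff) (auto simp: inj_def)

lemma line_edges_shift: "line_edges (shift_pair c ` T) = (\<lambda>e. (\<lambda>x. x + c) ` e) ` line_edges T"
proof (intro equalityI subsetI)
  fix e assume "e \<in> line_edges (shift_pair c ` T)"
  then consider x where "e = {x, x + 1}" | x y where "e = {x + c, y + c}" "(x, y) \<in> T"
    by (auto simp: line_edges_def shift_pair_def)
  then show "e \<in> (\<lambda>e. (\<lambda>x. x + c) ` e) ` line_edges T"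
  proof cases
    case (1 x)
    then show ?thesis by (intro image_eqI[of _ _ "{x - c, x - c + 1}"]) (auto simp: line_edges_def)
  next
    case (2 x y)
    then show ?thesis by (intro image_eqI[of _ _ "{x, y}"]) (auto simp: line_edges_def)
  qed
next
  fix e assume "e \<in> (\<lambda>e. (\<lambda>x. x + c) ` e) ` line_edges T"
  then obtain e' where e': "e' \<in> line_edges T" "e = (\<lambda>x. x + c) ` e'" by auto
  from e'(1) consider x where "e' = {x, x + 1}" | x y where "e' = {x, y}" "(x, y) \<in> T"
    by (auto simp: line_edges_def)
  then show "e \<in> line_edges (shift_pair c ` T)"
  proof cases
    case (1 x)
    then have "e = {x + c, (x + c) + 1}" using e'(2) by auto
    then show ?thesis by (auto simp: line_edges_def)
  next
    case (2 x y)
    then show ?thesis using e'(2) by (force simp: line_edges_def shift_pair_def)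
  qed
qed

lemma ball_match_shift:
  "ball_match g r \<rho> UNIV (line_edges (shift_pair c ` T)) (v + c) \<longleftrightarrow> ball_match g r \<rho> UNIV (line_edges T) v"
proof -
  let ?E = "line_edges T" and ?E' = "line_edges (shift_pair c ` T)" and ?\<tau> = "\<lambda>x::int. x + c"
  have adj: "(x + c, y + c) \<in> adj ?E' \<longleftrightarrow> (x, y) \<in> adj ?E" for x y
  proof -
    have "{x + c, y + c} = ?\<tau> ` {x, y}" by auto
    then show ?thesis unfolding adj_def line_edges_shift
      by (auto simp: image_iff image_plus_inject simp del: image_insert)
  qed
  have path: "(x + c, y + c) \<in> adj ?E' ^^ m \<longleftrightarrow> (x, y) \<in> adj ?E ^^ m" for x y m
  proof (induction m arbitrary: y)
    case (Suc m)
    have "(x + c, y + c) \<in> adj ?E' ^^ Suc m \<longleftrightarrow> (\<exists>z. (x + c, z) \<in> adj ?E' ^^ m \<and> (z, y + c) \<in> adj ?E')"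
      by (auto simp: relcomp_unfold)
    also have "\<dots> \<longleftrightarrow> (\<exists>z. (x + c, z + c) \<in> adj ?E' ^^ m \<and> (z + c, y + c) \<in> adj ?E')"
      by (metis diff_add_cancel)
    finally show ?case unfolding adj Suc by (auto simp: relcomp_unfold)
  qed auto
  have "bverts UNIV ?E' \<rho> (v + c) = ?\<tau> ` bverts UNIV ?E \<rho> v"
  proof (intro equalityI subsetI)
    fix x assume "x \<in> bverts UNIV ?E' \<rho> (v + c)"
    then have "x - c \<in> bverts UNIV ?E \<rho> v"
      using path[of v "x - c"] by (auto simp: bverts_def)
    then show "x \<in> ?\<tau> ` bverts UNIV ?E \<rho> v" by (intro image_eqI[of _ _ "x - c"]) auto
  qed (auto simp: bverts_def path)
  then have 1: "bverts UNIV ?E' \<rho> (v + c) = target g r (v + c) \<longleftrightarrow> bverts UNIV ?E \<rho> v = target g r v"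
    by (simp add: target_shift image_plus_inject)
  have inj: "inj (\<lambda>e. ?\<tau> ` e)" by (auto simp: inj_def image_plus_inject)
  have sub: "?\<tau> ` e \<subseteq> ?\<tau> ` W \<longleftrightarrow> e \<subseteq> W" for e W by (rule inj_image_subset_iff) (auto simp: inj_def)
  have 2: "{e\<in>?E'. e \<subseteq> target g r (v + c)} = (\<lambda>e. ?\<tau> ` e) ` {e\<in>?E. e \<subseteq> target g r v}"
    unfolding line_edges_shift target_shift using sub by auto
  have 3: "(\<lambda>e. (\<lambda>x. x - r + (v + c)) ` e) ` snd g = (\<lambda>e. ?\<tau> ` e) ` (\<lambda>e. (\<lambda>x. x - r + v) ` e) ` snd g"
    by (simp add: image_image add.assoc)
  show ?thesis unfolding ball_match_def 1 2 3 inj_image_eq_iff[OF inj] ..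
qed

lemma local_pairs_shift: "local_pairs g r K (v + c) = shift_pair c ` local_pairs g r K v"
proof (intro equalityI subsetI)
  fix e assume "e \<in> local_pairs g r K (v + c)"
  then show "e \<in> shift_pair c ` local_pairs g r K v"
    by (intro image_eqI[of _ _ "shift_pair (- c) e"])
      (auto simp: local_pairs_def shift_pair_def LRZ_def target_shift)
qed (auto simp: local_pairs_def shift_pair_def LRZ_def target_shift)

section \<open>Counting matching balls\<close>

definition matches :: "graph \<Rightarrow> int \<Rightarrow> nat \<Rightarrow> nat \<Rightarrow> (int \<times> int) set \<Rightarrow> nat" where
  "matches g r \<rho> N S = card {v\<in>{1..int N}. ball_match g r \<rho> {1..int N} (snd (fin_graph N S)) v}"

lemma matches_le: "matches g r \<rho> N S \<le> N"
proof -
  have "matches g r \<rho> N S \<le> card {1..int N}" unfolding matches_def by (intro card_mono) auto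
  then show ?thesis by simp
qed

text \<open>A switched edge is seen from \<open>v\<close> only if one of its ends lies in the target
  at \<open>v\<close>, which for each end leaves at most \<open>card (fst g)\<close> choices of
  \<open>v\<close>.\<close>

lemma matches_insert:
  assumes g: "finite (fst g)" and S: "S \<subseteq> LR N" and e: "e \<in> LR N"
  shows "\<bar>real (matches g r \<rho> N (insert e S)) - real (matches g r \<rho> N S)\<bar> \<le> 2 * real (card (fst g))"
proof -
  let ?A = "\<lambda>S. {v\<in>{1..int N}. ball_match g r \<rho> {1..int N} (snd (fin_graph N S)) v}"
  let ?D = "(\<lambda>w. fst e - w + r) ` fst g \<union> (\<lambda>w. snd e - w + r) ` fst g"
  have D: "card ?D \<le> 2 * card (fst g)"
    using card_Un_le[of "(\<lambda>w. fst e - w + r) ` fst g" "(\<lambda>w. snd e - w + r) ` fst g"]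
      card_image_le[OF g, of "\<lambda>w. fst e - w + r"] card_image_le[OF g, of "\<lambda>w. snd e - w + r"] by linarith
  have iff: "v \<in> ?A (insert e S) \<longleftrightarrow> v \<in> ?A S" if "v \<notin> ?D" for v
  proof -
    have "fst e \<notin> target g r v" "snd e \<notin> target g r v"
      using that by (force simp: target_def)+
    then show ?thesis using ball_match_fin_insert[OF S, of "fst e" "snd e" v g r \<rho>] e by auto
  qed
  have fD: "finite ?D" using g by simp
  have fA: "finite (?A S)" for S by (rule finite_subset[of _ "{1..int N}"]) auto
  have "card (?A (insert e S)) \<le> card (?A S \<union> ?D)"
    by (rule card_mono[OF finite_UnI[OF fA fD]]) (use iff in blast)
  moreover have "card (?A S) \<le> card (?A (insert e S) \<union> ?D)"
    by (rule card_mono[OF finite_UnI[OF fA fD]]) (use iff in blast)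
  moreover have "card (?A S \<union> ?D) \<le> card (?A S) + card ?D" "card (?A (insert e S) \<union> ?D) \<le> card (?A (insert e S)) + card ?D"
    by (rule card_Un_le)+
  ultimately show ?thesis using D unfolding matches_def by linarith
qed

lemma matches_lipschitz:
  assumes g: "finite (fst g)" and S: "S \<subseteq> LR N" and sub: "S' \<subseteq> S"
  shows "\<bar>real (matches g r \<rho> N S) - real (matches g r \<rho> N S')\<bar> \<le> 2 * real (card (fst g)) * real (card (S - S'))"
proof -
  have "\<bar>real (matches g r \<rho> N (S' \<union> D)) - real (matches g r \<rho> N S')\<bar> \<le> 2 * real (card (fst g)) * real (card D)"
    if "finite D" "D \<subseteq> S" for D
    using that
  proof (induction D)
    case (insert e D)
    have "\<bar>real (matches g r \<rho> N (insert e (S' \<union> D))) - real (matches g r \<rho> N (S' \<union> D))\<bar> \<le> 2 * real (card (fst g))"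
      using insert S sub by (intro matches_insert[OF g]) auto
    moreover have "2 * real (card (fst g)) * real (card (insert e D)) = 2 * real (card (fst g)) * real (card D) + 2 * real (card (fst g))"
      using insert by (simp add: algebra_simps)
    ultimately show ?case using insert by auto
  qed auto
  moreover have "S' \<union> (S - S') = S" using sub by auto
  moreover have "finite (S - S')" using finite_subset[OF S finite_LR] by simp
  ultimately show ?thesis by (metis Diff_subset)
qed

text \<open>Each length occurs for at most N pairs. This is how sums over quadratically many pairs
  become N times a convergent series.\<close>

lemma sum_LR_le:
  fixes u :: "nat \<Rightarrow> real"
  assumes u: "\<And>l. 0 \<le> u l"
  shows "(\<Sum>e\<in>LR N. u (nat (snd e - fst e))) \<le> real N * (\<Sum>l\<le>N. u l)"
proof -
  let ?\<phi> = "\<lambda>e. (fst e, nat (snd e - fst e))"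
  have inj: "inj_on ?\<phi> (LR N)" by (auto simp: inj_on_def LR_def)
  have "(\<Sum>e\<in>LR N. u (nat (snd e - fst e))) = (\<Sum>z\<in>?\<phi> ` LR N. u (snd z))"
    by (simp add: sum.reindex[OF inj])
  also have "\<dots> \<le> (\<Sum>z\<in>{1..int N} \<times> {..N}. u (snd z))"
    using u by (intro sum_mono2) (auto simp: LR_def)
  also have "\<dots> = (\<Sum>x\<in>{1..int N}. \<Sum>l\<le>N. u l)"
    by (subst sum.cartesian_product) (simp add: case_prod_beta)
  finally show ?thesis by simp
qed

definition len_prob :: "real \<Rightarrow> nat \<Rightarrow> real" where
  "len_prob \<gamma> l = exp (- (real l powr \<gamma>))"

lemma edge_prob_eq_len_prob: "e \<in> LR N \<Longrightarrow> edge_prob \<gamma> e = len_prob \<gamma> (nat (snd e - fst e))"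
  by (auto simp: edge_prob_def conn_prob_def len_prob_def LR_def)

lemma summable_len_prob:
  assumes "\<gamma> > 0"
  shows "summable (len_prob \<gamma>)"
proof (rule summable_comparison_test_bigo)
  show "summable (\<lambda>l. norm (inverse (real l ^ 2)))" using inverse_power_summable[of 2] by simp
  show "len_prob \<gamma> \<in> O(\<lambda>l. inverse (real l ^ 2))"
    unfolding len_prob_def using assms by real_asymp
qed

lemma sum_tail_le:
  fixes u :: "nat \<Rightarrow> real"
  assumes "summable u" "\<And>l. 0 \<le> u l" "\<eta> > 0"
  shows "\<exists>K. \<forall>L\<ge>K. \<forall>N. (\<Sum>l\<le>N. if l > L then u l else 0) \<le> \<eta>"
proof -
  from summable_partial_sum_bound[OF assms(1,3)] obtain K
    where K: "\<And>m n. K \<le> m \<Longrightarrow> norm (\<Sum>k=m..n. u k) < \<eta>" by blast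
  have "(\<Sum>l\<le>N. if l > L then u l else 0) \<le> \<eta>" if "L \<ge> K" for L N
  proof -
    have "(\<Sum>l\<le>N. if l > L then u l else 0) = (\<Sum>l\<in>{l\<in>{..N}. l > L}. u l)"
      by (simp only: sum.inter_filter finite_atMost)
    also have "{l\<in>{..N}. l > L} = {Suc L..N}" by auto
    also have "(\<Sum>l\<in>{Suc L..N}. u l) \<le> \<eta>" using K[of "Suc L" N] that by auto
    finally show ?thesis .
  qed
  then show ?thesis by blast
qed

text \<open>The probability of a match at \<open>v\<close> in the infinite graph truncated at length
  \<open>K\<close>, written as a sum over the finite window.\<close>

definition local_prob :: "real \<Rightarrow> graph \<Rightarrow> int \<Rightarrow> nat \<Rightarrow> nat \<Rightarrow> int \<Rightarrow> real" where
  "local_prob \<gamma> g r \<rho> K v = (\<Sum>T\<in>Pow (local_pairs g r K v). bern (edge_prob \<gamma>) (local_pairs g r K v) T *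
      of_bool (ball_match g r \<rho> UNIV (line_edges T) v))"

lemma local_prob_shift: "local_prob \<gamma> g r \<rho> K (v + c) = local_prob \<gamma> g r \<rho> K v"
proof -
  let ?F = "local_pairs g r K v"
  have inj: "inj (shift_pair c)" by (auto simp: inj_def shift_pair_def prod_eq_iff)
  have inj2: "inj_on ((`) (shift_pair c)) (Pow ?F)"
    using inj by (simp add: inj_on_def inj_image_eq_iff)
  have q: "edge_prob \<gamma> (shift_pair c e) = edge_prob \<gamma> e" for e
    by (simp add: edge_prob_def shift_pair_def conn_prob_def)
  have "bern (edge_prob \<gamma>) (shift_pair c ` ?F) (shift_pair c ` T) = bern (edge_prob \<gamma>) ?F T" for T
    unfolding bern_def using inj
    by (subst prod.reindex) (auto intro!: inj_on_subset[OF inj] simp: q inj_image_mem_iff cong: if_cong)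
  then show ?thesis
    unfolding local_prob_def local_pairs_shift image_Pow_surj[OF refl, symmetric]
    by (simp add: sum.reindex[OF inj2] ball_match_shift)
qed

text \<open>The margin \<open>K\<close> puts the whole window of local pairs inside
  \<open>LR N\<close>, and all other coordinates integrate out, so the value no longer depends on
  N.\<close>

lemma sum_bern_bulk_vertex:
  assumes W: "target g r v \<subseteq> {2 + int K..int N - 1 - int K}" and v: "v \<in> {1..int N}"
  shows "(\<Sum>S\<in>Pow (LR N). bern (edge_prob \<gamma>) (LR N) S *
      of_bool (ball_match g r \<rho> {1..int N} (snd (fin_graph N {e\<in>S. snd e - fst e \<le> int K})) v))
    = local_prob \<gamma> g r \<rho> K v"
proof -
  let ?F = "local_pairs g r K v"
  have F: "?F \<subseteq> LR N" using W by (force simp: local_pairs_def LR_def LRZ_def)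
  have W': "target g r v \<subseteq> {2..int N - 1}" using W by force
  have "(\<Sum>S\<in>Pow (LR N). bern (edge_prob \<gamma>) (LR N) S *
      of_bool (ball_match g r \<rho> {1..int N} (snd (fin_graph N {e\<in>S. snd e - fst e \<le> int K})) v))
    = (\<Sum>S\<in>Pow (LR N). bern (edge_prob \<gamma>) (LR N) S * of_bool (ball_match g r \<rho> UNIV (line_edges (S \<inter> ?F)) v))"
    using ball_match_fin_iff_line[OF _ W' v] by (intro sum.cong) auto
  also have "\<dots> = local_prob \<gamma> g r \<rho> K v"
    unfolding local_prob_def by (rule sum_bern_marginal[OF finite_LR F])
  finally show ?thesis .
qed

lemma sum_bern_of_bool_bounds:
  assumes "finite F" "\<And>e. e \<in> F \<Longrightarrow> 0 \<le> q e \<and> q e \<le> 1"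
  shows "0 \<le> (\<Sum>S\<in>Pow F. bern q F S * of_bool (P S))" "(\<Sum>S\<in>Pow F. bern q F S * of_bool (P S)) \<le> 1"
proof -
  show "0 \<le> (\<Sum>S\<in>Pow F. bern q F S * of_bool (P S))"
    using bern_nonneg[of F q] assms by (intro sum_nonneg) auto
  have "(\<Sum>S\<in>Pow F. bern q F S * of_bool (P S)) \<le> (\<Sum>S\<in>Pow F. bern q F S)"
    using bern_nonneg[of F q] assms by (intro sum_mono) auto
  then show "(\<Sum>S\<in>Pow F. bern q F S * of_bool (P S)) \<le> 1" using sum_bern_eq_1[OF assms(1)] by metis
qed

text \<open>By translation invariance all vertices away from the two ends contribute equally; the
  boundedly many others contribute an error at most 1 each, which disappears after division by
  N.\<close>

lemma expected_short_matches:
  assumes g: "finite (fst g)"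
  shows "\<exists>C. \<forall>N. \<bar>(\<Sum>S\<in>Pow (LR N). bern (edge_prob \<gamma>) (LR N) S * real (matches g r \<rho> N {e\<in>S. snd e - fst e \<le> int K}))
     - real N * local_prob \<gamma> g r \<rho> K 0\<bar> \<le> C"
proof -
  \<comment> \<open>A crude bound on how far \<open>g\<close> extends from its root. Vertices within
    about K + D of an end form the boundary, and \<open>C\<close> bounds their number.\<close>
  define D where "D = (\<Sum>x\<in>fst g. \<bar>x - r\<bar>)"
  have D: "\<bar>x - r\<bar> \<le> D" if "x \<in> fst g" for x
    unfolding D_def by (rule member_le_sum[OF that]) (use g in auto)
  have D0: "0 \<le> D" unfolding D_def by (intro sum_nonneg) auto
  define C where "C = real_of_int (2 * (int K + D + 2))"
  have "\<bar>(\<Sum>S\<in>Pow (LR N). bern (edge_prob \<gamma>) (LR N) S * real (matches g r \<rho> N {e\<in>S. snd e - fst e \<le> int K}))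
     - real N * local_prob \<gamma> g r \<rho> K 0\<bar> \<le> C" for N
  proof -
    let ?b = "\<lambda>S v. of_bool (ball_match g r \<rho> {1..int N} (snd (fin_graph N {e\<in>S. snd e - fst e \<le> int K})) v) :: real"
    let ?P = "\<lambda>v. \<Sum>S\<in>Pow (LR N). bern (edge_prob \<gamma>) (LR N) S * ?b S v"
    let ?\<pi> = "local_prob \<gamma> g r \<rho> K 0"
    let ?bulk = "{2 + int K + D..int N - 1 - int K - D}"
    have \<pi>: "0 \<le> ?\<pi>" "?\<pi> \<le> 1"
      unfolding local_prob_def using finite_local_pairs[OF g] edge_prob_bounds
      by (intro sum_bern_of_bool_bounds; auto)+
    have "(\<Sum>S\<in>Pow (LR N). bern (edge_prob \<gamma>) (LR N) S * real (matches g r \<rho> N {e\<in>S. snd e - fst e \<le> int K}))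
        = (\<Sum>S\<in>Pow (LR N). \<Sum>v\<in>{1..int N}. bern (edge_prob \<gamma>) (LR N) S * ?b S v)"
      by (intro sum.cong refl)
        (simp add: matches_def sum_distrib_left[symmetric] of_bool_def sum.inter_filter[symmetric])
    also have "\<dots> = (\<Sum>v\<in>{1..int N}. ?P v)" by (rule sum.swap)
    finally have "(\<Sum>S\<in>Pow (LR N). bern (edge_prob \<gamma>) (LR N) S * real (matches g r \<rho> N {e\<in>S. snd e - fst e \<le> int K}))
        - real N * ?\<pi> = (\<Sum>v\<in>{1..int N}. ?P v - ?\<pi>)"
      by (simp add: sum_subtractf)
    also have "\<bar>\<dots>\<bar> \<le> (\<Sum>v\<in>{1..int N}. \<bar>?P v - ?\<pi>\<bar>)" by (rule sum_abs)
    also have "\<dots> \<le> (\<Sum>v\<in>{1..int N}. if v \<in> ?bulk then 0 else 1)"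
    proof (rule sum_mono)
      fix v assume v: "v \<in> {1..int N}"
      show "\<bar>?P v - ?\<pi>\<bar> \<le> (if v \<in> ?bulk then 0 else 1)"
      proof (cases "v \<in> ?bulk")
        case True
        have "target g r v \<subseteq> {2 + int K..int N - 1 - int K}"
          using D True by (fastforce simp: target_def abs_le_iff)
        from sum_bern_bulk_vertex[OF this v] have "?P v = local_prob \<gamma> g r \<rho> K v" .
        then show ?thesis using local_prob_shift[of \<gamma> g r \<rho> K 0 v] by simp
      next
        case False
        have "0 \<le> ?P v" "?P v \<le> 1"
          using finite_LR edge_prob_bounds by (intro sum_bern_of_bool_bounds; auto)+
        then show ?thesis using \<pi> False by auto
      qed
    qed
    also have "\<dots> = (\<Sum>v\<in>{1..int N}. if v \<notin> ?bulk then 1 else 0)"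
      by (intro sum.cong) auto
    also have "\<dots> = real (card {v\<in>{1..int N}. v \<notin> ?bulk})"
      by (simp only: sum.inter_filter[symmetric] finite_atLeastAtMost_int) simp
    also have "\<dots> \<le> real (card ({1..<2 + int K + D} \<union> {int N - 1 - int K - D<..int N}))"
      by (intro of_nat_mono card_mono) auto
    also have "\<dots> \<le> real (card {1..<2 + int K + D} + card {int N - 1 - int K - D<..int N})"
      by (intro of_nat_mono card_Un_le)
    also have "\<dots> \<le> C" using D0 by (simp add: C_def)
    finally show ?thesis .
  qed
  then show ?thesis by blast
qed

section \<open>The infinite product measure\<close>

definition edge_measure :: "real \<Rightarrow> int \<times> int \<Rightarrow> bool measure" where
  "edge_measure \<gamma> e = measure_pmf (bernoulli_pmf (edge_prob \<gamma> e))"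

lemma edge_space_eq: "edge_space \<gamma> = PiM LRZ (edge_measure \<gamma>)"
  unfolding edge_space_def edge_measure_def[abs_def] edge_prob_def
  by (intro arg_cong[where f = "PiM LRZ"]) auto

interpretation edges: product_prob_space "edge_measure \<gamma>" LRZ for \<gamma>
  unfolding product_prob_space_def product_prob_space_axioms_def product_sigma_finite_def edge_measure_def
  using prob_space_measure_pmf prob_space_imp_sigma_finite by blast

lemma edge_space_cylinder:
  assumes F: "finite F" "F \<subseteq> LRZ" "T \<subseteq> F"
  shows "{\<omega>\<in>space (edge_space \<gamma>). {e\<in>LRZ. \<omega> e} \<inter> F = T} \<in> sets (edge_space \<gamma>)" (is "?C \<in> _")
    and "measure (edge_space \<gamma>) {\<omega>\<in>space (edge_space \<gamma>). {e\<in>LRZ. \<omega> e} \<inter> F = T} = bern (edge_prob \<gamma>) F T"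
proof -
  have C: "?C = {\<omega>\<in>space (edge_space \<gamma>). \<forall>e\<in>F. \<omega> e \<in> {e \<in> T}}"
    using F by auto
  then have C': "?C = prod_emb LRZ (edge_measure \<gamma>) F (PiE F (\<lambda>e. {e \<in> T}))"
    unfolding edge_space_eq using F(2) by (auto simp: prod_emb_def space_PiM Pi_iff)
  show "?C \<in> sets (edge_space \<gamma>)"
    unfolding C' unfolding edge_space_eq using F by (intro sets_PiM_I) (auto simp: edge_measure_def)
  have "measure (edge_space \<gamma>) ?C = (\<Prod>e\<in>F. measure (edge_measure \<gamma> e) {e \<in> T})"
    unfolding C' unfolding edge_space_eq using F by (intro edges.measure_PiM_emb) (auto simp: edge_measure_def)
  also have "\<dots> = bern (edge_prob \<gamma>) F T"
    unfolding bern_def edge_measure_def using edge_prob_bounds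
    by (intro prod.cong) (auto simp: measure_pmf_single)
  finally show "measure (edge_space \<gamma>) ?C = bern (edge_prob \<gamma>) F T" .
qed

text \<open>Such an event is a finite disjoint union of cylinders, one for each admissible
  configuration of the window.\<close>

lemma edge_space_local_event:
  assumes F: "finite F" "F \<subseteq> LRZ"
  shows "{\<omega>\<in>space (edge_space \<gamma>). P ({e\<in>LRZ. \<omega> e} \<inter> F)} \<in> sets (edge_space \<gamma>)" (is "?A \<in> _")
    and "measure (edge_space \<gamma>) {\<omega>\<in>space (edge_space \<gamma>). P ({e\<in>LRZ. \<omega> e} \<inter> F)}
      = (\<Sum>T\<in>Pow F. bern (edge_prob \<gamma>) F T * of_bool (P T))"
proof -
  let ?C = "\<lambda>T. {\<omega>\<in>space (edge_space \<gamma>). {e\<in>LRZ. \<omega> e} \<inter> F = T}"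
  have A: "?A = (\<Union>T\<in>{T\<in>Pow F. P T}. ?C T)" by auto
  have fin: "finite {T\<in>Pow F. P T}" using F by simp
  show "?A \<in> sets (edge_space \<gamma>)"
    unfolding A using fin edge_space_cylinder(1)[OF F] by (intro sets.finite_UN) auto
  interpret E: prob_space "edge_space \<gamma>"
    unfolding edge_space_eq by (rule edges.prob_space_axioms)
  have "measure (edge_space \<gamma>) ?A = (\<Sum>T\<in>{T\<in>Pow F. P T}. measure (edge_space \<gamma>) (?C T))"
    unfolding A using fin edge_space_cylinder(1)[OF F]
    by (intro E.finite_measure_finite_Union) (auto simp: disjoint_family_on_def)
  also have "\<dots> = (\<Sum>T\<in>{T\<in>Pow F. P T}. bern (edge_prob \<gamma>) F T)"
    using edge_space_cylinder(2)[OF F] by (intro sum.cong) auto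
  also have "\<dots> = (\<Sum>T\<in>Pow F. bern (edge_prob \<gamma>) F T * of_bool (P T))"
    unfolding sum.inter_filter[OF finite_Pow_iff[THEN iffD2, OF F(1)]] by (intro sum.cong) auto
  finally show "measure (edge_space \<gamma>) ?A = (\<Sum>T\<in>Pow F. bern (edge_prob \<gamma>) F T * of_bool (P T))" .
qed

text \<open>Continuity from above along the decreasing truncated events.\<close>

lemma local_prob_tendsto:
  assumes g: "finite (fst g)" and R: "R \<ge> 0"
  shows "(\<lambda>K. local_prob \<gamma> g r (nat \<lfloor>R\<rfloor>) K 0) \<longlonglongrightarrow> inf_ball_prob \<gamma> R g r"
proof -
  let ?\<rho> = "nat \<lfloor>R\<rfloor>"
  \<comment> \<open>A crude bound for the diameter of the target. Offsetting by \<open>K0\<close>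
    makes the events decrease from index 0 on.\<close>
  define K0 where "K0 = nat (\<Sum>z\<in>target g r 0 \<times> target g r 0. \<bar>snd z - fst z\<bar>)"
  have fW: "finite (target g r 0)" using g by (simp add: target_def)
  have K0: "y - x \<le> int K0" if "x \<in> target g r 0" "y \<in> target g r 0" for x y
  proof -
    have "\<bar>snd (x, y) - fst (x, y)\<bar> \<le> (\<Sum>z\<in>target g r 0 \<times> target g r 0. \<bar>snd z - fst z\<bar>)"
      by (rule member_le_sum) (use that fW in auto)
    then show ?thesis unfolding K0_def by auto
  qed
  have K1: "y - x \<le> int (K + K0)" if "x \<in> target g r 0" "y \<in> target g r 0" for x y K
    using K0[OF that] by simp
  define A where "A K = {\<omega>\<in>space (edge_space \<gamma>).
    ball_match g r ?\<rho> UNIV (line_edges ({e\<in>LRZ. \<omega> e} \<inter> local_pairs g r (K + K0) 0)) 0}" for K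
  have sub: "local_pairs g r K v \<subseteq> LRZ" for K v by (auto simp: local_pairs_def)
  have sets: "A K \<in> sets (edge_space \<gamma>)" for K
    unfolding A_def by (rule edge_space_local_event(1)[OF finite_local_pairs[OF g] sub])
  have meas: "measure (edge_space \<gamma>) (A K) = local_prob \<gamma> g r ?\<rho> (K + K0) 0" for K
    unfolding A_def local_prob_def by (rule edge_space_local_event(2)[OF finite_local_pairs[OF g] sub])
  have dec: "decseq A"
  proof (rule decseq_SucI, rule subsetI)
    fix K \<omega> assume "\<omega> \<in> A (Suc K)"
    then show "\<omega> \<in> A K"
      unfolding A_def using ball_match_local_antimono[OF K1[of _ _ K], where T = "{e\<in>LRZ. \<omega> e}" and K' = "Suc K + K0"]
      by auto
  qed
  interpret E: prob_space "edge_space \<gamma>"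
    unfolding edge_space_eq by (rule edges.prob_space_axioms)
  have "(\<lambda>K. measure (edge_space \<gamma>) (A K)) \<longlonglongrightarrow> measure (edge_space \<gamma>) (\<Inter>K. A K)"
    using sets dec by (intro E.finite_Lim_measure_decseq) auto
  moreover have "(\<Inter>K. A K) = {\<omega>\<in>space (edge_space \<gamma>). rooted_iso (ball_graph (inf_graph \<omega>) 0 R, 0) (g, r)}"
  proof -
    have ex: "(\<forall>K. Q (K + K0)) \<longleftrightarrow> (\<forall>K\<ge>K0. Q K)" for Q :: "nat \<Rightarrow> bool"
      by (auto dest: le_Suc_ex simp: add.commute)
    have "(\<forall>K. ball_match g r ?\<rho> UNIV (line_edges (T \<inter> local_pairs g r (K + K0) 0)) 0)
        \<longleftrightarrow> ball_match g r ?\<rho> UNIV (line_edges T) 0" if "T \<subseteq> LRZ" for T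
      unfolding ex[of "\<lambda>K. ball_match g r ?\<rho> UNIV (line_edges (T \<inter> local_pairs g r K 0)) 0"]
      by (rule ball_match_iff_all_local[OF K0 that, symmetric])
    from this[of "{e\<in>LRZ. \<omega> e}" for \<omega>] show ?thesis
      unfolding A_def inf_graph_line_edges using R by (auto simp: rooted_iso_ball_iff)
  qed
  ultimately have "(\<lambda>K. local_prob \<gamma> g r ?\<rho> (K + K0) 0) \<longlonglongrightarrow> inf_ball_prob \<gamma> R g r"
    by (simp add: meas inf_ball_prob_def)
  then show ?thesis by (rule LIMSEQ_offset)
qed

section \<open>Large deviations of the number of matching balls\<close>

definition mean_matches :: "real \<Rightarrow> graph \<Rightarrow> int \<Rightarrow> nat \<Rightarrow> nat \<Rightarrow> real" where
  "mean_matches \<gamma> g r \<rho> N = (\<Sum>S\<in>Pow (LR N). bern (edge_prob \<gamma>) (LR N) S * real (matches g r \<rho> N S))"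

lemma len_prob_nonneg: "0 \<le> len_prob \<gamma> l"
  by (simp add: len_prob_def)

text \<open>Each edge longer than \<open>K\<close> shifts the count by at most 2
  \<open>card (fst g)\<close>, and the expected number of such edges is at most N times a tail of
  the length series.\<close>

lemma mean_matches_truncation:
  assumes g: "finite (fst g)"
  shows "\<bar>mean_matches \<gamma> g r \<rho> N
     - (\<Sum>S\<in>Pow (LR N). bern (edge_prob \<gamma>) (LR N) S * real (matches g r \<rho> N {e\<in>S. snd e - fst e \<le> int K}))\<bar>
     \<le> 2 * real (card (fst g)) * (real N * (\<Sum>l\<le>N. if l > K then len_prob \<gamma> l else 0))"
proof -
  let ?q = "edge_prob \<gamma>" and ?c = "2 * real (card (fst g))"
  let ?sh = "\<lambda>S. {e\<in>S. snd e - fst e \<le> int K}" and ?G = "{e. int K < snd e - fst e}"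
  have "\<bar>mean_matches \<gamma> g r \<rho> N - (\<Sum>S\<in>Pow (LR N). bern ?q (LR N) S * real (matches g r \<rho> N (?sh S)))\<bar>
      = \<bar>\<Sum>S\<in>Pow (LR N). bern ?q (LR N) S * (real (matches g r \<rho> N S) - real (matches g r \<rho> N (?sh S)))\<bar>"
    by (simp add: mean_matches_def sum_subtractf right_diff_distrib)
  also have "\<dots> \<le> (\<Sum>S\<in>Pow (LR N). \<bar>bern ?q (LR N) S * (real (matches g r \<rho> N S) - real (matches g r \<rho> N (?sh S)))\<bar>)"
    by (rule sum_abs)
  also have "\<dots> \<le> (\<Sum>S\<in>Pow (LR N). bern ?q (LR N) S * (?c * real (card (S \<inter> ?G))))"
  proof (rule sum_mono)
    fix S assume S: "S \<in> Pow (LR N)"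
    have "S - ?sh S = S \<inter> ?G" by auto
    then have "\<bar>real (matches g r \<rho> N S) - real (matches g r \<rho> N (?sh S))\<bar> \<le> ?c * real (card (S \<inter> ?G))"
      using matches_lipschitz[OF g, of S N "?sh S" r \<rho>] S by auto
    moreover have "0 \<le> bern ?q (LR N) S" using edge_prob_bounds by (intro bern_nonneg) auto
    ultimately show "\<bar>bern ?q (LR N) S * (real (matches g r \<rho> N S) - real (matches g r \<rho> N (?sh S)))\<bar>
        \<le> bern ?q (LR N) S * (?c * real (card (S \<inter> ?G)))"
      by (simp add: abs_mult mult_left_mono)
  qed
  also have "\<dots> = ?c * (\<Sum>S\<in>Pow (LR N). bern ?q (LR N) S * real (card (S \<inter> ?G)))"
    by (simp add: sum_distrib_left mult_ac)
  also have "\<dots> = ?c * (\<Sum>e\<in>LR N \<inter> ?G. ?q e)"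
    by (simp add: sum_bern_card[OF finite_LR])
  also have "(\<Sum>e\<in>LR N \<inter> ?G. ?q e) = (\<Sum>e\<in>LR N. (\<lambda>l. if l > K then len_prob \<gamma> l else 0) (nat (snd e - fst e)))"
  proof -
    have "(\<Sum>e\<in>LR N \<inter> ?G. ?q e) = (\<Sum>e\<in>LR N. if e \<in> ?G then ?q e else 0)"
      by (rule sum.inter_restrict[OF finite_LR])
    also have "\<dots> = (\<Sum>e\<in>LR N. (\<lambda>l. if l > K then len_prob \<gamma> l else 0) (nat (snd e - fst e)))"
      by (rule sum.cong) (auto simp: edge_prob_eq_len_prob)
    finally show ?thesis .
  qed
  also have "?c * (\<Sum>e\<in>LR N. (\<lambda>l. if l > K then len_prob \<gamma> l else 0) (nat (snd e - fst e)))
      \<le> ?c * (real N * (\<Sum>l\<le>N. if l > K then len_prob \<gamma> l else 0))"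
    by (intro mult_left_mono sum_LR_le) (auto simp: len_prob_nonneg)
  finally show ?thesis .
qed

text \<open>The truncation error relative to N is uniform in N, so \<open>K\<close> can be fixed
  before N grows. Truncation, boundary and limit in \<open>K\<close> use a quarter of
  \<open>e\<close> each.\<close>

lemma mean_matches_tendsto:
  assumes g: "finite (fst g)" and R: "R \<ge> 0" and \<gamma>: "\<gamma> > 0"
  shows "(\<lambda>N. mean_matches \<gamma> g r (nat \<lfloor>R\<rfloor>) N / real N) \<longlonglongrightarrow> inf_ball_prob \<gamma> R g r"
proof (rule LIMSEQ_I)
  fix e :: real assume e: "e > 0"
  let ?\<rho> = "nat \<lfloor>R\<rfloor>" and ?\<pi> = "inf_ball_prob \<gamma> R g r"
  define c where "c = 2 * real (card (fst g)) + 1"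
  have c: "c > 0" by (simp add: c_def add_nonneg_pos)
  obtain K1 where K1: "\<forall>L\<ge>K1. \<forall>N. (\<Sum>l\<le>N. if l > L then len_prob \<gamma> l else 0) \<le> e / (4 * c)"
    using sum_tail_le[OF summable_len_prob[OF \<gamma>] len_prob_nonneg, of "e / (4 * c)"] e c by auto
  obtain K2 where K2: "\<And>K. K \<ge> K2 \<Longrightarrow> norm (local_prob \<gamma> g r ?\<rho> K 0 - ?\<pi>) < e / 4"
    using LIMSEQ_D[OF local_prob_tendsto[OF g R, of \<gamma> r], of "e / 4"] e by auto
  define K where "K = max K1 K2"
  have K: "(\<Sum>l\<le>N. if l > K then len_prob \<gamma> l else 0) \<le> e / (4 * c)" for N
    using K1 max.cobounded1[of K1 K2] unfolding K_def by blast
  define M where "M N = (\<Sum>S\<in>Pow (LR N). bern (edge_prob \<gamma>) (LR N) S * real (matches g r ?\<rho> N {e\<in>S. snd e - fst e \<le> int K}))" for N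
  obtain C where C: "\<And>N. \<bar>M N - real N * local_prob \<gamma> g r ?\<rho> K 0\<bar> \<le> C"
    using expected_short_matches[OF g, of \<gamma> r ?\<rho> K] unfolding M_def by blast
  obtain N0 :: nat where N0: "C / (e / 4) < real N0" using reals_Archimedean2 by blast
  have "norm (mean_matches \<gamma> g r ?\<rho> N / real N - ?\<pi>) < e" if N: "N \<ge> max N0 1" for N
  proof -
    have N1: "real N > 0" "real N \<ge> real N0" using N by auto
    have "\<bar>mean_matches \<gamma> g r ?\<rho> N - M N\<bar> \<le> 2 * real (card (fst g)) * (real N * (\<Sum>l\<le>N. if l > K then len_prob \<gamma> l else 0))"
      unfolding M_def by (rule mean_matches_truncation[OF g])
    also have "\<dots> \<le> c * (real N * (e / (4 * c)))"
      using K[of N] by (intro mult_mono mult_left_mono mult_nonneg_nonneg sum_nonneg)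
        (auto simp: c_def len_prob_nonneg)
    also have "\<dots> = real N * (e / 4)" using c by simp
    finally have 1: "\<bar>mean_matches \<gamma> g r ?\<rho> N - M N\<bar> \<le> real N * (e / 4)" .
    have "C < real N0 * (e / 4)" using N0 e by (simp add: field_simps)
    also have "\<dots> \<le> real N * (e / 4)" using N1 e by (intro mult_right_mono) auto
    finally have 2: "\<bar>M N - real N * local_prob \<gamma> g r ?\<rho> K 0\<bar> \<le> real N * (e / 4)"
      using C[of N] by linarith
    have "\<bar>local_prob \<gamma> g r ?\<rho> K 0 - ?\<pi>\<bar> \<le> e / 4" using K2[of K] by (auto simp: K_def)
    then have "real N * \<bar>local_prob \<gamma> g r ?\<rho> K 0 - ?\<pi>\<bar> \<le> real N * (e / 4)" by (intro mult_left_mono) auto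
    then have 3: "\<bar>real N * local_prob \<gamma> g r ?\<rho> K 0 - real N * ?\<pi>\<bar> \<le> real N * (e / 4)"
      by (simp add: right_diff_distrib[symmetric] abs_mult)
    have "\<bar>mean_matches \<gamma> g r ?\<rho> N - real N * ?\<pi>\<bar> \<le> real N * (3 * e / 4)" using 1 2 3 by linarith
    also have "\<dots> < real N * e" using N1 e by simp
    finally have "\<bar>mean_matches \<gamma> g r ?\<rho> N - real N * ?\<pi>\<bar> < real N * e" .
    moreover have "mean_matches \<gamma> g r ?\<rho> N / real N - ?\<pi> = (mean_matches \<gamma> g r ?\<rho> N - real N * ?\<pi>) / real N"
      using N1 by (simp add: field_simps)
    ultimately show ?thesis using N1 by (simp add: abs_divide divide_less_eq mult.commute)
  qed
  then show "\<exists>no. \<forall>n\<ge>no. norm (mean_matches \<gamma> g r ?\<rho> n / real n - ?\<pi>) < e" by blast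
qed

text \<open>Exponential Markov inequality for the long length and the deviation jointly. The
  absolute value is handled by adding the moments for both signs \<sigma>, hence the factor 2;
  \<kappa> pays for the fluctuations and \<tau> for the reward on long edges.\<close>

lemma matches_deviation_bound:
  assumes g: "finite (fst g)" and \<theta>: "\<theta> \<ge> 0" and t: "t \<ge> 0" "t * (2 * real (card (fst g))) \<le> 1"
    and \<kappa>: "\<And>N. (\<Sum>l\<le>N. len_prob \<gamma> l) \<le> \<kappa>"
    and \<tau>: "\<And>N. (\<Sum>l\<le>N. if l > L then (exp (\<theta> * real l) - 1) * len_prob \<gamma> l else 0) \<le> \<tau>"
  shows "(\<Sum>S\<in>{S\<in>Pow (LR N). d \<le> \<bar>real (matches g r \<rho> N S) - mean_matches \<gamma> g r \<rho> N\<bar> \<and> A \<le> long_len L S}. PN N \<gamma> S)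
    \<le> 2 * exp (- (t * d) - \<theta> * A + real N * ((t * (2 * real (card (fst g))))\<^sup>2 * \<kappa> + 3 * \<tau>))"
proof -
  let ?q = "edge_prob \<gamma>" and ?m = "mean_matches \<gamma> g r \<rho> N"
  define c where "c = t * (2 * real (card (fst g)))"
  define a where "a e = (if int L < snd e - fst e then \<theta> * real_of_int (snd e - fst e) else 0)" for e :: "int \<times> int"
  define B where "B = real N * (c\<^sup>2 * \<kappa> + 3 * \<tau>)"
  have c: "0 \<le> c" "c \<le> 1" using t by (auto simp: c_def)
  have a_sum: "(\<Sum>e\<in>S. a e) = \<theta> * long_len L S" if "S \<subseteq> LR N" for S
  proof -
    have fS: "finite S" using finite_subset[OF that finite_LR] .
    show ?thesis unfolding long_len_def a_def sum_distrib_left by (rule sum.inter_filter[OF fS, symmetric])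
  qed
  have exponent: "(\<Sum>e\<in>LR N. ?q e * (c\<^sup>2 + 3 * (exp (a e) - 1))) \<le> B"
  proof -
    define u where "u l = len_prob \<gamma> l * (c\<^sup>2 + 3 * (if l > L then exp (\<theta> * real l) - 1 else 0))" for l
    have "(\<Sum>e\<in>LR N. ?q e * (c\<^sup>2 + 3 * (exp (a e) - 1))) = (\<Sum>e\<in>LR N. u (nat (snd e - fst e)))"
      by (rule sum.cong) (auto simp: u_def a_def edge_prob_eq_len_prob LR_def)
    also have "\<dots> \<le> real N * (\<Sum>l\<le>N. u l)"
      using \<theta> by (intro sum_LR_le) (auto simp: u_def len_prob_nonneg)
    also have "(\<Sum>l\<le>N. u l) = c\<^sup>2 * (\<Sum>l\<le>N. len_prob \<gamma> l) + 3 * (\<Sum>l\<le>N. if l > L then (exp (\<theta> * real l) - 1) * len_prob \<gamma> l else 0)"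
      unfolding sum_distrib_left sum.distrib[symmetric] by (rule sum.cong) (auto simp: u_def algebra_simps)
    also have "real N * \<dots> \<le> B"
      unfolding B_def using \<kappa>[of N] \<tau>[of N] by (intro mult_left_mono add_mono) auto
    finally show ?thesis .
  qed
  have moment: "(\<Sum>S\<in>Pow (LR N). PN N \<gamma> S * exp (\<theta> * long_len L S + \<sigma> * t * (real (matches g r \<rho> N S) - ?m))) \<le> exp B"
    if \<sigma>: "\<sigma> \<in> {1, -1}" for \<sigma> :: real
  proof -
    define f where "f S = \<sigma> * t * real (matches g r \<rho> N S)" for S
    have mean: "(\<Sum>T\<in>Pow (LR N). bern ?q (LR N) T * f T) = \<sigma> * t * ?m"
      by (simp add: f_def mean_matches_def sum_distrib_left mult_ac)
    have "(\<Sum>S\<in>Pow (LR N). bern ?q (LR N) S * exp ((\<Sum>e\<in>S. a e) + f S - (\<Sum>T\<in>Pow (LR N). bern ?q (LR N) T * f T)))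
        \<le> exp (\<Sum>e\<in>LR N. ?q e * (c\<^sup>2 + 3 * (exp (a e) - 1)))"
    proof (rule bern_exp_moment[OF finite_LR c])
      show "\<bar>f (insert e S) - f S\<bar> \<le> c" if "e \<in> LR N" "S \<subseteq> LR N" for e S
      proof -
        have "\<bar>f (insert e S) - f S\<bar> = t * \<bar>real (matches g r \<rho> N (insert e S)) - real (matches g r \<rho> N S)\<bar>"
          using \<sigma> t(1) by (auto simp: f_def right_diff_distrib[symmetric] abs_mult)
        also have "\<dots> \<le> c" unfolding c_def using t(1) matches_insert[OF g that(2,1)] by (intro mult_left_mono) auto
        finally show ?thesis .
      qed
    qed (use edge_prob_bounds \<theta> in \<open>auto simp: a_def\<close>)
    also have "\<dots> \<le> exp B" using exponent by simp
    finally have "(\<Sum>S\<in>Pow (LR N). bern ?q (LR N) S * exp ((\<Sum>e\<in>S. a e) + f S - \<sigma> * t * ?m)) \<le> exp B"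
      unfolding mean .
    moreover have "(\<Sum>S\<in>Pow (LR N). bern ?q (LR N) S * exp ((\<Sum>e\<in>S. a e) + f S - \<sigma> * t * ?m))
        = (\<Sum>S\<in>Pow (LR N). PN N \<gamma> S * exp (\<theta> * long_len L S + \<sigma> * t * (real (matches g r \<rho> N S) - ?m)))"
    proof (rule sum.cong[OF refl])
      fix S assume "S \<in> Pow (LR N)"
      then show "bern ?q (LR N) S * exp ((\<Sum>e\<in>S. a e) + f S - \<sigma> * t * ?m)
        = PN N \<gamma> S * exp (\<theta> * long_len L S + \<sigma> * t * (real (matches g r \<rho> N S) - ?m))"
        by (simp add: PN_eq_bern a_sum f_def algebra_simps)
    qed
    ultimately show ?thesis by simp
  qed
  let ?X = "{S\<in>Pow (LR N). d \<le> \<bar>real (matches g r \<rho> N S) - ?m\<bar> \<and> A \<le> long_len L S}"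
  let ?e = "\<lambda>\<sigma> S. exp (\<theta> * long_len L S + \<sigma> * t * (real (matches g r \<rho> N S) - ?m))"
  have "exp (\<theta> * A + t * d) * (\<Sum>S\<in>?X. PN N \<gamma> S) \<le> (\<Sum>S\<in>?X. PN N \<gamma> S * (?e 1 S + ?e (-1) S))"
    unfolding sum_distrib_left
  proof (rule sum_mono)
    fix S assume S: "S \<in> ?X"
    have "\<theta> * A \<le> \<theta> * long_len L S" using S \<theta> by (auto intro: mult_left_mono)
    moreover have "t * d \<le> t * \<bar>real (matches g r \<rho> N S) - ?m\<bar>" using S t by (auto intro: mult_left_mono)
    ultimately have "exp (\<theta> * A + t * d) \<le> exp (\<theta> * long_len L S + t * \<bar>real (matches g r \<rho> N S) - ?m\<bar>)"
      by simp
    also have "\<dots> \<le> ?e 1 S + ?e (-1) S"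
      by (cases "real (matches g r \<rho> N S) \<ge> ?m") (auto simp: abs_if algebra_simps add_increasing add_increasing2)
    finally show "exp (\<theta> * A + t * d) * PN N \<gamma> S \<le> PN N \<gamma> S * (?e 1 S + ?e (-1) S)"
      using PN_nonneg[of N \<gamma> S] by (subst mult.commute) (rule mult_left_mono)
  qed
  also have "\<dots> \<le> (\<Sum>S\<in>Pow (LR N). PN N \<gamma> S * (?e 1 S + ?e (-1) S))"
    using PN_nonneg finite_LR by (intro sum_mono2) (auto intro!: mult_nonneg_nonneg add_nonneg_nonneg)
  also have "\<dots> = (\<Sum>S\<in>Pow (LR N). PN N \<gamma> S * ?e 1 S) + (\<Sum>S\<in>Pow (LR N). PN N \<gamma> S * ?e (-1) S)"
    by (simp add: distrib_left sum.distrib)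
  also have "\<dots> \<le> 2 * exp B" using moment[of 1] moment[of "-1"] by simp
  finally have "(\<Sum>S\<in>?X. PN N \<gamma> S) \<le> 2 * exp B / exp (\<theta> * A + t * d)"
    by (simp add: pos_le_divide_eq mult.commute)
  also have "\<dots> = 2 * exp (B - (\<theta> * A + t * d))"
    by (simp add: exp_diff)
  also have "B - (\<theta> * A + t * d) = - (t * d) - \<theta> * A + B" by simp
  finally show ?thesis by (simp add: B_def c_def)
qed

text \<open>The exponential moment is taken with the weight \<open>exp (\<theta> * long_len L S)\<close>, \<open>\<theta>\<close> close to 1: forcing
  a total length \<open>rate * N\<close> of long edges costs \<open>exp (- rate * N)\<close>, and a deviation of the local
  statistics costs an additional exponential factor.\<close>

lemma matches_large_deviation:
  assumes g: "finite (fst g)" and \<gamma>: "\<gamma> > 0" and \<delta>: "\<delta> > 0" and rate: "rate = 0 \<or> (rate > 0 \<and> \<gamma> = 1)"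
  obtains \<eta> \<epsilon> L where "\<eta> > 0" "\<epsilon> > 0" "L \<ge> 1"
    "\<And>N. (\<Sum>S\<in>{S\<in>Pow (LR N). \<delta> * real N \<le> \<bar>real (matches g r \<rho> N S) - mean_matches \<gamma> g r \<rho> N\<bar>
          \<and> (rate - \<epsilon>) * real N \<le> long_len L S}. PN N \<gamma> S) \<le> 2 * exp (- ((rate + \<eta>) * real N))"
proof -
  define c where "c = 2 * real (card (fst g)) + 1"
  have c: "c \<ge> 1" by (simp add: c_def)
  define \<kappa> where "\<kappa> = suminf (len_prob \<gamma>) + 1"
  have \<kappa>: "(\<Sum>l\<le>N. len_prob \<gamma> l) \<le> \<kappa>" for N
    unfolding \<kappa>_def using sum_le_suminf[OF summable_len_prob[OF \<gamma>], of "{..N}"] by (simp add: len_prob_nonneg)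
  have \<kappa>1: "\<kappa> \<ge> 1" unfolding \<kappa>_def using suminf_nonneg[OF summable_len_prob[OF \<gamma>]] by (simp add: len_prob_nonneg)
  \<comment> \<open>The first bound keeps increments at most 1, as \<open>bern_exp_moment\<close>
    requires; the second keeps the quadratic term t^2 c^2 \<kappa> below a quarter of the linear
    gain t \<delta>.\<close>
  define t where "t = min (1 / c) (\<delta> / (4 * c\<^sup>2 * \<kappa>))"
  have t: "t > 0" using c \<kappa>1 \<delta> by (simp add: t_def)
  have tc: "t * (2 * real (card (fst g))) \<le> 1"
  proof -
    have "t * (2 * real (card (fst g))) \<le> (1 / c) * c"
      using t c by (intro mult_mono) (auto simp: t_def c_def)
    then show ?thesis using c by simp
  qed
  \<comment> \<open>The budget: the deviation gains 4 z. The quadratic term, the tail 3 \<tau> and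
    the loss from \<theta> < 1 and \<epsilon> > 0 take at most z each, and the last z is the \<eta>
    obtained.\<close>
  define z where "z = t * \<delta> / 4"
  have z: "z > 0" using t \<delta> by (simp add: z_def)
  have quad: "(t * (2 * real (card (fst g))))\<^sup>2 * \<kappa> \<le> z"
  proof -
    have "(t * (2 * real (card (fst g))))\<^sup>2 * \<kappa> \<le> (t * c)\<^sup>2 * \<kappa>"
      using t \<kappa>1 by (intro mult_right_mono power_mono mult_left_mono) (auto simp: c_def)
    also have "\<dots> = t * (t * (c\<^sup>2 * \<kappa>))" by (simp add: power2_eq_square)
    also have "\<dots> \<le> t * (\<delta> / (4 * c\<^sup>2 * \<kappa>) * (c\<^sup>2 * \<kappa>))"
      using t c \<kappa>1 by (intro mult_left_mono mult_right_mono) (auto simp: t_def)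
    also have "\<dots> = z" using c \<kappa>1 by (simp add: z_def)
    finally show ?thesis .
  qed
  have "\<exists>\<theta> \<epsilon> \<tau> L. \<theta> \<ge> 0 \<and> \<epsilon> > 0 \<and> L \<ge> 1 \<and> rate - z \<le> \<theta> * (rate - \<epsilon>) \<and> 3 * \<tau> \<le> z \<and>
     (\<forall>N. (\<Sum>l\<le>N. if l > L then (exp (\<theta> * real l) - 1) * len_prob \<gamma> l else 0) \<le> \<tau>)"
  proof (cases "rate = 0")
    case True
    then show ?thesis using z
      by - (rule exI[of _ "0::real"], rule exI[of _ "1::real"], rule exI[of _ "0::real"], rule exI[of _ "1::nat"], auto cong: if_cong)
  next
    case False
    then have r: "rate > 0" "\<gamma> = 1" using rate by auto
    \<comment> \<open>Here \<theta> = 1 - s, so for \<gamma> = 1 the rewarded weights exp(\<theta>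
      l) exp(- l) = exp(- s l) are summable and \<open>L\<close> can make their tail small;
      \<open>s\<close> is small enough that \<theta> loses at most z/2 of the rate.\<close>
    define s where "s = min (1 / 2) (z / (2 * rate))"
    have s: "0 < s" "s \<le> 1 / 2" "s * rate \<le> z / 2"
    proof -
      show "0 < s" "s \<le> 1 / 2" using z r by (auto simp: s_def)
      have "s * rate \<le> z / (2 * rate) * rate" using r by (intro mult_right_mono) (auto simp: s_def)
      then show "s * rate \<le> z / 2" using r by simp
    qed
    have "summable (\<lambda>l. exp (- s) ^ l)" using s by (intro summable_geometric) auto
    then have summ: "summable (\<lambda>l. exp (- s * real l))"
      by (simp add: exp_of_nat_mult[symmetric] mult.commute)
    obtain K where K: "\<forall>L\<ge>K. \<forall>N. (\<Sum>l\<le>N. if l > L then exp (- s * real l) else 0) \<le> z / 3"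
      using sum_tail_le[OF summ, of "z / 3"] z by auto
    define L where "L = max K 1"
    have "(\<Sum>l\<le>N. if l > L then (exp ((1 - s) * real l) - 1) * len_prob \<gamma> l else 0) \<le> z / 3" for N
    proof -
      have "(exp ((1 - s) * real l) - 1) * len_prob \<gamma> l \<le> exp (- s * real l)" for l
      proof -
        have "(exp ((1 - s) * real l) - 1) * len_prob \<gamma> l \<le> exp ((1 - s) * real l) * exp (- real l)"
          using r by (intro mult_mono) (auto simp: len_prob_def)
        also have "\<dots> = exp (- s * real l)" by (simp add: exp_add[symmetric] algebra_simps)
        finally show ?thesis .
      qed
      then have "(\<Sum>l\<le>N. if l > L then (exp ((1 - s) * real l) - 1) * len_prob \<gamma> l else 0)
          \<le> (\<Sum>l\<le>N. if l > L then exp (- s * real l) else 0)"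
        by (intro sum_mono) auto
      also have "\<dots> \<le> z / 3" using K max.cobounded1[of K 1] unfolding L_def by blast
      finally show ?thesis .
    qed
    moreover have "rate - z \<le> (1 - s) * (rate - z / 2)"
    proof -
      have "(1 - s) * (rate - z / 2) = rate - z / 2 - s * rate + s * (z / 2)" by (simp add: field_simps)
      moreover have "0 \<le> s * (z / 2)" using s z by simp
      ultimately show ?thesis using s(3) by linarith
    qed
    ultimately show ?thesis using s z
      by - (rule exI[of _ "1 - s"], rule exI[of _ "z / 2"], rule exI[of _ "z / 3"], rule exI[of _ L], simp add: L_def)
  qed
  then obtain \<theta> \<epsilon> \<tau> L where *: "\<theta> \<ge> 0" "\<epsilon> > 0" "L \<ge> 1" "rate - z \<le> \<theta> * (rate - \<epsilon>)" "3 * \<tau> \<le> z"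
     "\<And>N. (\<Sum>l\<le>N. if l > L then (exp (\<theta> * real l) - 1) * len_prob \<gamma> l else 0) \<le> \<tau>" by blast
  show ?thesis
  proof (rule that[OF z *(2,3)])
    fix N
    have "(\<Sum>S\<in>{S\<in>Pow (LR N). \<delta> * real N \<le> \<bar>real (matches g r \<rho> N S) - mean_matches \<gamma> g r \<rho> N\<bar>
          \<and> (rate - \<epsilon>) * real N \<le> long_len L S}. PN N \<gamma> S)
       \<le> 2 * exp (- (t * (\<delta> * real N)) - \<theta> * ((rate - \<epsilon>) * real N)
            + real N * ((t * (2 * real (card (fst g))))\<^sup>2 * \<kappa> + 3 * \<tau>))"
      using t by (intro matches_deviation_bound[OF g *(1) _ tc \<kappa> *(6)]) auto
    also have "\<dots> \<le> 2 * exp (- ((rate + z) * real N))"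
    proof -
      have "- (t * (\<delta> * real N)) - \<theta> * ((rate - \<epsilon>) * real N)
            + real N * ((t * (2 * real (card (fst g))))\<^sup>2 * \<kappa> + 3 * \<tau>)
          = real N * (- (4 * z) - \<theta> * (rate - \<epsilon>) + ((t * (2 * real (card (fst g))))\<^sup>2 * \<kappa> + 3 * \<tau>))"
        by (simp add: z_def algebra_simps)
      also have "\<dots> \<le> real N * (- (rate + z))"
        using quad *(4,5) by (intro mult_left_mono) linarith+
      also have "\<dots> = - ((rate + z) * real N)" by (simp add: algebra_simps)
      finally show ?thesis by simp
    qed
    finally show "(\<Sum>S\<in>{S\<in>Pow (LR N). \<delta> * real N \<le> \<bar>real (matches g r \<rho> N S) - mean_matches \<gamma> g r \<rho> N\<bar>
          \<and> (rate - \<epsilon>) * real N \<le> long_len L S}. PN N \<gamma> S) \<le> 2 * exp (- ((rate + z) * real N))" .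
  qed
qed

section \<open>Convergence of the tilted ball probabilities\<close>

lemma fin_ball_prob_eq:
  assumes R: "R > 0"
  shows "fin_ball_prob N \<gamma> b p R g r =
    (\<Sum>S\<in>Pow (LR N). tilt_weight N \<gamma> b p S / Zfun N \<gamma> b p * (real (matches g r (nat \<lfloor>R\<rfloor>) N S) / real N))"
proof -
  have "{v \<in> {1..int N}. rooted_iso (ball_graph (fin_graph N S) v R, v) (g, r)}
      = {v\<in>{1..int N}. ball_match g r (nat \<lfloor>R\<rfloor>) {1..int N} (snd (fin_graph N S)) v}" for S
  proof (rule Collect_cong)
    fix v
    have "fin_graph N S = ({1..int N}, snd (fin_graph N S))" by (simp add: fin_graph_def)
    then show "(v \<in> {1..int N} \<and> rooted_iso (ball_graph (fin_graph N S) v R, v) (g, r))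
        \<longleftrightarrow> (v \<in> {1..int N} \<and> ball_match g r (nat \<lfloor>R\<rfloor>) {1..int N} (snd (fin_graph N S)) v)"
      using rooted_iso_ball_iff[of v "{1..int N}" R "snd (fin_graph N S)" g r] R by auto
  qed
  then show ?thesis unfolding fin_ball_prob_def matches_def by simp
qed

lemma tilt_weight_nonneg: "0 \<le> tilt_weight N \<gamma> b p S"
  unfolding tilt_weight_def using PN_nonneg by simp

lemma inf_ball_prob_bounds: "0 \<le> inf_ball_prob \<gamma> R g r" "inf_ball_prob \<gamma> R g r \<le> 1"
proof -
  interpret E: prob_space "edge_space \<gamma>"
    unfolding edge_space_eq by (rule edges.prob_space_axioms)
  show "0 \<le> inf_ball_prob \<gamma> R g r" "inf_ball_prob \<gamma> R g r \<le> 1" by (auto simp: inf_ball_prob_def)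
qed

text \<open>Configurations of high energy carry weight at most exp(- u) times their probability. For
  those in \<open>Y\<close> the tilt is simply dropped, as the energy is nonnegative.\<close>

lemma tilted_mass_le:
  assumes X: "X \<subseteq> Pow (LR N)"
    and up: "\<And>S. S \<in> X \<Longrightarrow> u \<le> real N powr b * Hp p (fin_graph N S) \<or> S \<in> Y"
    and H: "\<And>S. 0 \<le> Hp p (fin_graph N S)" and Y: "Y \<subseteq> Pow (LR N)"
  shows "(\<Sum>S\<in>X. tilt_weight N \<gamma> b p S) \<le> exp (- u) + (\<Sum>S\<in>Y. PN N \<gamma> S)"
proof -
  have fin: "finite (Pow (LR N))" using finite_LR by simp
  have "(\<Sum>S\<in>X. tilt_weight N \<gamma> b p S) \<le> (\<Sum>S\<in>X. exp (- u) * PN N \<gamma> S + (if S \<in> Y then PN N \<gamma> S else 0))"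
  proof (rule sum_mono)
    fix S assume S: "S \<in> X"
    show "tilt_weight N \<gamma> b p S \<le> exp (- u) * PN N \<gamma> S + (if S \<in> Y then PN N \<gamma> S else 0)"
    proof (cases "S \<in> Y")
      case True
      have "tilt_weight N \<gamma> b p S \<le> 1 * PN N \<gamma> S"
        unfolding tilt_weight_def using H[of S] PN_nonneg by (intro mult_right_mono) auto
      moreover have "0 \<le> exp (- u) * PN N \<gamma> S" using PN_nonneg by simp
      ultimately show ?thesis using True by simp
    next
      case False
      then have "u \<le> real N powr b * Hp p (fin_graph N S)" using up[OF S] by simp
      then show ?thesis using False PN_nonneg[of N \<gamma> S] by (auto simp: tilt_weight_def intro!: mult_right_mono)
    qed
  qed
  also have "\<dots> = exp (- u) * (\<Sum>S\<in>X. PN N \<gamma> S) + (\<Sum>S\<in>X \<inter> Y. PN N \<gamma> S)"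
    by (simp add: sum.distrib sum_distrib_left sum.inter_restrict[OF finite_subset[OF X fin]])
  also have "\<dots> \<le> exp (- u) * (\<Sum>S\<in>Pow (LR N). PN N \<gamma> S) + (\<Sum>S\<in>Y. PN N \<gamma> S)"
    using X fin finite_subset[OF Y fin] PN_nonneg by (intro add_mono mult_left_mono sum_mono2) auto
  also have "(\<Sum>S\<in>Pow (LR N). PN N \<gamma> S) = 1"
    unfolding PN_eq_bern by (rule sum_bern_eq_1[OF finite_LR])
  finally show ?thesis by simp
qed

text \<open>Separates the probability from the geometry: \<open>rate\<close> is the exponential cost
  per vertex of the partition function. The energy or the long length must enforce the same
  \<open>rate\<close> on all configurations, so that atypical ones are exponentially negligible
  relative to \<open>Zfun\<close>.\<close>

theorem fin_ball_prob_tendsto: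
  assumes p: "1 \<le> p" and \<gamma>: "\<gamma> > 0" and R: "R > 0" and g: "finite (fst g)"
    and rate: "rate = 0 \<or> (rate > 0 \<and> \<gamma> = 1)"
    and low: "\<And>\<eta>. \<eta> > 0 \<Longrightarrow> eventually (\<lambda>N. exp (- ((rate + \<eta>) * real N)) \<le> Zfun N \<gamma> b p) sequentially"
    and up: "\<And>\<epsilon> L. \<epsilon> > 0 \<Longrightarrow> L \<ge> 1 \<Longrightarrow> eventually (\<lambda>N. \<forall>S\<subseteq>LR N.
        (rate + 1) * real N \<le> real N powr b * Hp p (fin_graph N S) \<or> (rate - \<epsilon>) * real N \<le> long_len L S) sequentially"
  shows "(\<lambda>N. fin_ball_prob N \<gamma> b p R g r) \<longlonglongrightarrow> inf_ball_prob \<gamma> R g r"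
proof (rule tendstoI)
  fix e :: real assume e: "e > 0"
  let ?\<rho> = "nat \<lfloor>R\<rfloor>" and ?\<pi> = "inf_ball_prob \<gamma> R g r"
  \<comment> \<open>The final error is at most 3 \<delta>: one for the mean, one for the deviation,
    one for the mass of atypical configurations.\<close>
  define \<delta> where "\<delta> = e / 4"
  have \<delta>: "\<delta> > 0" using e by (simp add: \<delta>_def)
  obtain \<eta> \<epsilon> L where \<eta>: "\<eta> > 0" and \<epsilon>: "\<epsilon> > 0" and L: "L \<ge> 1" and ld:
    "\<And>N. (\<Sum>S\<in>{S\<in>Pow (LR N). \<delta> * real N \<le> \<bar>real (matches g r ?\<rho> N S) - mean_matches \<gamma> g r ?\<rho> N\<bar>
          \<and> (rate - \<epsilon>) * real N \<le> long_len L S}. PN N \<gamma> S) \<le> 2 * exp (- ((rate + \<eta>) * real N))"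
    using matches_large_deviation[OF g \<gamma> \<delta> rate, of r ?\<rho>] by blast
  \<comment> \<open>Capped at 1 because the energy alternative exceeds the rate by 1 only; half of
    it goes to the lower bound on \<open>Zfun\<close>.\<close>
  define \<eta>' where "\<eta>' = min \<eta> 1"
  have \<eta>': "0 < \<eta>'" "\<eta>' \<le> \<eta>" "\<eta>' \<le> 1" using \<eta> by (auto simp: \<eta>'_def)
  have "eventually (\<lambda>N. \<bar>mean_matches \<gamma> g r ?\<rho> N / real N - ?\<pi>\<bar> < \<delta>) sequentially"
    using tendstoD[OF mean_matches_tendsto[OF g _ \<gamma>] \<delta>, of R r] R by (simp add: dist_real_def)
  moreover have "eventually (\<lambda>N. 3 * exp (- (\<eta>' / 2 * real N)) < \<delta>) sequentially"
    using \<eta>'(1) \<delta> by real_asymp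
  moreover have "eventually (\<lambda>N. exp (- ((rate + \<eta>' / 2) * real N)) \<le> Zfun N \<gamma> b p) sequentially"
    using \<eta>' by (intro low) simp
  ultimately show "eventually (\<lambda>N. dist (fin_ball_prob N \<gamma> b p R g r) ?\<pi> < e) sequentially"
    using up[OF \<epsilon> L] eventually_gt_at_top[of 0]
  proof eventually_elim
    case (elim N)
    let ?Z = "Zfun N \<gamma> b p" and ?w = "tilt_weight N \<gamma> b p" and ?m = "mean_matches \<gamma> g r ?\<rho> N"
    let ?f = "\<lambda>S. real (matches g r ?\<rho> N S)"
    define X where "X = {S\<in>Pow (LR N). \<delta> * real N \<le> \<bar>?f S - ?m\<bar>}"
    define Y where "Y = {S\<in>Pow (LR N). \<delta> * real N \<le> \<bar>?f S - ?m\<bar> \<and> (rate - \<epsilon>) * real N \<le> long_len L S}"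
    have N: "real N > 0" using elim by simp
    have Z: "?Z > 0" using elim(3) exp_gt_zero less_le_trans by blast
    have "(\<Sum>S\<in>X. ?w S) \<le> exp (- ((rate + 1) * real N)) + (\<Sum>S\<in>Y. PN N \<gamma> S)"
      using elim(4,5) Hp_nonneg[OF p] by (intro tilted_mass_le) (auto simp: X_def Y_def)
    also have "\<dots> \<le> exp (- ((rate + \<eta>') * real N)) + 2 * exp (- ((rate + \<eta>') * real N))"
    proof (rule add_mono)
      show "exp (- ((rate + 1) * real N)) \<le> exp (- ((rate + \<eta>') * real N))"
        using \<eta>' by (auto intro!: mult_right_mono)
      have "(\<Sum>S\<in>Y. PN N \<gamma> S) \<le> 2 * exp (- ((rate + \<eta>) * real N))" unfolding Y_def by (rule ld)
      also have "\<dots> \<le> 2 * exp (- ((rate + \<eta>') * real N))" using \<eta>' by (auto intro!: mult_right_mono)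
      finally show "(\<Sum>S\<in>Y. PN N \<gamma> S) \<le> 2 * exp (- ((rate + \<eta>') * real N))" .
    qed
    also have "\<dots> = 3 * exp (- (\<eta>' / 2 * real N)) * exp (- ((rate + \<eta>' / 2) * real N))"
      by (simp add: mult_exp_exp algebra_simps)
    also have "\<dots> \<le> \<delta> * ?Z"
      using elim(2,3) \<delta> by (intro mult_mono) auto
    finally have mass: "(\<Sum>S\<in>X. ?w S) / ?Z \<le> \<delta>" using Z by (simp add: divide_le_eq)
    have tot: "(\<Sum>S\<in>Pow (LR N). ?w S / ?Z) = 1"
      using Z by (simp add: sum_divide_distrib[symmetric] Zfun_def[symmetric])
    have fin: "finite (Pow (LR N))" using finite_LR by simp
    have "fin_ball_prob N \<gamma> b p R g r - ?\<pi> = (\<Sum>S\<in>Pow (LR N). ?w S / ?Z * (?f S / real N)) - ?\<pi> * (\<Sum>S\<in>Pow (LR N). ?w S / ?Z)"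
      unfolding fin_ball_prob_eq[OF R] tot by simp
    also have "\<dots> = (\<Sum>S\<in>Pow (LR N). ?w S / ?Z * (?f S / real N - ?\<pi>))"
      by (simp add: sum_distrib_left sum_subtractf[symmetric] algebra_simps)
    also have "\<bar>\<dots>\<bar> \<le> (\<Sum>S\<in>Pow (LR N). \<bar>?w S / ?Z * (?f S / real N - ?\<pi>)\<bar>)" by (rule sum_abs)
    also have "\<dots> \<le> (\<Sum>S\<in>Pow (LR N). ?w S / ?Z * (2 * \<delta>) + (if S \<in> X then ?w S / ?Z else 0))"
    proof (rule sum_mono)
      fix S assume S: "S \<in> Pow (LR N)"
      have w: "0 \<le> ?w S / ?Z" using Z tilt_weight_nonneg by simp
      have "\<bar>?f S / real N - ?\<pi>\<bar> \<le> 2 * \<delta> + (if S \<in> X then 1 else 0)"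
      proof (cases "S \<in> X")
        case True
        have "?f S / real N \<le> 1" "0 \<le> ?f S / real N" using matches_le[of g r ?\<rho> N S] N by auto
        then have "\<bar>?f S / real N - ?\<pi>\<bar> \<le> 1" using inf_ball_prob_bounds[of \<gamma> R g r] by linarith
        then show ?thesis using True \<delta> by simp
      next
        case False
        then have "\<bar>?f S - ?m\<bar> \<le> \<delta> * real N" using S by (auto simp: X_def)
        then have "\<bar>?f S - ?m\<bar> / real N \<le> \<delta>" using N by (simp add: divide_le_eq)
        then have "\<bar>?f S / real N - ?m / real N\<bar> \<le> \<delta>"
          using N by (simp add: diff_divide_distrib[symmetric] abs_divide)
        then show ?thesis using elim(1) False by auto
      qed
      then have "?w S / ?Z * \<bar>?f S / real N - ?\<pi>\<bar> \<le> ?w S / ?Z * (2 * \<delta> + (if S \<in> X then 1 else 0))"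
        using w by (rule mult_left_mono)
      then show "\<bar>?w S / ?Z * (?f S / real N - ?\<pi>)\<bar> \<le> ?w S / ?Z * (2 * \<delta>) + (if S \<in> X then ?w S / ?Z else 0)"
        unfolding abs_mult abs_of_nonneg[OF w] by (auto simp: distrib_left)
    qed
    also have "\<dots> = 2 * \<delta> + (\<Sum>S\<in>X. ?w S) / ?Z"
    proof -
      have "(\<Sum>S\<in>Pow (LR N). if S \<in> X then ?w S / ?Z else 0) = (\<Sum>S\<in>Pow (LR N) \<inter> X. ?w S / ?Z)"
        by (rule sum.inter_restrict[OF fin, symmetric])
      also have "Pow (LR N) \<inter> X = X" by (auto simp: X_def)
      finally have X: "(\<Sum>S\<in>Pow (LR N). if S \<in> X then ?w S / ?Z else 0) = (\<Sum>S\<in>X. ?w S / ?Z)" .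
      show ?thesis
        unfolding sum.distrib sum_distrib_right[symmetric] tot X by (simp add: sum_divide_distrib)
    qed
    also have "\<dots> < e" using mass e unfolding \<delta>_def by linarith
    finally show ?case by (simp add: dist_real_def)
  qed
qed

text \<open>Local finiteness makes every matched ball finite, so an infinite \<open>g\<close> is
  never attained on either side.\<close>

lemma infinite_target_probs:
  assumes g: "is_graph g" "infinite (fst g)" and R: "R > 0"
  shows "fin_ball_prob N \<gamma> b p R g r = 0" "inf_ball_prob \<gamma> R g r = 0"
proof -
  have no: "\<not> ball_match g r \<rho> V E v" if "v \<in> V" "\<And>e. e \<in> E \<Longrightarrow> e \<subseteq> V" for \<rho> V E v
    using ball_match_finite[OF _ that g(1)] g(2) by blast
  have "matches g r (nat \<lfloor>R\<rfloor>) N S = 0" if "S \<in> Pow (LR N)" for S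
  proof -
    have "{v\<in>{1..int N}. ball_match g r (nat \<lfloor>R\<rfloor>) {1..int N} (snd (fin_graph N S)) v} = {}"
      using no[of _ "{1..int N}" "snd (fin_graph N S)"] fin_graph_edges_subset[of S N] that by blast
    then show ?thesis unfolding matches_def by (metis card.empty)
  qed
  then show "fin_ball_prob N \<gamma> b p R g r = 0" unfolding fin_ball_prob_eq[OF R] by simp
  have "\<not> rooted_iso (ball_graph (inf_graph \<omega>) 0 R, 0) (g, r)" for \<omega>
    unfolding inf_graph_line_edges using R no[of 0 UNIV] by (simp add: rooted_iso_ball_iff)
  then show "inf_ball_prob \<gamma> R g r = 0" by (simp add: inf_ball_prob_def)
qed

text \<open>The value is the left end of the k-th interval, which is nonempty thanks to the maximum
  with 0. For infinite p, the case k = 1 is the point 0 of [0, 1/4].\<close>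

lemma not_in_Eset:
  assumes "1 \<le> p" "b \<notin> Eset p" "k \<ge> 1"
  shows "b \<noteq> (real k - 1) / real k"
proof
  assume b: "b = (real k - 1) / real k"
  show False
  proof (cases p)
    case (real q)
    have "b \<in> Eset p" unfolding real Eset_def using assms(3) b by (auto intro!: bexI[of _ k])
    with assms show False by simp
  next
    case PInf
    have "b \<in> Eset p" unfolding PInf Eset_def using assms(3) b
      by (cases "k = 1") (auto intro!: exI[of _ k])
    with assms show False by simp
  qed (use assms in auto)
qed

text \<open>In the variable x = 1/(1 - b) the thresholds (k-1)/k become the integers k, so the level
  sought is the integer part of a non-integer x.\<close>

lemma exists_level:
  assumes "b < 1" "0 \<le> b" "\<And>k::nat. k \<ge> 1 \<Longrightarrow> b \<noteq> (real k - 1) / real k"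
  obtains k :: nat where "k \<ge> 1" "b + 1 / real k > 1" "b + 1 / real (k + 1) < 1"
proof -
  define x where "x = 1 / (1 - b)"
  define k where "k = nat \<lfloor>x\<rfloor>"
  have x1: "x \<ge> 1" using assms by (simp add: x_def field_simps)
  have b: "b = 1 - 1 / x" using assms(1) by (simp add: x_def)
  have k1: "k \<ge> 1" using x1 by (simp add: k_def le_nat_iff)
  have "real k \<le> x" "x < real k + 1" using x1 by (auto simp: k_def)
  moreover have "x \<noteq> real k" using assms(3)[OF k1] k1 b by (auto simp: field_simps)
  ultimately have k: "real k < x" "x < real k + 1" by auto
  have "1 / x < 1 / real k" using k k1 by (intro divide_strict_left_mono) auto
  moreover have "1 / real (k + 1) < 1 / x" using k x1 by (intro divide_strict_left_mono) auto
  ultimately show ?thesis using that[OF k1] b by simp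
qed

theorem theorem2:
  fixes p :: ereal and \<gamma> b :: real
  assumes "1 \<le> p" and "\<gamma> > 0"
    and "(\<gamma> < 1 \<and> b < 1) \<or> (\<gamma> = 1 \<and> b < 1 \<and> b \<notin> Eset p) \<or> (\<gamma> > 1 \<and> b < 0)"
  shows "\<forall>R > 0. \<forall>g r. is_graph g \<and> r \<in> fst g \<longrightarrow>
           (\<lambda>N. fin_ball_prob N \<gamma> b p R g r) \<longlonglongrightarrow> inf_ball_prob \<gamma> R g r"
proof (intro allI impI)
  fix R :: real and g r assume R: "R > 0" and g: "is_graph g \<and> r \<in> fst g"
  show "(\<lambda>N. fin_ball_prob N \<gamma> b p R g r) \<longlonglongrightarrow> inf_ball_prob \<gamma> R g r"
  proof (cases "finite (fst g)")
    case False
    then show ?thesis using infinite_target_probs[OF _ False R] g by simp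
  next
    case fin: True
    \<comment> \<open>At rate 0 the second alternative of \<open>up\<close> always holds, since long
      lengths are nonnegative.\<close>
    have long0: "(0 - \<epsilon>) * real N \<le> long_len L S" if "S \<subseteq> LR N" "\<epsilon> > 0" for \<epsilon> L N S
    proof -
      have "0 \<le> long_len L S" unfolding long_len_def by (intro sum_nonneg) auto
      moreover have "(0 - \<epsilon>) * real N \<le> 0" using that by simp
      ultimately show ?thesis by linarith
    qed
    have zero_rate: ?thesis if "b + 1 / real (k + 1) < 1" "\<gamma> < 1 \<or> k = 0" for k
    proof (rule fin_ball_prob_tendsto[OF assms(1,2) R fin, of 0])
      show "eventually (\<lambda>N. exp (- ((0 + \<eta>) * real N)) \<le> Zfun N \<gamma> b p) sequentially" if "\<eta> > 0" for \<eta>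
        using eventually_Zfun_ge[OF assms(1) \<open>b + 1 / real (k + 1) < 1\<close> _ that, of \<gamma>] \<open>\<gamma> < 1 \<or> k = 0\<close>
        by (auto cong: if_cong)
    qed (use long0 in \<open>auto intro!: always_eventually\<close>)
    \<comment> \<open>Negative b needs no planted edges, whatever \<gamma> is. For \<gamma> < 1
      layers cost o(N), so any number of them may be used. Only \<gamma> = 1 with b \<ge> 0 has a
      positive rate.\<close>
    consider "b < 0" | "\<gamma> < 1" "b < 1" | "\<gamma> = 1" "0 \<le> b" "b < 1" "b \<notin> Eset p"
      using assms(3) by linarith
    then show ?thesis
    proof cases
      case 1
      then show ?thesis using zero_rate[of 0] by simp
    next
      case 2
      \<comment> \<open>Enough layers to bring the diameter exponent 1/(k+1) below 1 - b.\<close>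
      obtain k :: nat where "1 / (1 - b) < real k" using reals_Archimedean2 by blast
      then have "1 < real k * (1 - b)" using 2 by (simp add: divide_less_eq)
      also have "\<dots> \<le> real (k + 1) * (1 - b)" using 2 by (intro mult_right_mono) auto
      finally have "1 / real (k + 1) < 1 - b" by (simp add: divide_less_eq mult.commute)
      then show ?thesis using zero_rate[of k] 2 by simp
    next
      case 3
      obtain k :: nat where k: "k \<ge> 1" "b + 1 / real k > 1" "b + 1 / real (k + 1) < 1"
        using exists_level[OF 3(3,2)] not_in_Eset[OF assms(1) 3(4)] by blast
      show ?thesis
      proof (rule fin_ball_prob_tendsto[OF assms(1,2) R fin, of "real k"])
        show "eventually (\<lambda>N. exp (- ((real k + \<eta>) * real N)) \<le> Zfun N \<gamma> b p) sequentially" if "\<eta> > 0" for \<eta>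
          using eventually_Zfun_ge[OF assms(1) k(3) _ that, of \<gamma>] 3(1) by simp
        show "eventually (\<lambda>N. \<forall>S\<subseteq>LR N. (real k + 1) * real N \<le> real N powr b * Hp p (fin_graph N S)
            \<or> (real k - \<epsilon>) * real N \<le> long_len L S) sequentially" if "\<epsilon> > 0" "L \<ge> 1" for \<epsilon> L
          by (rule eventually_energy_or_long_len[OF assms(1) k(1) that k(2)])
      qed (use k(1) 3(1) in auto)
    qed
  qed
qed

end
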